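(* The value of the optimal constant in the case $(d,p)=(1,6)$ is $$\mathbf{H}_{1,6}=3^{-\frac{1}{12}}(2\pi)^{\frac12}.$$ Moreover, extremizers for the inequality $\|Tf\|_{L^6(\mathbb{R}^{2})}\le \mathbf{H}_{1,6}\,\|f\|_{L^2(\mathbb{H}^1)}$ do not exist; that is, there is no nonzero $f\in L^2(\mathbb{H}^1)$ with $\|Tf\|_{L^6(\mathbb{R}^{2})}= \mathbf{H}_{1,6}\,\|f\|_{L^2(\mathbb{H}^1)}$.
   Context: Write $\langle y\rangle=\sqrt{1+|y|^2}$. The hyperboloid is $\mathbb{H}^1=\{(y,y')\in\mathbb{R}\times\mathbb{R}: y'=\sqrt{1+y^2}\}$, equipped with the Lorentz invariant measure $\sigma$ given by $\int_{\mathbb{H}^1}\varphi\,d\sigma=\int_{\mathbb{R}}\varphi(y,\langle y\rangle)\frac{dy}{\langle y\rangle}$. A function $f:\mathbb{H}^1\to\mathbb{C}$ is identified with the function $y\mapsto f(y,\langle y\rangle)$ on $\mathbb{R}$, and $\|f\|_{L^2(\mathbb{H}^1)}=\left(\int_{\mathbb{R}}|f(y)|^2\frac{dy}{\langle y\rangle}\right)^{1/2}$. The Fourier extension operator is $$Tf(x,t)=\int_{\mathbb{R}}e^{ixy}e^{it\langle y\rangle}f(y)\frac{dy}{\langle y\rangle},\qquad (x,t)\in\mathbb{R}\times\mathbb{R},$$ for Schwartz $f$; it extends by density to a bounded operator from $L^2(\mathbb{H}^1)$ to $L^6(\mathbb{R}^2)$ (Strichartz). The optimal constant is $\mathbf{H}_{1,6}=\sup_{0\ne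 f\in L^2(\mathbb{H}^1)}\|Tf\|_{L^6(\mathbb{R}^2)}/\|f\|_{L^2(\mathbb{H}^1)}$. *)

theory Defs
  imports "HOL-Analysis.Analysis"
begin

definition jbracket :: "real \<Rightarrow> real" where
  "jbracket y = sqrt (1 + y\<^sup>2)"

text \<open>
  Functions on the hyperboloid are identified with functions on the real line via
  the parametrization sending \<open>y\<close> to \<open>(y, jbracket y)\<close>; the Lorentz invariant measure
  is written in this coordinate.
\<close>

definition hyp_measure :: "real measure" where
  "hyp_measure = density lborel (\<lambda>y. ennreal (1 / jbracket y))"

text \<open>
  Elements of \<open>Lp\<close> spaces are represented by measurable functions, without passing to the
  quotient by almost everywhere equality. The real-valued norm is only meaningful on
  \<open>Lp_space M p\<close>, since the Bochner integral of a non-integrable function is 0.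
\<close>

definition Lp_space :: "'a measure \<Rightarrow> real \<Rightarrow> ('a \<Rightarrow> complex) set" where
  "Lp_space M p = {f \<in> borel_measurable M. integrable M (\<lambda>x. norm (f x) powr p)}"

definition Lp_norm :: "'a measure \<Rightarrow> real \<Rightarrow> ('a \<Rightarrow> complex) \<Rightarrow> real" where
  "Lp_norm M p f = (LINT x|M. norm (f x) powr p) powr (1 / p)"

definition Lp_tendsto ::
    "'a measure \<Rightarrow> real \<Rightarrow> (nat \<Rightarrow> 'a \<Rightarrow> complex) \<Rightarrow> ('a \<Rightarrow> complex) \<Rightarrow> bool" where
  "Lp_tendsto M p g f \<longleftrightarrow>
     f \<in> Lp_space M p \<and> (\<forall>n. g n \<in> Lp_space M p) \<and>
     (\<lambda>n. Lp_norm M p (\<lambda>x. g n x - f x)) \<longlonglongrightarrow> 0"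

text \<open>In the next definition, \<open>D n\<close> is the \<open>n\<close>-th derivative of \<open>f\<close>.\<close>

definition schwartz :: "(real \<Rightarrow> complex) \<Rightarrow> bool" where
  "schwartz f \<longleftrightarrow>
     (\<exists>D :: nat \<Rightarrow> real \<Rightarrow> complex. D 0 = f \<and>
        (\<forall>n y. (D n has_vector_derivative D (Suc n) y) (at y)) \<and>
        (\<forall>n k. bounded (range (\<lambda>y. y ^ k *\<^sub>R D n y))))"

definition extension_integral :: "(real \<Rightarrow> complex) \<Rightarrow> real \<times> real \<Rightarrow> complex" where
  "extension_integral f = (\<lambda>(x, t).
     LINT y|hyp_measure.
       exp (\<i> * complex_of_real (x * y)) * exp (\<i> * complex_of_real (t * jbracket y)) * f y)"

text \<open>
  The extension by density: \<open>F\<close> is the image of \<open>f\<close> if it is the limit in \<open>L6\<close> of the images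
  of Schwartz functions converging to \<open>f\<close> in \<open>L2\<close>. By the Strichartz inequality and the
  density of Schwartz functions, such an \<open>F\<close> exists for every \<open>f\<close> in \<open>L2\<close> and is unique
  up to almost everywhere equality, so the choice of representative is immaterial.
\<close>

definition is_extension :: "(real \<Rightarrow> complex) \<Rightarrow> (real \<times> real \<Rightarrow> complex) \<Rightarrow> bool" where
  "is_extension f F \<longleftrightarrow>
     (\<exists>g. (\<forall>n. schwartz (g n)) \<and> Lp_tendsto hyp_measure 2 g f \<and>
          Lp_tendsto lborel 6 (\<lambda>n. extension_integral (g n)) F)"

definition extension_op :: "(real \<Rightarrow> complex) \<Rightarrow> real \<times> real \<Rightarrow> complex" where
  "extension_op f = (SOME F. is_extension f F)"

definition nonzero_L2 :: "(real \<Rightarrow> complex) set" where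
  "nonzero_L2 = {f \<in> Lp_space hyp_measure 2. \<not> (AE y in hyp_measure. f y = 0)}"

definition optimal_constant :: ereal where
  "optimal_constant =
     (SUP f \<in> nonzero_L2. ereal (Lp_norm lborel 6 (extension_op f) / Lp_norm hyp_measure 2 f))"

end

theory Submission
  imports Defs "HOL-Probability.Characteristic_Functions"
begin

text \<open>
  For a test function \<open>f\<close>, the cube of the extension of \<open>f\<close> is the Fourier transform of the threefold
  convolution of \<open>f \<sigma>\<close>. Inserting a Gaussian damping on the \<open>(x, t)\<close> side and using
  \<open>2 \<bar>h h'\<bar> \<le> \<bar>h\<bar>\<^sup>2 + \<bar>h'\<bar>\<^sup>2\<close> on the other side, then removing the damping, bounds the sixth power of the
  \<open>L6\<close> norm by \<open>(2 \<pi>)\<^sup>2 \<integral> \<bar>f \<otimes> f \<otimes> f\<bar>\<^sup>2 K\<close>, where \<open>K\<close> is any continuous majorant of the density of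
  \<open>\<sigma> * \<sigma> * \<sigma>\<close>. At mass \<open>m \<ge> 3\<close> this density is an elliptic integral bounded by
  \<open>4 \<pi> / sqrt ((m + 1)\<^sup>2 - 4)\<close>, which is strictly below its value \<open>2 \<pi> / sqrt 3\<close> at \<open>m = 3\<close>. The mass
  exceeds 3 for almost every triple of points, so the inequality is strict, and the positive deficit
  survives the passage from Schwartz functions to \<open>L2\<close> by Fatou's lemma. Gaussians
  concentrating at the vertex of the hyperboloid converge, after a parabolic rescaling, to the extension
  of a Gaussian from a parabola, whose \<open>L6\<close> norm is explicit and shows that the constant is optimal.
\<close>

section \<open>Substitution and light-cone coordinates\<close>

text \<open>Plancherel would express the sixth power of the L6 norm through the density of the
  pushforward of \<open>cube f\<close>, which calls for disintegrating the product measure along the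
  level sets of (u, v). Damping avoids this: against a finite Gaussian measure the square expands by
  Fubini into an integral over pairs of triples, with a positive symmetric kernel depending only on
  the differences of their (u, v). A Schur test then needs nothing but an upper bound for the
  pushforward of the product measure, which is why the substitutions are stated as inequalities. The
  Schur step is lossy unless the tensor cube is constant along the level sets. This is harmless for
  the constant, since Gaussians on the parabola have that property and they are the limit of the
  test functions. A second obstacle is that \<open>extension_op\<close> is a choice among limits, so
  nothing can be said about it before a limit is known to exist. Density of Schwartz functions in L2
  and completeness of L6 serve only for that; the strict inequality is proved for every candidate
  limit.\<close>

lemma nn_integral_substitution_le:
  fixes f g g' :: "real \<Rightarrow> real"
  assumes S: "S \<in> sets borel"
    and der: "\<And>x. x \<in> S \<Longrightarrow> (g has_field_derivative g' x) (at x)"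
    and inj: "inj_on g S"
    and f [measurable]: "f \<in> borel_measurable borel" and f0: "\<And>x. 0 \<le> f x"
  shows "(\<integral>\<^sup>+x\<in>S. ennreal (\<bar>g' x\<bar> * f (g x)) \<partial>lborel) \<le> (\<integral>\<^sup>+x. ennreal (f x) \<partial>lborel)"
proof (cases "(\<integral>\<^sup>+x. ennreal (f x) \<partial>lborel) = \<infinity>")
  case False
  have SL: "S \<in> sets lebesgue" using S by simp
  have der': "\<And>x. x \<in> S \<Longrightarrow> (g has_field_derivative g' x) (at x within S)"
    using der has_field_derivative_at_within by blast
  have gS: "g ` S \<in> sets lebesgue"
  proof (rule differentiable_image_in_sets_lebesgue[OF SL])
    show "g differentiable_on S"
      using der' by (auto simp: differentiable_on_def real_differentiable_def)
  qed auto
  have "integrable lborel f"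
    using False f0 by (intro integrableI_nonneg) (auto simp: less_top)
  then have "integrable lebesgue f" by (simp add: integrable_completion)
  then have "f absolutely_integrable_on UNIV" by (simp add: set_integrable_def)
  then have abs: "f absolutely_integrable_on (g ` S)"
    using set_integrable_subset gS by (metis subset_UNIV)
  define I where "I = integral (g ` S) f"
  have 1: "(f has_integral I) (g ` S)"
    using abs unfolding I_def by (simp add: set_lebesgue_integral_eq_integral(1) integrable_integral)
  have "(\<lambda>x. \<bar>g' x\<bar> * f (g x)) absolutely_integrable_on S \<and> integral S (\<lambda>x. \<bar>g' x\<bar> * f (g x)) = I"
    using has_absolute_integral_change_of_variables_1'[OF SL der' inj, where f=f and b=I] abs I_def by auto
  then have 2: "((\<lambda>x. \<bar>g' x\<bar> * f (g x)) has_integral I) S"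
    by (metis set_lebesgue_integral_eq_integral(1) integrable_integral)
  have "(\<integral>\<^sup>+x\<in>S. ennreal (\<bar>g' x\<bar> * f (g x)) \<partial>lborel) = ennreal I"
    by (rule nn_integral_has_integral_lebesgue'[OF _ 2]) (simp add: f0)
  also have "\<dots> = (\<integral>\<^sup>+x\<in>g ` S. ennreal (f x) \<partial>lborel)"
    by (rule nn_integral_has_integral_lebesgue'[OF _ 1, symmetric]) (simp add: f0)
  \<comment> \<open>Enlarging the image of \<open>S\<close> to the whole line only increases the
    integral of the nonnegative \<open>f\<close>, so the image never has to be computed.\<close>
  also have "\<dots> \<le> (\<integral>\<^sup>+x. ennreal (f x) \<partial>lborel)"
    by (intro nn_integral_mono) (simp split: split_indicator)
  finally show ?thesis .
qed simp

section \<open>The hyperboloid and its rapidity coordinate\<close>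

lemma jbracket_ge1 [simp]: "1 \<le> jbracket y"
  by (simp add: jbracket_def)

lemma jbracket_pos [simp]: "0 < jbracket y"
  using jbracket_ge1[of y] by linarith

lemma jbracket_nz [simp]: "jbracket y \<noteq> 0"
  using jbracket_pos[of y] by linarith

lemma jbracket_nonneg [simp]: "0 \<le> jbracket y"
  using jbracket_pos[of y] by linarith

lemma jbracket_sq: "(jbracket y)\<^sup>2 = 1 + y\<^sup>2"
  by (simp add: jbracket_def)

lemma jbracket_gt: "\<bar>y\<bar> < jbracket y"
  unfolding jbracket_def by (rule real_less_rsqrt) simp

lemma jbracket_measurable [measurable]: "jbracket \<in> borel_measurable borel"
  unfolding jbracket_def by measurable

lemma jbracket_deriv: "(jbracket has_field_derivative y / jbracket y) (at y)"
proof -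
  have "0 < 1 + y\<^sup>2" by (smt (verit) zero_le_power2)
  then show ?thesis
    unfolding jbracket_def[abs_def]
    by (auto intro!: derivative_eq_intros simp: divide_simps)
qed

text \<open>
  In the coordinate \<open>c = y + jbracket y\<close> one has \<open>jbracket y - y = 1 / c\<close>, the measure becomes \<open>dc / c\<close>, and
  the light-cone coordinates \<open>u = \<tau> + \<xi>\<close>, \<open>v = \<tau> - \<xi>\<close> of a sum of points are the sums of the \<open>c\<close> and
  of the \<open>1 / c\<close>.
\<close>

definition lightcone :: "real \<Rightarrow> real" where "lightcone y = y + jbracket y"

lemma lightcone_pos [simp]: "0 < lightcone y"
  using jbracket_gt[of y] by (simp add: lightcone_def)

lemma abs_lightcone [simp]: "\<bar>lightcone y\<bar> = lightcone y"
  using lightcone_pos[of y] by linarith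

lemma lightcone_nz [simp]: "lightcone y \<noteq> 0"
  using lightcone_pos[of y] by linarith

lemma lightcone_inv: "jbracket y - y = 1 / lightcone y"
proof -
  have "(jbracket y - y) * lightcone y = 1"
    using jbracket_sq[of y] by (simp add: lightcone_def algebra_simps power2_eq_square)
  then show ?thesis by (simp add: divide_simps)
qed

lemma lightcone_measurable [measurable]: "lightcone \<in> borel_measurable borel"
  unfolding lightcone_def by measurable

lemma lightcone_deriv: "(lightcone has_field_derivative lightcone y / jbracket y) (at y)"
  unfolding lightcone_def[abs_def]
  by (rule derivative_eq_intros jbracket_deriv refl)+ (simp add: divide_simps)

text \<open>Rapidity turns a Lorentz boost into a translation; because of this the pair mass below
  depends on \<open>y\<close> only through the difference \<open>arsinh y - l\<close>.\<close>

lemma lightcone_exp: "lightcone y = exp (arsinh y)"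
proof -
  have "0 < y + sqrt (y\<^sup>2 + 1)" using lightcone_pos[of y] by (simp add: lightcone_def jbracket_def add.commute)
  then show ?thesis by (simp add: arsinh_real_def lightcone_def jbracket_def add.commute)
qed

lemma lightcone_inj: "lightcone x = lightcone y \<longleftrightarrow> x = y"
  by (auto simp: lightcone_exp) (metis sinh_arsinh_real)

section \<open>Integration against the invariant measure\<close>

lemma sets_hyp_measure [simp, measurable_cong]: "sets hyp_measure = sets borel"
  by (simp add: hyp_measure_def)

lemma space_hyp_measure [simp]: "space hyp_measure = UNIV"
  by (simp add: hyp_measure_def)

lemma nn_integral_hyp:
  assumes "f \<in> borel_measurable borel"
  shows "(\<integral>\<^sup>+y. f y \<partial>hyp_measure) = (\<integral>\<^sup>+y. ennreal (1 / jbracket y) * f y \<partial>lborel)"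
  unfolding hyp_measure_def using assms by (subst nn_integral_density) auto

lemma sigma_finite_hyp: "sigma_finite_measure hyp_measure"
  unfolding hyp_measure_def
  by (subst sigma_finite_measure.sigma_finite_iff_density_finite[OF sigma_finite_lborel]) auto

interpretation hyp: sigma_finite_measure hyp_measure
  by (rule sigma_finite_hyp)

interpretation hyp2: pair_sigma_finite hyp_measure lborel
  by unfold_locales

section \<open>A continuous majorant of the threefold density\<close>

text \<open>In light-cone coordinates \<open>u * v\<close> is \<tau>^2 - \<xi>^2, so the square root
  is the mass of (\<xi>, \<tau>). For a negative product \<open>sqrt\<close> is negative, and the
  maximum absorbs that case.\<close>

definition clamped_mass :: "real \<Rightarrow> real \<Rightarrow> real" where "clamped_mass u v = max 3 (sqrt (u * v))"

text \<open>
  A majorant of the density of \<open>\<sigma> * \<sigma> * \<sigma>\<close> with respect to \<open>du dv = 2 d\<xi> d\<tau>\<close>, hence half of the density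
  in \<open>(\<xi>, \<tau>)\<close>; clamping the mass at 3 makes it continuous on the whole plane.
\<close>

definition conv_bound :: "real \<Rightarrow> real \<Rightarrow> real" where
  "conv_bound u v = 2 * pi / sqrt ((clamped_mass u v + 1)\<^sup>2 - 4)"

lemma clamped_mass_ge3: "3 \<le> clamped_mass u v" by (simp add: clamped_mass_def)

lemma conv_bound_den: "12 \<le> (clamped_mass u v + 1)\<^sup>2 - 4"
proof -
  have "4 ^ 2 \<le> (clamped_mass u v + 1)\<^sup>2" using clamped_mass_ge3[of u v] by (intro power_mono) auto
  then show ?thesis by simp
qed

lemma conv_bound_pos: "0 < conv_bound u v"
  using conv_bound_den[of u v] by (simp add: conv_bound_def)

lemma conv_bound_measurable [measurable]: "case_prod conv_bound \<in> borel_measurable (borel \<Otimes>\<^sub>M borel)"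
  unfolding conv_bound_def clamped_mass_def by measurable

lemma conv_bound_le: "conv_bound u v \<le> pi / sqrt 3"
proof -
  have "sqrt 12 \<le> sqrt ((clamped_mass u v + 1)\<^sup>2 - 4)" using conv_bound_den by simp
  moreover have "sqrt 12 = 2 * sqrt 3" by (rule real_sqrt_unique) (auto simp: power_mult_distrib)
  ultimately have *: "2 * sqrt 3 \<le> sqrt ((clamped_mass u v + 1)\<^sup>2 - 4)" by simp
  have "conv_bound u v \<le> 2 * pi / (2 * sqrt 3)"
    unfolding conv_bound_def using * conv_bound_den[of u v] by (intro divide_left_mono mult_pos_pos) auto
  then show ?thesis by simp
qed

lemma conv_bound_less:
  assumes "9 < u * v" shows "conv_bound u v < pi / sqrt 3"
proof -
  have "sqrt 9 < sqrt (u * v)" using assms by (subst real_sqrt_less_iff)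
  moreover have "sqrt 9 = (3::real)" by (rule real_sqrt_unique) auto
  ultimately have "3 < clamped_mass u v" by (simp add: clamped_mass_def)
  then have "4 ^ 2 < (clamped_mass u v + 1)\<^sup>2" by (intro power_strict_mono) auto
  then have "sqrt 12 < sqrt ((clamped_mass u v + 1)\<^sup>2 - 4)" by simp
  moreover have "sqrt 12 = 2 * sqrt 3" by (rule real_sqrt_unique) (auto simp: power_mult_distrib)
  ultimately have *: "2 * sqrt 3 < sqrt ((clamped_mass u v + 1)\<^sup>2 - 4)" by simp
  have "conv_bound u v < 2 * pi / (2 * sqrt 3)"
    unfolding conv_bound_def using * conv_bound_den[of u v] by (intro divide_strict_left_mono mult_pos_pos) auto
  then show ?thesis by simp
qed

text \<open>Needed when the damping is removed: continuity makes the Gaussian averages of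
  \<open>conv_bound\<close> converge to its value at every point.\<close>

lemma conv_bound_cont: "continuous_on UNIV (\<lambda>(u, v). conv_bound u v)"
proof -
  have "\<And>u v. sqrt ((clamped_mass u v + 1)\<^sup>2 - 4) \<noteq> 0"
    using conv_bound_den by (smt (verit) real_sqrt_eq_zero_cancel_iff)
  then show ?thesis
    unfolding conv_bound_def case_prod_beta clamped_mass_def by (intro continuous_intros) auto
qed

section \<open>The two-point density and the elliptic integral\<close>

definition pair_mass :: "real \<Rightarrow> real \<Rightarrow> real \<Rightarrow> real" where
  "pair_mass u v c = (u - c) * (v - 1 / c)"

text \<open>
  Density of \<open>\<sigma> * \<sigma>\<close> with respect to \<open>du dv\<close> at the point left over after the third summand \<open>c\<close> has been
  removed; \<open>pair_mass\<close> is the squared mass of that point.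
\<close>

definition pair_density :: "real \<Rightarrow> real \<Rightarrow> real \<Rightarrow> real" where
  "pair_density u v c = (if c < u \<and> 1 / c < v \<and> 4 < pair_mass u v c
     then 2 / sqrt (pair_mass u v c * (pair_mass u v c - 4)) else 0)"

lemma pair_density_measurable [measurable]:
  assumes [measurable]: "f \<in> borel_measurable M" "g \<in> borel_measurable M" "h \<in> borel_measurable M"
  shows "(\<lambda>x. pair_density (f x) (g x) (h x)) \<in> borel_measurable M"
  unfolding pair_density_def pair_mass_def by measurable

lemma pair_density_nonneg: "0 \<le> pair_density u v c"
  by (simp add: pair_density_def)

text \<open>
  With \<open>q = sinh ((arsinh y - l) / 2)\<close>, where \<open>l\<close> is the rapidity of \<open>(u, v)\<close>, the squared mass is
  \<open>w = (m - 1)\<^sup>2 - 4 m q\<^sup>2\<close>. The elementary bound \<open>w ((m + 1)\<^sup>2 - w) \<ge> 4 ((m + 1)\<^sup>2 - 4)\<close> on \<open>4 \<le> w \<le> (m - 1)\<^sup>2\<close>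
  turns the elliptic integrand into the derivative of an arcsine.
\<close>

lemma pair_density_integral_le:
  "(\<integral>\<^sup>+y. ennreal (pair_density u v (lightcone y)) \<partial>hyp_measure) \<le> ennreal (conv_bound u v)"
proof -
  define S where "S = {y. lightcone y < u \<and> 1 / lightcone y < v \<and> 4 < pair_mass u v (lightcone y)}"
  have S [measurable]: "S \<in> sets borel" unfolding S_def pair_mass_def by measurable
  show ?thesis
  proof (cases "S = {}")
    case True
    then have "\<And>y. pair_density u v (lightcone y) = 0" by (auto simp: S_def pair_density_def)
    then show ?thesis by simp
  next
    case False
    then obtain y0 where y0: "lightcone y0 < u" "1 / lightcone y0 < v" "4 < pair_mass u v (lightcone y0)" by (auto simp: S_def)
    have u0: "0 < u" using y0(1) lightcone_pos[of y0] by linarith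
    have v0: "0 < v" using y0(2) lightcone_pos[of y0] by (smt (verit) divide_nonneg_nonneg)
    define m where "m = sqrt (u * v)"
    have m0: "0 < m" using u0 v0 by (simp add: m_def)
    have m2: "u * v = m\<^sup>2" using u0 v0 by (simp add: m_def)
    define l where "l = ln (u / m)"
    have el: "exp l = u / m" using u0 m0 by (simp add: l_def)
    have eml: "exp (- l) = v / m" using u0 m0 m2 by (simp add: exp_minus el field_simps power2_eq_square)
    define q where "q y = sinh ((arsinh y - l) / 2)" for y :: real
    have chq: "cosh ((arsinh y - l) / 2) = sqrt (1 + (q y)\<^sup>2)" for y
      by (metis q_def cosh_square_eq cosh_real_nonneg add.commute real_sqrt_unique)
    have w: "pair_mass u v (lightcone y) = (m - 1)\<^sup>2 - 4 * m * (q y)\<^sup>2" for y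
    proof -
      have "cosh (arsinh y - l) = 1 + 2 * (q y)\<^sup>2"
      proof -
        have "2 * ((arsinh y - l) / 2) = arsinh y - l" by simp
        then show ?thesis
          using cosh_double[of "(arsinh y - l) / 2"] cosh_square_eq[of "(arsinh y - l) / 2"]
          by (simp only: q_def)
      qed
      moreover have "cosh (arsinh y - l) = (lightcone y * v / m + u / m / lightcone y) / 2"
      proof -
        have "exp (arsinh y - l) = lightcone y * (v / m)" unfolding lightcone_exp eml[symmetric] by (simp flip: exp_add)
        moreover have "exp (- (arsinh y - l)) = u / m / lightcone y" using el
          by (simp add: lightcone_exp exp_diff exp_minus)
        ultimately show ?thesis by (simp add: cosh_field_def)
      qed
      ultimately have "lightcone y * v + u / lightcone y = 2 * m * (1 + 2 * (q y)\<^sup>2)"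
        using m0 by (simp add: field_simps)
      moreover have "pair_mass u v (lightcone y) = m\<^sup>2 + 1 - (lightcone y * v + u / lightcone y)"
        by (simp add: pair_mass_def m2[symmetric] field_simps)
      ultimately show ?thesis by (simp add: power2_eq_square algebra_simps)
    qed
    \<comment> \<open>A point of \<open>S\<close> forces mass above 3: its pair mass exceeds 4 but
      is at most \<open>(m - 1)\<^sup>2\<close>, and \<open>m\<close> is positive. Hence the clamp
      in \<open>conv_bound\<close> is inactive.\<close>
    have "4 < (m - 1)\<^sup>2" using y0(3) w[of y0] m0 by (smt (verit) mult_nonneg_nonneg zero_le_power2)
    then have "2 < \<bar>m - 1\<bar>" using abs_le_square_iff[of "m-1" 2] by auto
    then have m3: "3 < m" using m0 by linarith
    have conv_bound: "conv_bound u v = 2 * pi / sqrt ((m + 1)\<^sup>2 - 4)"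
      using m3 by (simp add: conv_bound_def clamped_mass_def m_def)
    define D where "D = sqrt ((m + 1)\<^sup>2 - 4)"
    have "16 < (m + 1)\<^sup>2" using power_strict_mono[of 4 "m+1" 2] m3 by simp
    then have D0: "0 < D" by (simp add: D_def)
    have D2: "D\<^sup>2 = (m + 1)\<^sup>2 - 4" using \<open>16 < (m + 1)\<^sup>2\<close> by (simp add: D_def)
    \<comment> \<open>The value of |q| at which the pair mass drops to 4, so \<open>S\<close> lies
      inside |q| < s.\<close>
    define s where "s = sqrt (((m - 1)\<^sup>2 - 4) / (4 * m))"
    have s0: "0 < s" using \<open>4 < (m - 1)\<^sup>2\<close> m0 by (simp add: s_def)
    have s2: "4 * m * s\<^sup>2 = (m - 1)\<^sup>2 - 4" using \<open>4 < (m - 1)\<^sup>2\<close> m0 by (simp add: s_def)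
    have w4: "pair_mass u v (lightcone y) - 4 = 4 * m * (s\<^sup>2 - (q y)\<^sup>2)" for y
      using w[of y] s2 by (simp add: algebra_simps)
    have qs: "(q y)\<^sup>2 < s\<^sup>2" if "y \<in> S" for y
    proof -
      have "0 < pair_mass u v (lightcone y) - 4" using that by (simp add: S_def)
      then show ?thesis unfolding w4 using m0 by (simp add: zero_less_mult_iff)
    qed
    have qs1: "- 1 < q y / s \<and> q y / s < 1" if "y \<in> S" for y
    proof -
      have "\<bar>q y\<bar> < s" using qs[OF that] s0 abs_le_square_iff[of s "q y"] by (simp add: not_le[symmetric])
      then show ?thesis using s0 by (auto simp: divide_simps abs_less_iff)
    qed
    \<comment> \<open>The singular factor sqrt (w - 4) of the density is a multiple of sqrt (s^2 -
      q^2), which is the denominator in the derivative of arcsin (q / s).\<close>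
    define g where "g y = arcsin (q y / s)" for y
    define g' where "g' y = sqrt (1 + (q y)\<^sup>2) / (2 * sqrt (s\<^sup>2 - (q y)\<^sup>2) * jbracket y)" for y
    have der: "(g has_field_derivative g' y) (at y)" if "y \<in> S" for y
    proof -
      have jb: "sqrt (y\<^sup>2 + 1) = jbracket y" by (simp add: jbracket_def add.commute)
      have dq: "(q has_field_derivative sqrt (1 + (q y)\<^sup>2) / 2 / jbracket y) (at y)"
        unfolding q_def[abs_def]
        by (auto intro!: derivative_eq_intros simp: chq[unfolded q_def] jb)
      have "sqrt (s\<^sup>2 - (q y)\<^sup>2) = s * sqrt (1 - (q y / s)\<^sup>2)"
      proof -
        have "s\<^sup>2 - (q y)\<^sup>2 = s\<^sup>2 * (1 - (q y / s)\<^sup>2)" using s0 by (simp add: field_simps)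
        then show ?thesis using s0 by (simp add: real_sqrt_mult)
      qed
      then have g'eq: "g' y = inverse (sqrt (1 - (q y / s)\<^sup>2)) * (sqrt (1 + (q y)\<^sup>2) / 2 / jbracket y / s)"
        using s0 by (simp add: g'_def field_simps)
      have "((\<lambda>y. q y / s) has_field_derivative sqrt (1 + (q y)\<^sup>2) / 2 / jbracket y / s) (at y)"
        using dq s0 by (intro DERIV_cdivide)
      from DERIV_chain2[OF DERIV_arcsin this] qs1[OF that] show ?thesis
        unfolding g_def[abs_def] g'eq by blast
    qed
    have inj: "inj_on g S"
    proof (rule inj_onI)
      fix x y assume xy: "x \<in> S" "y \<in> S" "g x = g y"
      have "sin (g x) = q x / s" "sin (g y) = q y / s"
        using qs1[OF xy(1)] qs1[OF xy(2)] by (auto simp: g_def)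
      then have "q x = q y" using xy(3) s0 by simp
      then have "arsinh x = arsinh y" by (simp add: q_def)
      then have "lightcone x = lightcone y" by (simp add: lightcone_exp)
      then show "x = y" by (simp add: lightcone_inj)
    qed
    \<comment> \<open>Constant on the range of the arcsine, so that its integral
      \<open>2 / D * pi\<close> is exactly \<open>conv_bound u v\<close>.\<close>
    define f where "f x = 2 / D * indicator {- (pi / 2)..pi / 2} x" for x :: real
    have f: "f \<in> borel_measurable borel" unfolding f_def by measurable
    have pw: "1 / jbracket y * pair_density u v (lightcone y) \<le> \<bar>g' y\<bar> * f (g y)" if "y \<in> S" for y
    proof -
      have fg: "f (g y) = 2 / D"
        using arcsin_bounded[of "q y / s"] qs1[OF that] by (simp add: f_def g_def)
      define w' where "w' = pair_mass u v (lightcone y)"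
      have w4': "4 < w'" using that by (simp add: S_def w'_def)
      have wle: "w' \<le> (m - 1)\<^sup>2" using w[of y] m0 by (simp add: w'_def)
      have a1: "(m + 1)\<^sup>2 - w' = 4 * m * (1 + (q y)\<^sup>2)"
        using w[of y] by (simp add: w'_def power2_eq_square algebra_simps)
      \<comment> \<open>Expanding the product gives
        \<open>w' * ((m + 1)\<^sup>2 - w') - 4 * ((m + 1)\<^sup>2 - 4)\<close>, and its second
        factor is at least \<open>4 * m - 4\<close>. Equality holds at \<open>w' = 4\<close>, and
        the range of \<open>w'\<close> shrinks to 4 as \<open>m\<close> decreases to 3, so nothing
        is lost in the extreme value of the bound.\<close>
      have "0 \<le> (w' - 4) * ((m + 1)\<^sup>2 - 4 - w')"
        using w4' wle m3 by (intro mult_nonneg_nonneg) (auto simp: power2_eq_square algebra_simps)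
      then have "4 * D\<^sup>2 \<le> w' * (4 * m * (1 + (q y)\<^sup>2))"
        unfolding a1[symmetric] D2 by (simp add: algebra_simps)
      then have "sqrt (4 * D\<^sup>2) \<le> sqrt (w' * (4 * m * (1 + (q y)\<^sup>2)))" by simp
      then have a2: "2 * D \<le> sqrt w' * sqrt (4 * m) * sqrt (1 + (q y)\<^sup>2)"
        using D0 by (simp add: real_sqrt_mult)
      have a3: "sqrt (w' * (w' - 4)) = sqrt w' * sqrt (4 * m) * sqrt (s\<^sup>2 - (q y)\<^sup>2)"
        unfolding w'_def w4 by (simp add: real_sqrt_mult)
      have b: "0 < sqrt w'" "0 < sqrt (4 * m)" "0 < sqrt (s\<^sup>2 - (q y)\<^sup>2)" "0 \<le> sqrt (1 + (q y)\<^sup>2)"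
        using w4' m0 qs[OF that] by auto
      have "pair_density u v (lightcone y) = 2 / (sqrt w' * sqrt (4 * m) * sqrt (s\<^sup>2 - (q y)\<^sup>2))"
        using that a3 by (simp add: pair_density_def S_def w'_def)
      also have "\<dots> = (2 * D) / (sqrt w' * sqrt (4 * m)) * (1 / (D * sqrt (s\<^sup>2 - (q y)\<^sup>2)))"
        using D0 b by (simp add: field_simps)
      also have "\<dots> \<le> sqrt (1 + (q y)\<^sup>2) * (1 / (D * sqrt (s\<^sup>2 - (q y)\<^sup>2)))"
      proof (rule mult_right_mono)
        have "2 * D \<le> sqrt (1 + (q y)\<^sup>2) * (sqrt w' * sqrt (4 * m))" using a2 by (simp only: ac_simps)
        then show "2 * D / (sqrt w' * sqrt (4 * m)) \<le> sqrt (1 + (q y)\<^sup>2)"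
          using b by (simp only: pos_divide_le_eq mult_pos_pos)
      qed (use D0 b in auto)
      finally have "1 / jbracket y * pair_density u v (lightcone y) \<le>
          1 / jbracket y * (sqrt (1 + (q y)\<^sup>2) * (1 / (D * sqrt (s\<^sup>2 - (q y)\<^sup>2))))"
        by (intro mult_left_mono) auto
      also have "\<dots> = \<bar>g' y\<bar> * f (g y)"
        unfolding fg g'_def using b D0 by (simp add: field_simps)
      finally show ?thesis .
    qed
    have "(\<integral>\<^sup>+y. ennreal (pair_density u v (lightcone y)) \<partial>hyp_measure)
        = (\<integral>\<^sup>+y. ennreal (1 / jbracket y * pair_density u v (lightcone y)) \<partial>lborel)"
      by (subst nn_integral_hyp) (auto simp: ennreal_mult[symmetric] pair_density_nonneg less_imp_le)
    also have "\<dots> \<le> (\<integral>\<^sup>+y\<in>S. ennreal (\<bar>g' y\<bar> * f (g y)) \<partial>lborel)"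
    proof (rule nn_integral_mono)
      fix y
      show "ennreal (1 / jbracket y * pair_density u v (lightcone y)) \<le> ennreal (\<bar>g' y\<bar> * f (g y)) * indicator S y"
        using pw[of y] by (cases "y \<in> S") (auto intro!: ennreal_leI simp: S_def pair_density_def)
    qed
    also have "\<dots> \<le> (\<integral>\<^sup>+x. ennreal (f x) \<partial>lborel)"
      using D0 by (intro nn_integral_substitution_le[OF S der inj f]) (auto simp: f_def)
    also have "\<dots> = (\<integral>\<^sup>+x. ennreal (2 / D) * indicator {- (pi / 2)..pi / 2} x \<partial>lborel)"
      by (intro nn_integral_cong) (simp add: f_def split: split_indicator)
    also have "\<dots> = ennreal (2 / D) * ennreal pi"
      by (simp add: nn_integral_cmult)
    also have "\<dots> = ennreal (conv_bound u v)"
      using D0 by (simp add: conv_bound D_def ennreal_mult[symmetric])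
    finally show ?thesis .
  qed
qed

section \<open>The threefold convolution of the Lorentz invariant measure\<close>

text \<open>As the measure is dc / c in the coordinate \<open>c = lightcone y\<close>, replacing the
  first point by the total \<open>u\<close> leaves the weight \<open>1 / (u - r)\<close>; here
  \<open>r\<close> stands for the sum of the other two coordinates.\<close>

lemma first_substitution:
  fixes \<phi> :: "real \<Rightarrow> real"
  assumes [measurable]: "\<phi> \<in> borel_measurable borel" and \<phi>0: "\<And>x. 0 \<le> \<phi> x"
    and r: "0 < r"
  shows "(\<integral>\<^sup>+y. ennreal (\<phi> (lightcone y)) \<partial>hyp_measure)
    \<le> (\<integral>\<^sup>+u. ennreal (indicator {r<..} u * (\<phi> (u - r) / (u - r))) \<partial>lborel)"
proof -
  define f where "f u = indicator {r<..} u * (\<phi> (u - r) / (u - r))" for u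
  have f: "f \<in> borel_measurable borel" unfolding f_def by measurable
  have "(\<integral>\<^sup>+y. ennreal (\<phi> (lightcone y)) \<partial>hyp_measure) = (\<integral>\<^sup>+y. ennreal (1 / jbracket y * \<phi> (lightcone y)) \<partial>lborel)"
    by (subst nn_integral_hyp) (auto simp: ennreal_mult[symmetric] \<phi>0)
  also have "\<dots> = (\<integral>\<^sup>+y\<in>UNIV. ennreal (\<bar>lightcone y / jbracket y\<bar> * f (lightcone y + r)) \<partial>lborel)"
    by (intro nn_integral_cong) (simp add: f_def abs_mult)
  also have "\<dots> \<le> (\<integral>\<^sup>+u. ennreal (f u) \<partial>lborel)"
  proof (rule nn_integral_substitution_le[where g="\<lambda>y. lightcone y + r"])
    show "((\<lambda>y. lightcone y + r) has_field_derivative lightcone y / jbracket y) (at y)" for y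
      by (auto intro!: derivative_eq_intros lightcone_deriv)
    show "inj_on (\<lambda>y. lightcone y + r) UNIV" by (auto simp: inj_on_def lightcone_inj)
    show "0 \<le> f x" for x by (simp add: f_def \<phi>0 split: split_indicator)
  qed (use f in auto)
  finally show ?thesis by (simp add: f_def)
qed

text \<open>
  The pairs \<open>(b, s - b)\<close> and \<open>(s - b, b)\<close> have the same image, so the substitution is injective only
  on each of the halves \<open>2 b < s\<close> and \<open>2 b > s\<close>.
\<close>

lemma second_substitution_half:
  fixes \<phi> :: "real \<Rightarrow> real"
  assumes [measurable]: "\<phi> \<in> borel_measurable borel" and \<phi>0: "\<And>x. 0 \<le> \<phi> x"
    and c: "0 < c"
    and S [measurable]: "S \<in> sets borel"
    and S1: "\<And>y. y \<in> S \<Longrightarrow> lightcone y < u - c \<and> 2 * lightcone y \<noteq> u - c"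
    and S2: "\<And>x y. x \<in> S \<Longrightarrow> y \<in> S \<Longrightarrow> lightcone x + lightcone y \<noteq> u - c"
  shows "(\<integral>\<^sup>+y. ennreal (indicator S y * (\<phi> (1 / c + 1 / lightcone y + 1 / (u - c - lightcone y)) / (u - c - lightcone y))) \<partial>hyp_measure)
    \<le> (\<integral>\<^sup>+v. ennreal (\<phi> v * (pair_density u v c / 2)) \<partial>lborel)"
proof -
  define s where "s = u - c"
  define f where "f v = \<phi> v * (pair_density u v c / 2)" for v
  have f: "f \<in> borel_measurable borel" unfolding f_def by measurable
  define g where "g y = 1 / c + 1 / lightcone y + 1 / (s - lightcone y)" for y
  define g' where "g' y = (1 / (s - lightcone y)\<^sup>2 - 1 / (lightcone y)\<^sup>2) * (lightcone y / jbracket y)" for y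
  have der: "(g has_field_derivative g' y) (at y)" if "y \<in> S" for y
  proof -
    have "((\<lambda>b. 1 / c + 1 / b + 1 / (s - b)) has_field_derivative 1 / (s - b)\<^sup>2 - 1 / b\<^sup>2) (at b)"
      if "0 < b" "b < s" for b
      using that by (auto intro!: derivative_eq_intros simp: power2_eq_square)
    from DERIV_chain2[OF this[of "lightcone y"] lightcone_deriv] S1[OF that] show ?thesis
      unfolding g_def[abs_def] g'_def by (simp add: s_def)
  qed
  have inj: "inj_on g S"
  proof (rule inj_onI)
    fix x y assume xy: "x \<in> S" "y \<in> S" "g x = g y"
    define a b where "a = lightcone x" and "b = lightcone y"
    have ab: "0 < a" "0 < b" "a < s" "b < s" "a + b \<noteq> s"
      using S1[OF xy(1)] S1[OF xy(2)] S2[OF xy(1,2)] by (auto simp: a_def b_def s_def)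
    have e: "1 / a + 1 / (s - a) = s / (a * (s - a))" "1 / b + 1 / (s - b) = s / (b * (s - b))"
      using ab by (auto simp: field_simps)
    have "1 / a + 1 / (s - a) = 1 / b + 1 / (s - b)" using xy(3) by (simp add: g_def a_def b_def)
    then have "s / (a * (s - a)) = s / (b * (s - b))" unfolding e .
    then have "a * (s - a) = b * (s - b)" using ab by (simp add: divide_simps)
    then have "(a - b) * (s - (a + b)) = 0" by (simp add: algebra_simps)
    then have "a = b" using ab by simp
    then show "x = y" by (simp add: a_def b_def lightcone_inj)
  qed
  have pw: "1 / jbracket y * (\<phi> (g y) / (s - lightcone y)) = \<bar>g' y\<bar> * f (g y)" if "y \<in> S" for y
  proof -
    define b where "b = lightcone y"
    have b: "0 < b" "b < s" "2 * b \<noteq> s" using S1[OF that] by (auto simp: b_def s_def)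
    have cu: "c < u" using b by (simp add: s_def)
    \<comment> \<open>The squared mass of the two points \<open>b\<close> and \<open>s - b\<close>,
      equal to 4 exactly when they coincide. The factor |s - 2 b| in sqrt (w (w - 4)) is the one by
      which the Jacobian vanishes there, so the two cancel.\<close>
    define w where "w = s\<^sup>2 / (b * (s - b))"
    have gy: "g y - 1 / c = s / (b * (s - b))" using b by (simp add: g_def b_def[symmetric] field_simps)
    have weq: "pair_mass u (g y) c = w" unfolding pair_mass_def gy s_def[symmetric] w_def by (simp add: power2_eq_square)
    have w4: "w - 4 = (s - 2 * b)\<^sup>2 / (b * (s - b))"
      using b by (simp add: w_def field_simps power2_eq_square)
    then have w4': "4 < w" using b by (smt (verit) divide_pos_pos mult_pos_pos zero_less_power2)
    have "0 < s / (b * (s - b))" using b by simp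
    then have cg: "1 / c < g y" using gy by linarith
    have "w * (w - 4) = (s * (s - 2 * b) / (b * (s - b)))\<^sup>2"
      unfolding w4 unfolding w_def by (simp add: power2_eq_square field_simps)
    then have sq: "sqrt (w * (w - 4)) = s * \<bar>s - 2 * b\<bar> / (b * (s - b))"
      using b by (simp add: abs_mult)
    have pd: "pair_density u (g y) c / 2 = b * (s - b) / (s * \<bar>s - 2 * b\<bar>)"
      using cu cg w4' by (simp add: pair_density_def weq sq)
    have "1 / (s - b)\<^sup>2 - 1 / b\<^sup>2 = s * (2 * b - s) / (b\<^sup>2 * (s - b)\<^sup>2)"
      using b by (simp add: divide_simps) (simp add: power2_eq_square algebra_simps)
    then have gA: "\<bar>g' y\<bar> = s * \<bar>s - 2 * b\<bar> / (b\<^sup>2 * (s - b)\<^sup>2) * (b / jbracket y)"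
      unfolding g'_def b_def[symmetric] using b by (simp add: abs_mult abs_minus_commute)
    have "\<bar>g' y\<bar> * (pair_density u (g y) c / 2) = 1 / (jbracket y * (s - b))"
      unfolding pd gA using b by (simp add: divide_simps power2_eq_square)
    then show ?thesis unfolding f_def b_def[symmetric] by (simp add: mult.left_commute[of _ "\<phi> _"])
  qed
  have "(\<integral>\<^sup>+y. ennreal (indicator S y * (\<phi> (g y) / (s - lightcone y))) \<partial>hyp_measure)
     = (\<integral>\<^sup>+y. ennreal (1 / jbracket y * (indicator S y * (\<phi> (g y) / (s - lightcone y)))) \<partial>lborel)"
  proof (subst nn_integral_hyp)
    have nn: "0 \<le> indicator S y * (\<phi> (g y) / (s - lightcone y))" for y
      using S1[of y] \<phi>0 by (auto simp: s_def split: split_indicator)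
    show "(\<integral>\<^sup>+y. ennreal (1 / jbracket y) * ennreal (indicator S y * (\<phi> (g y) / (s - lightcone y))) \<partial>lborel)
     = (\<integral>\<^sup>+y. ennreal (1 / jbracket y * (indicator S y * (\<phi> (g y) / (s - lightcone y)))) \<partial>lborel)"
      by (intro nn_integral_cong ennreal_mult[symmetric] nn) simp
  qed (simp add: g_def)
  also have "\<dots> = (\<integral>\<^sup>+y\<in>S. ennreal (\<bar>g' y\<bar> * f (g y)) \<partial>lborel)"
    using pw by (intro nn_integral_cong) (simp split: split_indicator)
  also have "\<dots> \<le> (\<integral>\<^sup>+v. ennreal (f v) \<partial>lborel)"
    by (rule nn_integral_substitution_le[OF S der inj f]) (auto simp: f_def \<phi>0 pair_density_nonneg)
  finally show ?thesis by (simp add: f_def g_def s_def)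
qed

lemma second_substitution:
  fixes \<phi> :: "real \<Rightarrow> real"
  assumes [measurable]: "\<phi> \<in> borel_measurable borel" and \<phi>0: "\<And>x. 0 \<le> \<phi> x"
    and c: "0 < c"
  shows "(\<integral>\<^sup>+y. ennreal (indicator {lightcone y + c<..} u * (\<phi> (1 / c + 1 / lightcone y + 1 / (u - c - lightcone y)) / (u - c - lightcone y))) \<partial>hyp_measure)
    \<le> (\<integral>\<^sup>+v. ennreal (\<phi> v * pair_density u v c) \<partial>lborel)"
proof -
  define h where "h y = \<phi> (1 / c + 1 / lightcone y + 1 / (u - c - lightcone y)) / (u - c - lightcone y)" for y
  have hm [measurable]: "h \<in> borel_measurable borel" unfolding h_def by measurable
  define S1 where "S1 = {y. 2 * lightcone y < u - c}"
  define S2 where "S2 = {y. lightcone y < u - c \<and> u - c < 2 * lightcone y}"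
  have m [measurable]: "S1 \<in> sets borel" "S2 \<in> sets borel" by (auto simp: S1_def S2_def)
  have b1: "lightcone y < u - c" if "y \<in> S1" for y
    using that lightcone_pos[of y] unfolding S1_def mem_Collect_eq by linarith
  have b2: "lightcone y + c < u" if "2 * lightcone y < u - c" for y
    using that lightcone_pos[of y] by linarith
  \<comment> \<open>The fold between the two halves is at most one point, because
    \<open>lightcone\<close> is injective, and hence a null set.\<close>
  have ae: "AE y in hyp_measure. 2 * lightcone y \<noteq> u - c"
  proof -
    have "AE y in lborel. 2 * lightcone y \<noteq> u - c"
    proof (cases "\<exists>y. 2 * lightcone y = u - c")
      case True
      then obtain z where "2 * lightcone z = u - c" by blast
      then have "2 * lightcone y = u - c \<longleftrightarrow> y = z" for y using lightcone_inj[of y z] by auto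
      then show ?thesis using AE_lborel_singleton[of z] by auto
    qed auto
    then show ?thesis unfolding hyp_measure_def by (subst AE_density) auto
  qed
  have "(\<integral>\<^sup>+y. ennreal (indicator {lightcone y + c<..} u * h y) \<partial>hyp_measure)
     = (\<integral>\<^sup>+y. ennreal (indicator S1 y * h y) + ennreal (indicator S2 y * h y) \<partial>hyp_measure)"
    using ae by (intro nn_integral_cong_AE, eventually_elim)
      (use b1 b2 in \<open>auto simp: S1_def S2_def split: split_indicator\<close>)
  also have "\<dots> = (\<integral>\<^sup>+y. ennreal (indicator S1 y * h y) \<partial>hyp_measure) + (\<integral>\<^sup>+y. ennreal (indicator S2 y * h y) \<partial>hyp_measure)"
    by (intro nn_integral_add) auto
  also have "\<dots> \<le> (\<integral>\<^sup>+v. ennreal (\<phi> v * (pair_density u v c / 2)) \<partial>lborel) + (\<integral>\<^sup>+v. ennreal (\<phi> v * (pair_density u v c / 2)) \<partial>lborel)"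
    unfolding h_def
    by (intro add_mono second_substitution_half \<phi>0 c m assms(1)) (auto simp: S2_def dest: b1; simp add: S1_def S2_def)+
  also have "\<dots> = (\<integral>\<^sup>+v. ennreal (\<phi> v * pair_density u v c) \<partial>lborel)"
    by (subst nn_integral_add[symmetric]) (auto simp: \<phi>0 pair_density_nonneg ennreal_plus[symmetric] simp del: ennreal_plus)
  finally show ?thesis unfolding h_def .
qed

text \<open>Exchanging the first two points for \<open>u\<close> and \<open>v\<close> leaves the
  third, \<open>z\<close>, which Tonelli moves innermost. There it meets the two-point density, so
  the elliptic bound is the only real estimate.\<close>

lemma threefold_pushforward_le:
  fixes \<phi> :: "real \<Rightarrow> real \<Rightarrow> real"
  assumes [measurable]: "case_prod \<phi> \<in> borel_measurable (borel \<Otimes>\<^sub>M borel)" and \<phi>0: "\<And>x y. 0 \<le> \<phi> x y"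
  shows "(\<integral>\<^sup>+z. \<integral>\<^sup>+y. \<integral>\<^sup>+x. ennreal (\<phi> (lightcone x + lightcone y + lightcone z) (1 / lightcone x + 1 / lightcone y + 1 / lightcone z))
            \<partial>hyp_measure \<partial>hyp_measure \<partial>hyp_measure)
    \<le> (\<integral>\<^sup>+u. \<integral>\<^sup>+v. ennreal (\<phi> u v * conv_bound u v) \<partial>lborel \<partial>lborel)"
proof -
  define F where "F u y z = indicator {lightcone y + lightcone z<..} u *
     (\<phi> u (1 / lightcone z + 1 / lightcone y + 1 / (u - lightcone z - lightcone y)) / (u - lightcone z - lightcone y))" for u y z
  have [measurable]: "(\<lambda>x. \<phi> (f x) (g x)) \<in> borel_measurable M"
    if "f \<in> borel_measurable M" "g \<in> borel_measurable M" for M :: "'x measure" and f g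
    using measurable_compose[OF measurable_Pair[OF that] assms(1)] by simp
  have [measurable]: "(\<lambda>x. F (f x) (g x) (h x)) \<in> borel_measurable M"
    if [measurable]: "f \<in> borel_measurable M" "g \<in> borel_measurable M" "h \<in> borel_measurable M"
    for M :: "'x measure" and f g h
    unfolding F_def indicator_def greaterThan_iff by measurable
  have "(\<integral>\<^sup>+z. \<integral>\<^sup>+y. \<integral>\<^sup>+x. ennreal (\<phi> (lightcone x + lightcone y + lightcone z) (1 / lightcone x + 1 / lightcone y + 1 / lightcone z))
            \<partial>hyp_measure \<partial>hyp_measure \<partial>hyp_measure)
      \<le> (\<integral>\<^sup>+z. \<integral>\<^sup>+y. \<integral>\<^sup>+u. ennreal (F u y z) \<partial>lborel \<partial>hyp_measure \<partial>hyp_measure)"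
  proof (intro nn_integral_mono)
    fix z y
    have "(\<integral>\<^sup>+x. ennreal (\<phi> (lightcone x + (lightcone y + lightcone z)) (1 / lightcone x + 1 / lightcone y + 1 / lightcone z)) \<partial>hyp_measure)
      \<le> (\<integral>\<^sup>+u. ennreal (indicator {lightcone y + lightcone z<..} u * (\<phi> ((u - (lightcone y + lightcone z)) + (lightcone y + lightcone z)) (1 / (u - (lightcone y + lightcone z)) + 1 / lightcone y + 1 / lightcone z) / (u - (lightcone y + lightcone z)))) \<partial>lborel)"
      by (rule first_substitution) (auto simp: \<phi>0 add_pos_pos)
    also have "\<dots> = (\<integral>\<^sup>+u. ennreal (F u y z) \<partial>lborel)"
      by (intro nn_integral_cong) (simp add: F_def algebra_simps diff_diff_eq)
    finally show "(\<integral>\<^sup>+x. ennreal (\<phi> (lightcone x + lightcone y + lightcone z) (1 / lightcone x + 1 / lightcone y + 1 / lightcone z)) \<partial>hyp_measure) \<le> \<dots>"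
      by (simp add: add.assoc)
  qed
  also have "\<dots> = (\<integral>\<^sup>+z. \<integral>\<^sup>+u. \<integral>\<^sup>+y. ennreal (F u y z) \<partial>hyp_measure \<partial>lborel \<partial>hyp_measure)"
    by (intro nn_integral_cong hyp2.Fubini'[symmetric]) measurable
  also have "\<dots> \<le> (\<integral>\<^sup>+z. \<integral>\<^sup>+u. \<integral>\<^sup>+v. ennreal (\<phi> u v * pair_density u v (lightcone z)) \<partial>lborel \<partial>lborel \<partial>hyp_measure)"
    unfolding F_def by (intro nn_integral_mono second_substitution) (auto simp: \<phi>0)
  also have "\<dots> = (\<integral>\<^sup>+u. \<integral>\<^sup>+z. \<integral>\<^sup>+v. ennreal (\<phi> u v * pair_density u v (lightcone z)) \<partial>lborel \<partial>hyp_measure \<partial>lborel)"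
    by (intro hyp2.Fubini'[symmetric]) measurable
  also have "\<dots> = (\<integral>\<^sup>+u. \<integral>\<^sup>+v. \<integral>\<^sup>+z. ennreal (\<phi> u v * pair_density u v (lightcone z)) \<partial>hyp_measure \<partial>lborel \<partial>lborel)"
    by (intro nn_integral_cong hyp2.Fubini'[symmetric]) measurable
  also have "\<dots> \<le> (\<integral>\<^sup>+u. \<integral>\<^sup>+v. ennreal (\<phi> u v * conv_bound u v) \<partial>lborel \<partial>lborel)"
  proof (intro nn_integral_mono)
    fix u v
    have "(\<integral>\<^sup>+z. ennreal (\<phi> u v * pair_density u v (lightcone z)) \<partial>hyp_measure) = ennreal (\<phi> u v) * (\<integral>\<^sup>+z. ennreal (pair_density u v (lightcone z)) \<partial>hyp_measure)"
      by (subst nn_integral_cmult[symmetric]) (auto simp: ennreal_mult \<phi>0 pair_density_nonneg)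
    also have "\<dots> \<le> ennreal (\<phi> u v) * ennreal (conv_bound u v)"
      by (intro mult_left_mono pair_density_integral_le) auto
    finally show "(\<integral>\<^sup>+z. ennreal (\<phi> u v * pair_density u v (lightcone z)) \<partial>hyp_measure) \<le> ennreal (\<phi> u v * conv_bound u v)"
      by (simp add: ennreal_mult \<phi>0 less_imp_le[OF conv_bound_pos])
  qed
  finally show ?thesis .
qed

section \<open>Gaussian Fourier transforms and a Schur test\<close>

lemma gaussian_integrable:
  fixes a :: real assumes a: "0 < a"
  shows "integrable lborel (\<lambda>x. exp (- (a * x\<^sup>2)))"
proof -
  have "integrable lborel (\<lambda>x. sqrt (pi / a) * normal_density 0 (1 / sqrt (2 * a)) x)"
    using a by (intro integrable_mult_right integrable_normal_density) simp
  also have "(\<lambda>x. sqrt (pi / a) * normal_density 0 (1 / sqrt (2 * a)) x) = (\<lambda>x. exp (- (a * x\<^sup>2)))"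
    using a by (auto simp: normal_density_def power_divide fun_eq_iff real_sqrt_divide real_sqrt_mult power_mult_distrib)
  finally show ?thesis .
qed

text \<open>Rescaling by \<open>c = sqrt (2 * a)\<close> reduces this to the characteristic function
  of the standard normal distribution.\<close>

lemma gaussian_fourier:
  fixes a b :: real assumes a: "0 < a"
  shows "(LINT x|lborel. exp (\<i> * complex_of_real (b * x)) * complex_of_real (exp (- (a * x\<^sup>2))))
     = complex_of_real (sqrt (pi / a) * exp (- (b\<^sup>2 / (4 * a))))" (is "?I = _")
proof -
  define c where "c = sqrt (2 * a)"
  have c: "0 < c" and c2: "c\<^sup>2 = 2 * a" using a by (auto simp: c_def)
  define t where "t = b / c"
  have "complex_of_real (exp (- (t\<^sup>2) / 2)) = char std_normal_distribution t"
    by (simp add: char_std_normal_distribution)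
  also have "\<dots> = (LINT x|lborel. std_normal_density x *\<^sub>R iexp (t * x))"
    unfolding char_def by (subst integral_density) (auto simp: normal_density_nonneg)
  also have "\<dots> = \<bar>c\<bar> *\<^sub>R (LINT x|lborel. std_normal_density (0 + c * x) *\<^sub>R iexp (t * (0 + c * x)))"
    using c by (intro lborel_integral_real_affine) simp
  also have "(LINT x|lborel. std_normal_density (0 + c * x) *\<^sub>R iexp (t * (0 + c * x)))
      = (LINT x|lborel. complex_of_real (1 / sqrt (2 * pi)) * (exp (\<i> * complex_of_real (b * x)) * complex_of_real (exp (- (a * x\<^sup>2)))))"
  proof (intro Bochner_Integration.integral_cong refl)
    fix x :: real
    have "std_normal_density (0 + c * x) = 1 / sqrt (2 * pi) * exp (- (a * x\<^sup>2))"
      by (simp add: std_normal_density_def power_mult_distrib c2)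
    moreover have "t * (0 + c * x) = b * x" using c by (simp add: t_def)
    ultimately show "std_normal_density (0 + c * x) *\<^sub>R iexp (t * (0 + c * x))
      = complex_of_real (1 / sqrt (2 * pi)) * (exp (\<i> * complex_of_real (b * x)) * complex_of_real (exp (- (a * x\<^sup>2))))"
      by (simp only: scaleR_conv_of_real of_real_mult ac_simps)
  qed
  also have "\<dots> = complex_of_real (1 / sqrt (2 * pi)) * ?I" by simp
  finally have 1: "complex_of_real (exp (- (t\<^sup>2) / 2)) = complex_of_real (c / sqrt (2 * pi)) * ?I"
    using c by (simp add: scaleR_conv_of_real)
  have 2: "sqrt (pi / a) * (c / sqrt (2 * pi)) = 1"
    using a by (simp add: c_def real_sqrt_divide real_sqrt_mult)
  have 3: "- (t\<^sup>2) / 2 = - (b\<^sup>2 / (4 * a))" using a by (simp add: t_def power_divide c2)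
  have "complex_of_real (sqrt (pi / a)) * complex_of_real (exp (- (t\<^sup>2) / 2))
      = complex_of_real (sqrt (pi / a) * (c / sqrt (2 * pi))) * ?I"
    unfolding 1 by (simp only: of_real_mult ac_simps)
  then show ?thesis unfolding 2 unfolding 3 by simp
qed

lemma gaussian_integral:
  fixes a :: real assumes a: "0 < a"
  shows "(LINT x|lborel. exp (- (a * x\<^sup>2))) = sqrt (pi / a)"
proof -
  have "complex_of_real (LINT x|lborel. exp (- (a * x\<^sup>2))) = (LINT x|lborel. complex_of_real (exp (- (a * x\<^sup>2))))"
    by simp
  also have "\<dots> = complex_of_real (sqrt (pi / a))" using gaussian_fourier[OF a, of 0] by simp
  finally show ?thesis using of_real_eq_iff by blast
qed

lemma gaussian_nn_integral:
  fixes a :: real assumes a: "0 < a"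
  shows "(\<integral>\<^sup>+x. ennreal (exp (- (a * x\<^sup>2))) \<partial>lborel) = ennreal (sqrt (pi / a))"
  using nn_integral_eq_integral[OF gaussian_integrable[OF a]] gaussian_integral[OF a] by simp

lemma
  fixes f :: "'a \<Rightarrow> complex" and g :: "'b \<Rightarrow> complex"
  assumes M1: "sigma_finite_measure M1" and M2: "sigma_finite_measure M2"
    and f: "integrable M1 f" and g: "integrable M2 g"
  shows integrable_pair_mult: "integrable (M1 \<Otimes>\<^sub>M M2) (\<lambda>x. f (fst x) * g (snd x))"
    and integral_pair_mult: "(LINT x|(M1 \<Otimes>\<^sub>M M2). f (fst x) * g (snd x)) = (LINT x|M1. f x) * (LINT x|M2. g x)"
proof -
  interpret P: pair_sigma_finite M1 M2 using M1 M2 by (simp add: pair_sigma_finite_def)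
  have [measurable]: "f \<in> borel_measurable M1" "g \<in> borel_measurable M2" using f g by auto
  show i: "integrable (M1 \<Otimes>\<^sub>M M2) (\<lambda>x. f (fst x) * g (snd x))"
  proof (rule P.Fubini_integrable)
    show "(\<lambda>x. f (fst x) * g (snd x)) \<in> borel_measurable (M1 \<Otimes>\<^sub>M M2)" by measurable
    show "integrable M1 (\<lambda>x. LINT y|M2. cmod (f (fst (x, y)) * g (snd (x, y))))"
      using f by (simp add: norm_mult)
    show "AE x in M1. integrable M2 (\<lambda>y. f (fst (x, y)) * g (snd (x, y)))"
      using g by simp
  qed
  show "(LINT x|(M1 \<Otimes>\<^sub>M M2). f (fst x) * g (snd x)) = (LINT x|M1. f x) * (LINT x|M2. g x)"
    using P.integral_fst'[OF i] by simp
qed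

lemma cnj_measurable [measurable]: "cnj \<in> borel_measurable borel"
  by (intro borel_measurable_continuous_onI continuous_intros)

section \<open>A Schur test for damped Fourier integrals\<close>

text \<open>The squared modulus expands to a quadratic form in \<open>h\<close> with kernel
  \<open>k\<close>. Finiteness of \<rho>, the bound on \<open>E\<close> and integrability of
  \<open>h\<close> justify Fubini; positivity and symmetry of \<open>k\<close> then give the Schur
  bound.\<close>

lemma damped_bessel:
  fixes E :: "'p \<Rightarrow> 'z \<Rightarrow> complex" and h :: "'z \<Rightarrow> complex" and k :: "'z \<Rightarrow> 'z \<Rightarrow> real"
  assumes \<rho>: "finite_measure \<rho>" and N: "sigma_finite_measure N" and h: "integrable N h"
    and E [measurable]: "case_prod E \<in> borel_measurable (\<rho> \<Otimes>\<^sub>M N)" and E1: "\<And>p z. cmod (E p z) \<le> 1"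
    and k [measurable]: "case_prod k \<in> borel_measurable (N \<Otimes>\<^sub>M N)" and k0: "\<And>z z'. 0 \<le> k z z'"
    and ksym: "\<And>z z'. k z z' = k z' z"
    and ft: "\<And>z z'. (LINT p|\<rho>. E p z * cnj (E p z')) = complex_of_real (k z z')"
  shows "(\<integral>\<^sup>+p. ennreal ((cmod (LINT z|N. E p z * h z))\<^sup>2) \<partial>\<rho>)
     \<le> (\<integral>\<^sup>+z. ennreal ((cmod (h z))\<^sup>2) * (\<integral>\<^sup>+z'. ennreal (k z z') \<partial>N) \<partial>N)"
proof -
  interpret R: finite_measure \<rho> by fact
  interpret N: sigma_finite_measure N by fact
  interpret NN: pair_sigma_finite N N ..
  have sNN: "sigma_finite_measure (N \<Otimes>\<^sub>M N)" ..
  interpret RNN: pair_sigma_finite \<rho> "N \<Otimes>\<^sub>M N" ..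
  have [measurable]: "h \<in> borel_measurable N" using h by auto
  have hc: "integrable N (\<lambda>z. cnj (h z))" using h by simp
  define H where "H q = h (fst q) * cnj (h (snd q))" for q
  have iH: "integrable (N \<Otimes>\<^sub>M N) H"
    unfolding H_def by (rule integrable_pair_mult[OF N N h hc])
  have [measurable]: "H \<in> borel_measurable (N \<Otimes>\<^sub>M N)" using iH by auto
  define K where "K p q = (E p (fst q) * cnj (E p (snd q))) * H q" for p q
  have iK: "integrable (\<rho> \<Otimes>\<^sub>M (N \<Otimes>\<^sub>M N)) (case_prod K)"
  proof (rule Bochner_Integration.integrable_bound)
    show "integrable (\<rho> \<Otimes>\<^sub>M (N \<Otimes>\<^sub>M N)) (\<lambda>x. 1 * H (snd x))"
      by (rule integrable_pair_mult[OF R.sigma_finite_measure_axioms sNN _ iH]) simp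
    show "case_prod K \<in> borel_measurable (\<rho> \<Otimes>\<^sub>M N \<Otimes>\<^sub>M N)" unfolding K_def by measurable
    have "cmod (E p z * cnj (E p z')) \<le> 1" for p z z'
      using mult_le_one[OF E1 norm_ge_zero E1, of p z p z'] by (simp add: norm_mult)
    then show "AE x in \<rho> \<Otimes>\<^sub>M N \<Otimes>\<^sub>M N. cmod (case_prod K x) \<le> cmod (1 * H (snd x))"
      by (auto simp: K_def norm_mult[of _ "H _"] intro!: AE_I2 mult_left_le_one_le)
  qed
  define J where "J p = (LINT z|N. E p z * h z)" for p
  have iE: "integrable N (\<lambda>z. E p z * h z)" if "p \<in> space \<rho>" for p
  proof (rule Bochner_Integration.integrable_bound[OF h])
    show "(\<lambda>z. E p z * h z) \<in> borel_measurable N" using that by measurable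
    show "AE z in N. cmod (E p z * h z) \<le> cmod (h z)"
      using E1 by (auto simp: norm_mult intro!: AE_I2 mult_left_le_one_le)
  qed
  have JK: "(LINT q|(N \<Otimes>\<^sub>M N). K p q) = complex_of_real ((cmod (J p))\<^sup>2)" if "p \<in> space \<rho>" for p
  proof -
    have "(LINT q|(N \<Otimes>\<^sub>M N). K p q) = (LINT q|(N \<Otimes>\<^sub>M N). (E p (fst q) * h (fst q)) * cnj (E p (snd q) * h (snd q)))"
      unfolding K_def H_def by (intro Bochner_Integration.integral_cong) (auto simp: ac_simps)
    also have "\<dots> = J p * (LINT z|N. cnj (E p z * h z))"
      unfolding J_def using iE[OF that]
      by (intro integral_pair_mult[OF N N, where g="\<lambda>z. cnj (E p z * h z)"]) (auto simp del: complex_cnj_mult)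
    also have "\<dots> = J p * cnj (J p)" unfolding J_def by (subst Bochner_Integration.integral_cnj) simp
    also have "\<dots> = complex_of_real ((cmod (J p))\<^sup>2)" by (simp add: complex_norm_square[symmetric])
    finally show ?thesis .
  qed
  have iJ: "integrable \<rho> (\<lambda>p. complex_of_real ((cmod (J p))\<^sup>2))"
    using RNN.integrable_fst[OF iK] by (rule Bochner_Integration.integrable_cong[THEN iffD1, rotated 2]) (auto simp: JK)
  then have iJ': "integrable \<rho> (\<lambda>p. (cmod (J p))\<^sup>2)"
    using complex_of_real_integrable_eq by blast
  have pK: "(LINT p|\<rho>. K p q) = complex_of_real (k (fst q) (snd q)) * H q" for q
    unfolding K_def by (subst integral_mult_left_zero) (simp only: ft)
  have "complex_of_real (LINT p|\<rho>. (cmod (J p))\<^sup>2) = (LINT p|\<rho>. LINT q|(N \<Otimes>\<^sub>M N). K p q)"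
    by (subst integral_complex_of_real[symmetric]) (auto simp: JK intro!: Bochner_Integration.integral_cong)
  also have "\<dots> = (LINT q|(N \<Otimes>\<^sub>M N). LINT p|\<rho>. K p q)"
    by (rule RNN.Fubini_integral[OF iK, symmetric])
  also have "\<dots> = (LINT q|(N \<Otimes>\<^sub>M N). complex_of_real (k (fst q) (snd q)) * H q)" by (simp only: pK)
  finally have e: "complex_of_real (LINT p|\<rho>. (cmod (J p))\<^sup>2) = \<dots>" .
  have i2: "integrable (N \<Otimes>\<^sub>M N) (\<lambda>q. complex_of_real (k (fst q) (snd q)) * H q)"
    using RNN.integrable_snd[OF iK] by (simp only: pK)
  have "(LINT p|\<rho>. (cmod (J p))\<^sup>2) = cmod (complex_of_real (LINT p|\<rho>. (cmod (J p))\<^sup>2))"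
    unfolding norm_of_real by (simp add: integral_nonneg_AE)
  then have le: "(LINT p|\<rho>. (cmod (J p))\<^sup>2) \<le> (LINT q|(N \<Otimes>\<^sub>M N). cmod (complex_of_real (k (fst q) (snd q)) * H q))"
    unfolding e using integral_norm_bound by metis
  have "(\<integral>\<^sup>+p. ennreal ((cmod (J p))\<^sup>2) \<partial>\<rho>) = ennreal (LINT p|\<rho>. (cmod (J p))\<^sup>2)"
    by (intro nn_integral_eq_integral iJ') auto
  also have "\<dots> \<le> ennreal (LINT q|(N \<Otimes>\<^sub>M N). cmod (complex_of_real (k (fst q) (snd q)) * H q))"
    using le by (rule ennreal_leI)
  also have "\<dots> = (\<integral>\<^sup>+q. ennreal (cmod (complex_of_real (k (fst q) (snd q)) * H q)) \<partial>(N \<Otimes>\<^sub>M N))"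
    using i2 by (intro nn_integral_eq_integral[symmetric]) auto
  also have "\<dots> = (\<integral>\<^sup>+z. \<integral>\<^sup>+z'. ennreal (k z z' * (cmod (h z) * cmod (h z'))) \<partial>N \<partial>N)"
    by (subst N.nn_integral_fst[symmetric]) (auto simp: H_def norm_mult k0)
  also have "\<dots> \<le> (\<integral>\<^sup>+z. \<integral>\<^sup>+z'. ennreal (1/2 * (cmod (h z))\<^sup>2 * k z z') + ennreal (1/2 * (cmod (h z'))\<^sup>2 * k z z') \<partial>N \<partial>N)"
  proof (intro nn_integral_mono)
    fix z z'
    have "cmod (h z) * cmod (h z') \<le> 1/2 * (cmod (h z))\<^sup>2 + 1/2 * (cmod (h z'))\<^sup>2"
      using sum_squares_bound[of "cmod (h z)" "cmod (h z')"] by simp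
    then have "k z z' * (cmod (h z) * cmod (h z')) \<le> 1/2 * (cmod (h z))\<^sup>2 * k z z' + 1/2 * (cmod (h z'))\<^sup>2 * k z z'"
      using mult_left_mono[OF _ k0[of z z']] by (fastforce simp: algebra_simps)
    then show "ennreal (k z z' * (cmod (h z) * cmod (h z'))) \<le> ennreal (1/2 * (cmod (h z))\<^sup>2 * k z z') + ennreal (1/2 * (cmod (h z'))\<^sup>2 * k z z')"
      by (subst ennreal_plus[symmetric]) (auto simp: k0 simp del: ennreal_plus intro!: ennreal_leI)
  qed
  also have "\<dots> = (\<integral>\<^sup>+z. \<integral>\<^sup>+z'. ennreal (1/2 * (cmod (h z))\<^sup>2 * k z z') \<partial>N \<partial>N)
      + (\<integral>\<^sup>+z. \<integral>\<^sup>+z'. ennreal (1/2 * (cmod (h z'))\<^sup>2 * k z z') \<partial>N \<partial>N)"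
    by (subst nn_integral_add[symmetric]) (auto intro!: nn_integral_cong nn_integral_add)
  \<comment> \<open>Tonelli and the symmetry of \<open>k\<close> turn the half that carries |h z'|^2
    into a copy of the half that carries |h z|^2.\<close>
  also have "(\<integral>\<^sup>+z. \<integral>\<^sup>+z'. ennreal (1/2 * (cmod (h z'))\<^sup>2 * k z z') \<partial>N \<partial>N) = (\<integral>\<^sup>+z'. \<integral>\<^sup>+z. ennreal (1/2 * (cmod (h z'))\<^sup>2 * k z z') \<partial>N \<partial>N)"
    by (rule NN.Fubini') measurable
  also have "(\<integral>\<^sup>+z'. \<integral>\<^sup>+z. ennreal (1/2 * (cmod (h z'))\<^sup>2 * k z z') \<partial>N \<partial>N) = (\<integral>\<^sup>+z. \<integral>\<^sup>+z'. ennreal (1/2 * (cmod (h z))\<^sup>2 * k z z') \<partial>N \<partial>N)"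
    by (simp only: ksym)
  also have "(\<integral>\<^sup>+z. \<integral>\<^sup>+z'. ennreal (1/2 * (cmod (h z))\<^sup>2 * k z z') \<partial>N \<partial>N) + (\<integral>\<^sup>+z. \<integral>\<^sup>+z'. ennreal (1/2 * (cmod (h z))\<^sup>2 * k z z') \<partial>N \<partial>N)
    = (\<integral>\<^sup>+z. ennreal ((cmod (h z))\<^sup>2) * (\<integral>\<^sup>+z'. ennreal (k z z') \<partial>N) \<partial>N)"
  proof (subst nn_integral_add[symmetric], measurable, intro nn_integral_cong)
    fix z assume [measurable]: "z \<in> space N"
    have "(\<integral>\<^sup>+z'. ennreal (1/2 * (cmod (h z))\<^sup>2 * k z z') \<partial>N) + (\<integral>\<^sup>+z'. ennreal (1/2 * (cmod (h z))\<^sup>2 * k z z') \<partial>N)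
      = (\<integral>\<^sup>+z'. ennreal ((cmod (h z))\<^sup>2) * ennreal (k z z') \<partial>N)"
      by (subst nn_integral_add[symmetric]) (auto simp: k0 ennreal_plus[symmetric] ennreal_mult[symmetric] simp del: ennreal_plus intro!: nn_integral_cong)
    also have "\<dots> = ennreal ((cmod (h z))\<^sup>2) * (\<integral>\<^sup>+z'. ennreal (k z z') \<partial>N)"
      by (intro nn_integral_cmult) measurable
    finally show "(\<integral>\<^sup>+z'. ennreal (1/2 * (cmod (h z))\<^sup>2 * k z z') \<partial>N) + (\<integral>\<^sup>+z'. ennreal (1/2 * (cmod (h z))\<^sup>2 * k z z') \<partial>N) = \<dots>" .
  qed
  finally show ?thesis unfolding J_def .
qed

section \<open>The damped Strichartz integral\<close>

lemma fst_snd_borel_measurable [measurable]: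
  "(fst :: real \<times> real \<Rightarrow> real) \<in> borel_measurable borel"
  "(snd :: real \<times> real \<Rightarrow> real) \<in> borel_measurable borel"
  by (intro borel_measurable_continuous_onI continuous_intros)+

lemma conv_bound_measurable' [measurable]:
  assumes "f \<in> borel_measurable M" "g \<in> borel_measurable M"
  shows "(\<lambda>x. conv_bound (f x) (g x)) \<in> borel_measurable M"
  using measurable_compose[OF measurable_Pair[OF assms] conv_bound_measurable] by simp

section \<open>Triples of points and tensor cubes\<close>

definition triple :: "(real \<times> real \<times> real) measure" where
  "triple = hyp_measure \<Otimes>\<^sub>M (hyp_measure \<Otimes>\<^sub>M hyp_measure)"

definition total_u :: "real \<times> real \<times> real \<Rightarrow> real" where
  "total_u z = lightcone (fst z) + lightcone (fst (snd z)) + lightcone (snd (snd z))"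

definition total_v :: "real \<times> real \<times> real \<Rightarrow> real" where
  "total_v z = 1 / lightcone (fst z) + 1 / lightcone (fst (snd z)) + 1 / lightcone (snd (snd z))"

definition cube :: "(real \<Rightarrow> complex) \<Rightarrow> real \<times> real \<times> real \<Rightarrow> complex" where
  "cube g z = g (fst z) * (g (fst (snd z)) * g (snd (snd z)))"

interpretation hyp3: pair_sigma_finite hyp_measure "hyp_measure \<Otimes>\<^sub>M hyp_measure"
proof -
  interpret P: pair_sigma_finite hyp_measure hyp_measure ..
  show "pair_sigma_finite hyp_measure (hyp_measure \<Otimes>\<^sub>M hyp_measure)" ..
qed

interpretation hyp_pair: pair_sigma_finite hyp_measure hyp_measure ..

lemma sigma_finite_triple: "sigma_finite_measure triple"
  unfolding triple_def ..

interpretation triple: sigma_finite_measure triple by (rule sigma_finite_triple)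

lemma sigma_finite_hyp_pair: "sigma_finite_measure (hyp_measure \<Otimes>\<^sub>M hyp_measure)" ..

lemma total_u_measurable [measurable]: "total_u \<in> borel_measurable triple"
  unfolding total_u_def triple_def by measurable

lemma total_v_measurable [measurable]: "total_v \<in> borel_measurable triple"
  unfolding total_v_def triple_def by measurable

lemma cube_measurable [measurable]:
  assumes [measurable]: "g \<in> borel_measurable borel"
  shows "cube g \<in> borel_measurable triple"
  unfolding cube_def triple_def by measurable

lemma nn_integral_triple:
  assumes [measurable]: "f \<in> borel_measurable triple"
  shows "(\<integral>\<^sup>+z. f z \<partial>triple) = (\<integral>\<^sup>+x. \<integral>\<^sup>+y. \<integral>\<^sup>+z. f (x, y, z) \<partial>hyp_measure \<partial>hyp_measure \<partial>hyp_measure)"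
proof -
  have [measurable]: "f \<in> borel_measurable (hyp_measure \<Otimes>\<^sub>M hyp_measure \<Otimes>\<^sub>M hyp_measure)"
    using assms by (simp add: triple_def)
  have "(\<integral>\<^sup>+z. f z \<partial>triple) = (\<integral>\<^sup>+x. \<integral>\<^sup>+p. f (x, p) \<partial>(hyp_measure \<Otimes>\<^sub>M hyp_measure) \<partial>hyp_measure)"
    unfolding triple_def by (rule hyp3.M2.nn_integral_fst[symmetric]) measurable
  also have "\<dots> = (\<integral>\<^sup>+x. \<integral>\<^sup>+y. \<integral>\<^sup>+z. f (x, y, z) \<partial>hyp_measure \<partial>hyp_measure \<partial>hyp_measure)"
  proof (rule nn_integral_cong)
    fix x
    have "(\<lambda>p. f (x, p)) \<in> borel_measurable (hyp_measure \<Otimes>\<^sub>M hyp_measure)" by measurable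
    then show "(\<integral>\<^sup>+p. f (x, p) \<partial>(hyp_measure \<Otimes>\<^sub>M hyp_measure)) = (\<integral>\<^sup>+y. \<integral>\<^sup>+z. f (x, y, z) \<partial>hyp_measure \<partial>hyp_measure)"
      by (rule hyp.nn_integral_fst[symmetric])
  qed
  finally show ?thesis .
qed

lemma nn_integral_triple_prod:
  assumes [measurable]: "f \<in> borel_measurable borel"
  shows "(\<integral>\<^sup>+z. f (fst z) * (f (fst (snd z)) * f (snd (snd z))) \<partial>triple) = (\<integral>\<^sup>+y. f y \<partial>hyp_measure) ^ 3"
proof -
  have m [measurable]: "f \<in> borel_measurable hyp_measure" by measurable
  have "(\<lambda>z. f (fst z) * (f (fst (snd z)) * f (snd (snd z)))) \<in> borel_measurable triple"
    unfolding triple_def by measurable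
  then have "(\<integral>\<^sup>+z. f (fst z) * (f (fst (snd z)) * f (snd (snd z))) \<partial>triple)
    = (\<integral>\<^sup>+x. \<integral>\<^sup>+y. \<integral>\<^sup>+z. f x * (f y * f z) \<partial>hyp_measure \<partial>hyp_measure \<partial>hyp_measure)"
    by (subst nn_integral_triple) auto
  also have "\<dots> = (\<integral>\<^sup>+y. f y \<partial>hyp_measure) ^ 3"
    by (simp add: nn_integral_cmult nn_integral_multc power3_eq_cube mult.assoc)
  finally show ?thesis .
qed

lemma triple_pushforward_le:
  fixes \<phi> :: "real \<Rightarrow> real \<Rightarrow> real"
  assumes [measurable]: "case_prod \<phi> \<in> borel_measurable (borel \<Otimes>\<^sub>M borel)" and \<phi>0: "\<And>x y. 0 \<le> \<phi> x y"
  shows "(\<integral>\<^sup>+z. ennreal (\<phi> (total_u z) (total_v z)) \<partial>triple) \<le> (\<integral>\<^sup>+u. \<integral>\<^sup>+v. ennreal (\<phi> u v * conv_bound u v) \<partial>lborel \<partial>lborel)"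
proof -
  have "(\<lambda>z. ennreal (\<phi> (total_u z) (total_v z))) \<in> borel_measurable triple"
    using measurable_compose[OF measurable_Pair[OF total_u_measurable total_v_measurable] assms(1)] by simp
  then have "(\<integral>\<^sup>+z. ennreal (\<phi> (total_u z) (total_v z)) \<partial>triple)
    = (\<integral>\<^sup>+z. \<integral>\<^sup>+y. \<integral>\<^sup>+x. ennreal (\<phi> (lightcone x + lightcone y + lightcone z) (1 / lightcone x + 1 / lightcone y + 1 / lightcone z))
            \<partial>hyp_measure \<partial>hyp_measure \<partial>hyp_measure)"
    by (subst nn_integral_triple) (auto simp: total_u_def total_v_def ac_simps)
  also have "\<dots> \<le> (\<integral>\<^sup>+u. \<integral>\<^sup>+v. ennreal (\<phi> u v * conv_bound u v) \<partial>lborel \<partial>lborel)"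
    by (rule threefold_pushforward_le[OF assms])
  finally show ?thesis .
qed

section \<open>Plane waves and the extension integral\<close>

definition planewave :: "real \<times> real \<Rightarrow> real \<Rightarrow> complex" where
  "planewave p y = exp (\<i> * complex_of_real (fst p * y)) * exp (\<i> * complex_of_real (snd p * jbracket y))"

lemma extension_integral_eq: "extension_integral f p = (LINT y|hyp_measure. planewave p y * f y)"
  by (cases p) (simp add: extension_integral_def planewave_def)

lemma planewave_measurable [measurable]: "case_prod planewave \<in> borel_measurable (borel \<Otimes>\<^sub>M borel)"
  unfolding planewave_def borel_prod[symmetric] by measurable

lemma cmod_planewave [simp]: "cmod (planewave p y) = 1"
  by (simp add: planewave_def norm_mult)

lemma planewave_integrable:
  assumes "integrable hyp_measure f"
  shows "integrable hyp_measure (\<lambda>y. planewave p y * f y)"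
proof (rule Bochner_Integration.integrable_bound[OF assms])
  have [measurable]: "f \<in> borel_measurable borel"
    using borel_measurable_integrable[OF assms] by (simp cong: measurable_cong_sets)
  show "(\<lambda>y. planewave p y * f y) \<in> borel_measurable hyp_measure" by measurable
qed (simp add: norm_mult)

lemma extension_integral_measurable [measurable]:
  assumes [measurable]: "f \<in> borel_measurable borel"
  shows "extension_integral f \<in> borel_measurable borel"
proof -
  have "(\<lambda>p. LINT y|hyp_measure. planewave p y * f y) \<in> borel_measurable borel" by measurable
  then show ?thesis unfolding extension_integral_eq[abs_def] .
qed

definition wave3 :: "real \<times> real \<Rightarrow> real \<times> real \<times> real \<Rightarrow> complex" where
  "wave3 p z = planewave p (fst z) * (planewave p (fst (snd z)) * planewave p (snd (snd z)))"

lemma wave3_measurable [measurable]: "case_prod wave3 \<in> borel_measurable (borel \<Otimes>\<^sub>M triple)"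
  unfolding wave3_def triple_def by measurable

text \<open>Fubini over three independent copies makes the cube of the extension linear in the
  tensor cube, so that an L6 estimate becomes an L2 estimate for a Fourier integral.\<close>

lemma extension_integral_cubed:
  assumes f: "integrable hyp_measure f"
  shows "integrable triple (cube f)"
    and "(LINT z|triple. wave3 p z * cube f z) = (extension_integral f p) ^ 3"
proof -
  note i1 = integrable_pair_mult[OF sigma_finite_hyp sigma_finite_hyp f f]
  show "integrable triple (cube f)"
    unfolding triple_def cube_def[abs_def]
    using integrable_pair_mult[OF sigma_finite_hyp sigma_finite_hyp_pair f i1] by simp
  let ?g = "\<lambda>y. planewave p y * f y"
  have g: "integrable hyp_measure ?g" by (rule planewave_integrable[OF f])
  note i2 = integrable_pair_mult[OF sigma_finite_hyp sigma_finite_hyp g g]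
  have "(LINT z|triple. wave3 p z * cube f z) = (LINT z|triple. ?g (fst z) * (?g (fst (snd z)) * ?g (snd (snd z))))"
    by (intro Bochner_Integration.integral_cong) (auto simp: wave3_def cube_def ac_simps)
  also have "\<dots> = (LINT y|hyp_measure. ?g y) * (LINT q|(hyp_measure \<Otimes>\<^sub>M hyp_measure). ?g (fst q) * ?g (snd q))"
    unfolding triple_def
    using integral_pair_mult[OF sigma_finite_hyp sigma_finite_hyp_pair g i2] by simp
  also have "\<dots> = (extension_integral f p) ^ 3"
    unfolding integral_pair_mult[OF sigma_finite_hyp sigma_finite_hyp g g] extension_integral_eq
    by (simp add: power3_eq_cube mult.assoc)
  finally show "(LINT z|triple. wave3 p z * cube f z) = (extension_integral f p) ^ 3" .
qed

section \<open>Gaussian damping on the dual side\<close>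

definition gauss_plane :: "real \<Rightarrow> (real \<times> real) measure" where
  "gauss_plane a = density (lborel \<Otimes>\<^sub>M lborel) (\<lambda>p. ennreal (exp (- (a * (fst p)\<^sup>2)) * exp (- (a * (snd p)\<^sup>2))))"

lemma sets_gauss_plane [simp, measurable_cong]: "sets (gauss_plane a) = sets borel"
  unfolding gauss_plane_def lborel_prod by simp

lemma nn_integral_gauss_plane:
  assumes [measurable]: "f \<in> borel_measurable borel"
  shows "(\<integral>\<^sup>+p. f p \<partial>gauss_plane a) = (\<integral>\<^sup>+p. ennreal (exp (- (a * (fst p)\<^sup>2)) * exp (- (a * (snd p)\<^sup>2))) * f p \<partial>lborel)"
  unfolding gauss_plane_def lborel_prod by (subst nn_integral_density) auto

lemma finite_gauss_plane: assumes a: "0 < a" shows "finite_measure (gauss_plane a)"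
proof
  have "emeasure (gauss_plane a) (space (gauss_plane a)) = (\<integral>\<^sup>+p. 1 \<partial>gauss_plane a)" by simp
  also have "\<dots> = (\<integral>\<^sup>+p. ennreal (exp (- (a * (fst p)\<^sup>2)) * exp (- (a * (snd p)\<^sup>2))) \<partial>(lborel \<Otimes>\<^sub>M lborel))"
    unfolding gauss_plane_def by (subst nn_integral_density) auto
  also have "\<dots> = (\<integral>\<^sup>+x. \<integral>\<^sup>+t. ennreal (exp (- (a * x\<^sup>2)) * exp (- (a * t\<^sup>2))) \<partial>lborel \<partial>lborel)"
    by (subst lborel.nn_integral_fst[symmetric]) auto
  also have "\<dots> = ennreal (sqrt (pi / a)) * ennreal (sqrt (pi / a))"
    by (simp add: ennreal_mult nn_integral_cmult nn_integral_multc gaussian_nn_integral[OF a])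
  also have "\<dots> < \<infinity>" by (simp add: ennreal_mult_less_top)
  finally show "emeasure (gauss_plane a) (space (gauss_plane a)) \<noteq> \<infinity>" by simp
qed

text \<open>The phase sees a triple only through its total momentum X and total energy Y. Since u =
  Y + X and v = Y - X, squared distances in (u, v) are twice those in (X, Y), which turns
  \<open>4 * a\<close> into \<open>8 * a\<close>.\<close>

lemma gauss_plane_fourier:
  assumes a: "0 < a"
  shows "(LINT p|gauss_plane a. wave3 p z * cnj (wave3 p z'))
    = complex_of_real (pi / a * exp (- (((total_u z - total_u z')\<^sup>2 + (total_v z - total_v z')\<^sup>2) / (8 * a))))"
proof -
  define X where "X z = fst z + fst (snd z) + snd (snd z)" for z :: "real \<times> real \<times> real"
  define Y where "Y z = jbracket (fst z) + jbracket (fst (snd z)) + jbracket (snd (snd z))" for z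
  have UV: "total_u z = X z + Y z" "total_v z = Y z - X z" for z
    by (simp_all add: total_u_def total_v_def X_def Y_def lightcone_inv[symmetric]) (simp add: lightcone_def)
  have w: "wave3 p z = exp (\<i> * complex_of_real (fst p * X z + snd p * Y z))" for p z
    by (simp add: wave3_def planewave_def X_def Y_def exp_add[symmetric] algebra_simps)
  define b where "b = X z - X z'"
  define c where "c = Y z - Y z'"
  let ?f = "\<lambda>b x. exp (\<i> * complex_of_real (b * x)) * complex_of_real (exp (- (a * x\<^sup>2)))"
  have int: "integrable lborel (?f b)" for b
  proof (rule Bochner_Integration.integrable_bound[OF gaussian_integrable[OF a]])
    show "?f b \<in> borel_measurable lborel" by measurable
  qed (simp add: norm_mult)
  have e: "wave3 p z * cnj (wave3 p z') = exp (\<i> * complex_of_real (b * fst p)) * exp (\<i> * complex_of_real (c * snd p))" for p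
    by (simp add: w exp_cnj b_def c_def exp_add[symmetric] algebra_simps)
  have "(LINT p|gauss_plane a. wave3 p z * cnj (wave3 p z')) =
     (LINT p|(lborel \<Otimes>\<^sub>M lborel). (exp (- (a * (fst p)\<^sup>2)) * exp (- (a * (snd p)\<^sup>2))) *\<^sub>R
        (exp (\<i> * complex_of_real (b * fst p)) * exp (\<i> * complex_of_real (c * snd p))))"
    unfolding e gauss_plane_def by (subst integral_density) auto
  also have "\<dots> = (LINT p|(lborel \<Otimes>\<^sub>M lborel). ?f b (fst p) * ?f c (snd p))"
    by (intro Bochner_Integration.integral_cong) (auto simp: scaleR_conv_of_real)
  also have "\<dots> = complex_of_real (sqrt (pi / a) * exp (- (b\<^sup>2 / (4 * a)))) * complex_of_real (sqrt (pi / a) * exp (- (c\<^sup>2 / (4 * a))))"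
    by (subst integral_pair_mult[OF sigma_finite_lborel sigma_finite_lborel int int])
       (simp only: gaussian_fourier[OF a])
  also have "\<dots> = complex_of_real (pi / a * exp (- (b\<^sup>2 / (4 * a)) + - (c\<^sup>2 / (4 * a))))"
  proof -
    have sq: "sqrt (pi / a) * sqrt (pi / a) = pi / a" using a by simp
    have AC: "r * A * (r * B) = r * r * (A * B)" for r A B :: real by (simp only: ac_simps)
    have "sqrt (pi / a) * exp (- (b\<^sup>2 / (4 * a))) * (sqrt (pi / a) * exp (- (c\<^sup>2 / (4 * a))))
        = pi / a * exp (- (b\<^sup>2 / (4 * a)) + - (c\<^sup>2 / (4 * a)))"
      unfolding AC sq exp_add ..
    then show ?thesis by (simp only: of_real_mult[symmetric])
  qed
  also have "- (b\<^sup>2 / (4 * a)) + - (c\<^sup>2 / (4 * a)) = - (((total_u z - total_u z')\<^sup>2 + (total_v z - total_v z')\<^sup>2) / (8 * a))"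
    using a unfolding UV b_def c_def by (simp add: field_simps power2_eq_square)
  finally show ?thesis .
qed

text \<open>A Gaussian average of \<open>conv_bound\<close> at scale \<open>s\<close>, in rescaled
  variables so that only the argument of \<open>conv_bound\<close> depends on \<open>s\<close>. The
  weight integrates to 8 \<pi>^2, the product of the Plancherel factor (2 \<pi>)^2 and the factor 2
  in du dv = 2 d\<xi> d\<tau>.\<close>

definition smoothed_bound :: "real \<Rightarrow> real \<Rightarrow> real \<Rightarrow> ennreal" where
  "smoothed_bound s u v = (\<integral>\<^sup>+p. \<integral>\<^sup>+q. ennreal (pi * exp (- (1/8 * p\<^sup>2)) * exp (- (1/8 * q\<^sup>2)) * conv_bound (u + s * p) (v + s * q)) \<partial>lborel \<partial>lborel)"

lemma smoothed_bound_measurable [measurable]: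
  assumes [measurable]: "f \<in> borel_measurable M" "g \<in> borel_measurable M"
  shows "(\<lambda>x. smoothed_bound s (f x) (g x)) \<in> borel_measurable M"
  unfolding smoothed_bound_def by measurable

lemma strichartz_damped:
  assumes f: "integrable hyp_measure f" and [measurable]: "f \<in> borel_measurable borel" and s: "0 < s"
  shows "(\<integral>\<^sup>+p. ennreal (exp (- (s\<^sup>2 * (fst p)\<^sup>2)) * exp (- (s\<^sup>2 * (snd p)\<^sup>2)) * cmod (extension_integral f p) ^ 6) \<partial>lborel)
    \<le> (\<integral>\<^sup>+z. ennreal ((cmod (cube f z))\<^sup>2) * smoothed_bound s (total_u z) (total_v z) \<partial>triple)"
proof -
  \<comment> \<open>With this damping parameter the kernel on the dual side has width proportional
    to \<open>s\<close>, and the two factors \<open>s\<close> of the affine substitutions below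
    cancel \<open>1 / a\<close>.\<close>
  define a where "a = s\<^sup>2"
  have a: "0 < a" using s by (simp add: a_def)
  define k where "k z z' = pi / a * exp (- (((total_u z - total_u z')\<^sup>2 + (total_v z - total_v z')\<^sup>2) / (8 * a)))" for z z'
  have "(\<integral>\<^sup>+p. ennreal (exp (- (a * (fst p)\<^sup>2)) * exp (- (a * (snd p)\<^sup>2)) * cmod (extension_integral f p) ^ 6) \<partial>lborel)
     = (\<integral>\<^sup>+p. ennreal (exp (- (a * (fst p)\<^sup>2)) * exp (- (a * (snd p)\<^sup>2))) * ennreal (cmod (extension_integral f p) ^ 6) \<partial>lborel)"
    by (simp add: ennreal_mult)
  also have "\<dots> = (\<integral>\<^sup>+p. ennreal (cmod (extension_integral f p) ^ 6) \<partial>gauss_plane a)"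
    by (rule nn_integral_gauss_plane[symmetric]) measurable
  also have "\<dots> = (\<integral>\<^sup>+p. ennreal ((cmod (LINT z|triple. wave3 p z * cube f z))\<^sup>2) \<partial>gauss_plane a)"
    by (simp add: extension_integral_cubed[OF f] norm_power flip: power_mult)
  also have "\<dots> \<le> (\<integral>\<^sup>+z. ennreal ((cmod (cube f z))\<^sup>2) * (\<integral>\<^sup>+z'. ennreal (k z z') \<partial>triple) \<partial>triple)"
  proof (rule damped_bessel[OF finite_gauss_plane[OF a] sigma_finite_triple extension_integral_cubed(1)[OF f]])
    show "case_prod wave3 \<in> borel_measurable (gauss_plane a \<Otimes>\<^sub>M triple)" by measurable
    show "case_prod k \<in> borel_measurable (triple \<Otimes>\<^sub>M triple)" unfolding k_def by measurable
    show "cmod (wave3 p z) \<le> 1" for p z by (simp add: wave3_def norm_mult)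
    show "0 \<le> k z z'" for z z' using a by (simp add: k_def)
    show "k z z' = k z' z" for z z' by (simp add: k_def power2_commute)
    show "(LINT p|gauss_plane a. wave3 p z * cnj (wave3 p z')) = complex_of_real (k z z')" for z z'
      unfolding k_def by (rule gauss_plane_fourier[OF a])
  qed
  also have "\<dots> \<le> (\<integral>\<^sup>+z. ennreal ((cmod (cube f z))\<^sup>2) * smoothed_bound s (total_u z) (total_v z) \<partial>triple)"
  proof (intro nn_integral_mono mult_left_mono)
    fix z
    define P where "P u v = pi / a * exp (- (((total_u z - u)\<^sup>2 + (total_v z - v)\<^sup>2) / (8 * a)))" for u v
    have [measurable]: "case_prod P \<in> borel_measurable (borel \<Otimes>\<^sub>M borel)" unfolding P_def by measurable
    have "(\<integral>\<^sup>+z'. ennreal (k z z') \<partial>triple) = (\<integral>\<^sup>+z'. ennreal (P (total_u z') (total_v z')) \<partial>triple)"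
      by (simp add: k_def P_def)
    also have "\<dots> \<le> (\<integral>\<^sup>+u. \<integral>\<^sup>+v. ennreal (P u v * conv_bound u v) \<partial>lborel \<partial>lborel)"
      using a by (intro triple_pushforward_le) (auto simp: P_def)
    also have "\<dots> = (\<integral>\<^sup>+u. ennreal s * (\<integral>\<^sup>+q. ennreal (P u (total_v z + s * q) * conv_bound u (total_v z + s * q)) \<partial>lborel) \<partial>lborel)"
      using s by (subst nn_integral_real_affine[where c=s and t="total_v z"]) (auto simp: P_def)
    also have "\<dots> = ennreal s * (\<integral>\<^sup>+p. ennreal s * (\<integral>\<^sup>+q. ennreal (P (total_u z + s * p) (total_v z + s * q) * conv_bound (total_u z + s * p) (total_v z + s * q)) \<partial>lborel) \<partial>lborel)"
      using s by (subst nn_integral_real_affine[where c=s and t="total_u z"]) (auto simp: P_def)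
    also have "\<dots> = (\<integral>\<^sup>+p. \<integral>\<^sup>+q. ennreal s * (ennreal s * ennreal (P (total_u z + s * p) (total_v z + s * q) * conv_bound (total_u z + s * p) (total_v z + s * q))) \<partial>lborel \<partial>lborel)"
      by (simp add: nn_integral_cmult P_def)
    also have "\<dots> = smoothed_bound s (total_u z) (total_v z)"
      unfolding smoothed_bound_def
    proof (intro nn_integral_cong)
      fix p q
      have "s * (s * P (total_u z + s * p) (total_v z + s * q)) = pi * exp (- (1/8 * p\<^sup>2)) * exp (- (1/8 * q\<^sup>2))"
        using s by (simp add: P_def a_def exp_add[symmetric] power2_eq_square field_simps)
      then show "ennreal s * (ennreal s * ennreal (P (total_u z + s * p) (total_v z + s * q) * conv_bound (total_u z + s * p) (total_v z + s * q)))
         = ennreal (pi * exp (- (1/8 * p\<^sup>2)) * exp (- (1/8 * q\<^sup>2)) * conv_bound (total_u z + s * p) (total_v z + s * q))"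
        using s a less_imp_le[OF conv_bound_pos] by (subst ennreal_mult[symmetric], simp, simp add: P_def)+ (simp only: mult.assoc[symmetric])
    qed
    finally show "(\<integral>\<^sup>+z'. ennreal (k z z') \<partial>triple) \<le> smoothed_bound s (total_u z) (total_v z)" .
  qed simp
  finally show ?thesis by (simp add: a_def)
qed

section \<open>Strichartz inequality with deficit\<close>

lemma smoothed_bound_pair:
  "smoothed_bound s u v = (\<integral>\<^sup>+x. ennreal (pi * exp (- (1/8 * (fst x)\<^sup>2)) * exp (- (1/8 * (snd x)\<^sup>2)) * conv_bound (u + s * fst x) (v + s * snd x)) \<partial>(lborel \<Otimes>\<^sub>M lborel))"
  unfolding smoothed_bound_def by (subst lborel.nn_integral_fst[symmetric]) auto

lemma gauss_pair_const:
  assumes "0 \<le> c"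
  shows "(\<integral>\<^sup>+x. ennreal (pi * exp (- (1/8 * (fst x)\<^sup>2)) * exp (- (1/8 * (snd x)\<^sup>2)) * c) \<partial>(lborel \<Otimes>\<^sub>M lborel))
    = ennreal (8 * pi\<^sup>2 * c)"
proof -
  have "(\<integral>\<^sup>+x. ennreal (pi * exp (- (1/8 * (fst x)\<^sup>2)) * exp (- (1/8 * (snd x)\<^sup>2)) * c) \<partial>(lborel \<Otimes>\<^sub>M lborel))
     = (\<integral>\<^sup>+x. \<integral>\<^sup>+y. ennreal (pi * c) * (ennreal (exp (- (1/8 * x\<^sup>2))) * ennreal (exp (- (1/8 * y\<^sup>2)))) \<partial>lborel \<partial>lborel)"
    using assms by (subst lborel.nn_integral_fst[symmetric]) (auto simp: ennreal_mult[symmetric] ac_simps)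
  also have "\<dots> = ennreal (pi * c) * (ennreal (sqrt (pi / (1/8))) * ennreal (sqrt (pi / (1/8))))"
    by (simp add: nn_integral_cmult nn_integral_multc gaussian_nn_integral[of "1/8", simplified])
  also have "\<dots> = ennreal (pi * c * (sqrt (pi / (1/8)) * sqrt (pi / (1/8))))"
  proof -
    have "ennreal A * (ennreal B * ennreal B) = ennreal (A * (B * B))" if "0 \<le> A" "0 \<le> B" for A B
      using that by (simp add: ennreal_mult)
    then show ?thesis using assms by simp
  qed
  also have "pi * c * (sqrt (pi / (1/8)) * sqrt (pi / (1/8))) = 8 * pi\<^sup>2 * c"
    by (simp add: power2_eq_square)
  finally show ?thesis .
qed

lemma smoothed_bound_le: "smoothed_bound s u v \<le> ennreal (8 * pi\<^sup>2 * (pi / sqrt 3))"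
proof -
  have "smoothed_bound s u v \<le> (\<integral>\<^sup>+x. ennreal (pi * exp (- (1/8 * (fst x)\<^sup>2)) * exp (- (1/8 * (snd x)\<^sup>2)) * (pi / sqrt 3)) \<partial>(lborel \<Otimes>\<^sub>M lborel))"
    unfolding smoothed_bound_pair by (intro nn_integral_mono ennreal_leI mult_left_mono conv_bound_le) auto
  then show ?thesis by (subst (asm) gauss_pair_const) auto
qed

lemma smoothed_bound_tendsto:
  "(\<lambda>n. smoothed_bound (1 / real (Suc n)) u v) \<longlonglongrightarrow> ennreal (8 * pi\<^sup>2 * conv_bound u v)"
proof -
  have "(\<lambda>n. \<integral>\<^sup>+x. ennreal (pi * exp (- (1/8 * (fst x)\<^sup>2)) * exp (- (1/8 * (snd x)\<^sup>2)) * conv_bound (u + 1 / real (Suc n) * fst x) (v + 1 / real (Suc n) * snd x)) \<partial>(lborel \<Otimes>\<^sub>M lborel))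
    \<longlonglongrightarrow> (\<integral>\<^sup>+x. ennreal (pi * exp (- (1/8 * (fst x)\<^sup>2)) * exp (- (1/8 * (snd x)\<^sup>2)) * conv_bound u v) \<partial>(lborel \<Otimes>\<^sub>M lborel))"
  proof (rule nn_integral_dominated_convergence[where w="\<lambda>x. ennreal (pi * exp (- (1/8 * (fst x)\<^sup>2)) * exp (- (1/8 * (snd x)\<^sup>2)) * (pi / sqrt 3))"], goal_cases)
    case (4 j) show ?case by (intro AE_I2 ennreal_leI mult_left_mono conv_bound_le) auto
  next
    case 5 show ?case by (subst gauss_pair_const) auto
  next
    case 6 show ?case
    proof (intro AE_I2 tendsto_ennrealI tendsto_mult tendsto_const)
      fix x :: "real \<times> real"
      have l: "(\<lambda>n. 1 / real (Suc n)) \<longlonglongrightarrow> 0" by (rule LIMSEQ_Suc[OF lim_1_over_n])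
      have "(\<lambda>n. (u + 1 / real (Suc n) * fst x, v + 1 / real (Suc n) * snd x)) \<longlonglongrightarrow> (u + 0 * fst x, v + 0 * snd x)"
        by (intro tendsto_Pair tendsto_add tendsto_mult tendsto_const l)
      then have "(\<lambda>n. (u + 1 / real (Suc n) * fst x, v + 1 / real (Suc n) * snd x)) \<longlonglongrightarrow> (u, v)" by simp
      from continuous_on_tendsto_compose[OF conv_bound_cont this]
      show "(\<lambda>n. conv_bound (u + 1 / real (Suc n) * fst x) (v + 1 / real (Suc n) * snd x)) \<longlonglongrightarrow> conv_bound u v" by simp
    qed
  qed measurable
  then show ?thesis
    unfolding smoothed_bound_pair by (subst (asm) gauss_pair_const) (auto simp: less_imp_le[OF conv_bound_pos])
qed

lemma nn_integral_cube:
  assumes [measurable]: "f \<in> borel_measurable borel"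
  shows "(\<integral>\<^sup>+z. ennreal ((cmod (cube f z))\<^sup>2) \<partial>triple) = (\<integral>\<^sup>+y. ennreal ((cmod (f y))\<^sup>2) \<partial>hyp_measure) ^ 3"
  by (subst nn_integral_triple_prod[symmetric])
     (auto simp: cube_def norm_mult power_mult_distrib ennreal_mult)

text \<open>The two sides lose the damping differently: on the left, where finiteness is not yet
  known, Fatou suffices; on the right dominated convergence applies because the tensor cube is
  square integrable.\<close>

lemma strichartz_weighted:
  assumes f: "integrable hyp_measure f" and [measurable]: "f \<in> borel_measurable borel"
    and f2: "(\<integral>\<^sup>+y. ennreal ((cmod (f y))\<^sup>2) \<partial>hyp_measure) < \<infinity>"
  shows "(\<integral>\<^sup>+p. ennreal (cmod (extension_integral f p) ^ 6) \<partial>lborel)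
    \<le> (\<integral>\<^sup>+z. ennreal ((cmod (cube f z))\<^sup>2) * ennreal (8 * pi\<^sup>2 * conv_bound (total_u z) (total_v z)) \<partial>triple)"
proof -
  define d where "d n p = exp (- ((1 / real (Suc n))\<^sup>2 * (fst p)\<^sup>2)) * exp (- ((1 / real (Suc n))\<^sup>2 * (snd p)\<^sup>2))" for n and p :: "real \<times> real"
  have [measurable]: "d n \<in> borel_measurable borel" for n unfolding d_def by measurable
  define A where "A n = (\<integral>\<^sup>+p. ennreal (d n p * cmod (extension_integral f p) ^ 6) \<partial>lborel)" for n
  define B where "B n = (\<integral>\<^sup>+z. ennreal ((cmod (cube f z))\<^sup>2) * smoothed_bound (1 / real (Suc n)) (total_u z) (total_v z) \<partial>triple)" for n
  have AB: "A n \<le> B n" for n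
    unfolding A_def B_def d_def using strichartz_damped[OF f, of "1 / real (Suc n)"] by simp
  have dl: "(\<lambda>n. d n p) \<longlonglongrightarrow> 1" for p
  proof -
    have l: "(\<lambda>n. 1 / real (Suc n)) \<longlonglongrightarrow> 0" by (rule LIMSEQ_Suc[OF lim_1_over_n])
    have "(\<lambda>n. d n p) \<longlonglongrightarrow> exp (- (0\<^sup>2 * (fst p)\<^sup>2)) * exp (- (0\<^sup>2 * (snd p)\<^sup>2))"
      unfolding d_def by (intro tendsto_intros l)
    then show ?thesis by simp
  qed
  have Bl: "B \<longlonglongrightarrow> (\<integral>\<^sup>+z. ennreal ((cmod (cube f z))\<^sup>2) * ennreal (8 * pi\<^sup>2 * conv_bound (total_u z) (total_v z)) \<partial>triple)"
    unfolding B_def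
  proof (rule nn_integral_dominated_convergence[where w="\<lambda>z. ennreal ((cmod (cube f z))\<^sup>2) * ennreal (8 * pi\<^sup>2 * (pi / sqrt 3))"], goal_cases)
    case (4 j) show ?case by (intro AE_I2 mult_left_mono smoothed_bound_le) auto
  next
    case 5 show ?case using f2
      by (subst nn_integral_multc) (auto simp: nn_integral_cube ennreal_mult_less_top power_less_top_ennreal)
  next
    case 6 show ?case
      by (intro AE_I2 ennreal_tendsto_cmult smoothed_bound_tendsto) auto
  qed measurable
  have "(\<integral>\<^sup>+p. ennreal (cmod (extension_integral f p) ^ 6) \<partial>lborel)
    = (\<integral>\<^sup>+p. liminf (\<lambda>n. ennreal (d n p * cmod (extension_integral f p) ^ 6)) \<partial>lborel)"
  proof (intro nn_integral_cong)
    fix p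
    have "(\<lambda>n. ennreal (d n p * cmod (extension_integral f p) ^ 6)) \<longlonglongrightarrow> ennreal (1 * cmod (extension_integral f p) ^ 6)"
      by (intro tendsto_intros dl)
    then show "ennreal (cmod (extension_integral f p) ^ 6) = liminf (\<lambda>n. ennreal (d n p * cmod (extension_integral f p) ^ 6))"
      by (simp add: lim_imp_Liminf)
  qed
  also have "\<dots> \<le> liminf A"
    unfolding A_def by (intro nn_integral_liminf) measurable
  also have "\<dots> \<le> liminf B" by (intro Liminf_mono always_eventually allI AB)
  also have "\<dots> = (\<integral>\<^sup>+z. ennreal ((cmod (cube f z))\<^sup>2) * ennreal (8 * pi\<^sup>2 * conv_bound (total_u z) (total_v z)) \<partial>triple)"
    using Bl by (intro lim_imp_Liminf) auto
  finally show ?thesis .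
qed

section \<open>The deficit and its positivity\<close>

text \<open>Equal to (2 \<pi>)^3 / sqrt 3: the total weight 8 \<pi>^2 of the Gaussian average times
  the largest value \<pi> / sqrt 3 of \<open>conv_bound\<close>, taken at mass 3.\<close>

definition sharp6 :: real where "sharp6 = 8 * pi\<^sup>2 * (pi / sqrt 3)"

lemma sharp6_pos: "0 < sharp6" by (simp add: sharp6_def)

text \<open>The loss in replacing \<open>conv_bound\<close> by its largest value. It is kept as a
  separate term because a strict inequality for each approximant would by itself be lost in the
  limit.\<close>

definition deficit :: "(real \<Rightarrow> complex) \<Rightarrow> ennreal" where
  "deficit f = (\<integral>\<^sup>+z. ennreal ((cmod (cube f z))\<^sup>2) * ennreal (8 * pi\<^sup>2 * (pi / sqrt 3 - conv_bound (total_u z) (total_v z))) \<partial>triple)"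

lemma strichartz_deficit:
  assumes f: "integrable hyp_measure f" and [measurable]: "f \<in> borel_measurable borel"
    and f2: "(\<integral>\<^sup>+y. ennreal ((cmod (f y))\<^sup>2) \<partial>hyp_measure) < \<infinity>"
  shows "(\<integral>\<^sup>+p. ennreal (cmod (extension_integral f p) ^ 6) \<partial>lborel) + deficit f
    \<le> ennreal sharp6 * (\<integral>\<^sup>+y. ennreal ((cmod (f y))\<^sup>2) \<partial>hyp_measure) ^ 3"
proof -
  have "(\<integral>\<^sup>+p. ennreal (cmod (extension_integral f p) ^ 6) \<partial>lborel) + deficit f
    \<le> (\<integral>\<^sup>+z. ennreal ((cmod (cube f z))\<^sup>2) * ennreal (8 * pi\<^sup>2 * conv_bound (total_u z) (total_v z)) \<partial>triple) + deficit f"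
    by (intro add_right_mono strichartz_weighted[OF f _ f2]) measurable
  also have "\<dots> = (\<integral>\<^sup>+z. ennreal ((cmod (cube f z))\<^sup>2) * ennreal sharp6 \<partial>triple)"
    unfolding deficit_def
  proof (subst nn_integral_add[symmetric], measurable, intro nn_integral_cong)
    fix z
    have "ennreal (8 * pi\<^sup>2 * conv_bound (total_u z) (total_v z)) + ennreal (8 * pi\<^sup>2 * (pi / sqrt 3 - conv_bound (total_u z) (total_v z))) = ennreal sharp6"
      using conv_bound_le[of "total_u z" "total_v z"] conv_bound_pos[of "total_u z" "total_v z"] mult_left_mono[OF conv_bound_le[of "total_u z" "total_v z"], of "8 * pi\<^sup>2"]
      by (subst ennreal_plus[symmetric]) (auto simp: sharp6_def algebra_simps simp del: ennreal_plus)
    then show "ennreal ((cmod (cube f z))\<^sup>2) * ennreal (8 * pi\<^sup>2 * conv_bound (total_u z) (total_v z)) + ennreal ((cmod (cube f z))\<^sup>2) * ennreal (8 * pi\<^sup>2 * (pi / sqrt 3 - conv_bound (total_u z) (total_v z)))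
      = ennreal ((cmod (cube f z))\<^sup>2) * ennreal sharp6"
      by (simp only: distrib_left[symmetric])
  qed
  also have "\<dots> = ennreal sharp6 * (\<integral>\<^sup>+y. ennreal ((cmod (f y))\<^sup>2) \<partial>hyp_measure) ^ 3"
    by (subst nn_integral_multc) (auto simp: nn_integral_cube mult.commute)
  finally show ?thesis .
qed

text \<open>Cauchy-Schwarz for (a + b + c) (1/a + 1/b + 1/c) with its remainder as a sum of squares.
  The mass is 3 only when all three points coincide, and one distinct pair already gives
  strictness.\<close>

lemma total_uv_gt9:
  assumes "fst z \<noteq> fst (snd z)" shows "9 < total_u z * total_v z"
proof -
  define a b c where "a = lightcone (fst z)" and "b = lightcone (fst (snd z))" and "c = lightcone (snd (snd z))"
  have pos: "0 < a" "0 < b" "0 < c" by (auto simp: a_def b_def c_def)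
  have ne: "a \<noteq> b" using assms by (simp add: a_def b_def lightcone_inj)
  have "total_u z * total_v z = 9 + (a - b)\<^sup>2 / (a * b) + (b - c)\<^sup>2 / (b * c) + (a - c)\<^sup>2 / (a * c)"
    using pos unfolding total_u_def total_v_def a_def[symmetric] b_def[symmetric] c_def[symmetric]
    by (simp add: field_simps power2_eq_square)
  moreover have "0 < (a - b)\<^sup>2 / (a * b)" using pos ne by (intro divide_pos_pos) auto
  moreover have "0 \<le> (b - c)\<^sup>2 / (b * c)" "0 \<le> (a - c)\<^sup>2 / (a * c)" using pos by auto
  ultimately show ?thesis by linarith
qed

lemma AE_hyp_neq: "AE y in hyp_measure. y \<noteq> c"
  unfolding hyp_measure_def using AE_lborel_singleton[of c] by (subst AE_density) auto

lemma AE_triple_neq: "AE z in triple. fst z \<noteq> fst (snd z)"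
proof -
  have m: "(\<lambda>z. indicator {z. fst z = fst (snd z)} z :: ennreal) \<in> borel_measurable triple"
  proof -
    have "(\<lambda>z. if fst z = fst (snd z) then 1 else 0 :: ennreal) \<in> borel_measurable triple"
      unfolding triple_def by measurable
    then show ?thesis by (simp add: indicator_def of_bool_def)
  qed
  have "(\<integral>\<^sup>+z. indicator {z. fst z = fst (snd z)} z \<partial>triple)
    = (\<integral>\<^sup>+x. \<integral>\<^sup>+y. \<integral>\<^sup>+z. indicator {x} y \<partial>hyp_measure \<partial>hyp_measure \<partial>hyp_measure)"
    by (subst nn_integral_triple[OF m]) (auto simp: indicator_def intro!: nn_integral_cong)
  also have "\<dots> = 0"
  proof -
    have "(\<integral>\<^sup>+y. \<integral>\<^sup>+z. indicator {x} y \<partial>hyp_measure \<partial>hyp_measure) = 0" for x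
    proof (subst nn_integral_0_iff_AE)
      show "AE y in hyp_measure. (\<integral>\<^sup>+z. indicator {x} y \<partial>hyp_measure) = 0"
        using AE_hyp_neq[of x] by eventually_elim simp
    qed measurable
    then show ?thesis by simp
  qed
  finally have "AE z in triple. (indicator {z. fst z = fst (snd z)} z :: ennreal) = 0"
    using nn_integral_0_iff_AE[OF m] by simp
  then show ?thesis by eventually_elim (auto simp: indicator_def)
qed

lemma deficit_pos:
  assumes [measurable]: "f \<in> borel_measurable borel" and nz: "\<not> (AE y in hyp_measure. f y = 0)"
  shows "0 < deficit f"
proof (rule ccontr)
  assume "\<not> 0 < deficit f"
  then have "deficit f = 0" by simp
  then have "AE z in triple. ennreal ((cmod (cube f z))\<^sup>2) * ennreal (8 * pi\<^sup>2 * (pi / sqrt 3 - conv_bound (total_u z) (total_v z))) = 0"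
    unfolding deficit_def by (subst (asm) nn_integral_0_iff_AE) auto
  then have "AE z in triple. ennreal ((cmod (cube f z))\<^sup>2) = 0"
    using AE_triple_neq
  proof eventually_elim
    case (elim z)
    then show ?case using conv_bound_less[OF total_uv_gt9[OF elim(2)]]
      by (auto simp: ennreal_eq_0_iff mult_le_0_iff)
  qed
  then have "(\<integral>\<^sup>+z. ennreal ((cmod (cube f z))\<^sup>2) \<partial>triple) = 0"
    by (subst nn_integral_0_iff_AE) auto
  then have "(\<integral>\<^sup>+y. ennreal ((cmod (f y))\<^sup>2) \<partial>hyp_measure) = 0"
    by (simp add: nn_integral_cube)
  then have "AE y in hyp_measure. ennreal ((cmod (f y))\<^sup>2) = 0"
    by (subst (asm) nn_integral_0_iff_AE) auto
  then have "AE y in hyp_measure. f y = 0" by eventually_elim simp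
  with nz show False by simp
qed

text \<open>Almost everywhere convergence in one variable passes to the tensor cubes by the product
  structure of the measure, and then Fatou applies.\<close>

lemma deficit_le_liminf:
  assumes [measurable]: "f \<in> borel_measurable borel" "\<And>n. g n \<in> borel_measurable borel"
    and lim: "AE y in hyp_measure. (\<lambda>n. g n y) \<longlonglongrightarrow> f y"
  shows "deficit f \<le> liminf (\<lambda>n. deficit (g n))"
proof -
  let ?w = "\<lambda>z. ennreal (8 * pi\<^sup>2 * (pi / sqrt 3 - conv_bound (total_u z) (total_v z)))"
  have ae: "AE z in triple. (\<lambda>n. cube (g n) z) \<longlonglongrightarrow> cube f z"
  proof -
    have 1: "AE y in hyp_measure. AE z in hyp_measure. (\<lambda>n. g n y * g n z) \<longlonglongrightarrow> f y * f z"
      using lim by eventually_elim (use lim in eventually_elim, intro tendsto_mult)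
    have 2: "AE q in hyp_measure \<Otimes>\<^sub>M hyp_measure. (\<lambda>n. g n (fst q) * g n (snd q)) \<longlonglongrightarrow> f (fst q) * f (snd q)"
    proof (rule hyp_pair.AE_pair_measure)
      show "{q \<in> space (hyp_measure \<Otimes>\<^sub>M hyp_measure). (\<lambda>n. g n (fst q) * g n (snd q)) \<longlonglongrightarrow> f (fst q) * f (snd q)}
        \<in> sets (hyp_measure \<Otimes>\<^sub>M hyp_measure)"
        by (subst LIM_zero_iff[symmetric]) measurable
    qed (use 1 in simp)
    have "AE x in hyp_measure. AE q in hyp_measure \<Otimes>\<^sub>M hyp_measure. (\<lambda>n. cube (g n) (x, q)) \<longlonglongrightarrow> cube f (x, q)"
      using lim
    proof eventually_elim
      case x: (elim x)
      show ?case using 2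
      proof eventually_elim
        case (elim q)
        show ?case using tendsto_mult[OF x elim] by (simp add: cube_def)
      qed
    qed
    then show ?thesis unfolding triple_def
    proof (intro hyp3.AE_pair_measure)
      show "{z \<in> space (hyp_measure \<Otimes>\<^sub>M hyp_measure \<Otimes>\<^sub>M hyp_measure). (\<lambda>n. cube (g n) z) \<longlonglongrightarrow> cube f z}
        \<in> sets (hyp_measure \<Otimes>\<^sub>M hyp_measure \<Otimes>\<^sub>M hyp_measure)"
        unfolding triple_def[symmetric] by (subst LIM_zero_iff[symmetric]) measurable
    qed
  qed
  have "deficit f = (\<integral>\<^sup>+z. liminf (\<lambda>n. ennreal ((cmod (cube (g n) z))\<^sup>2) * ?w z) \<partial>triple)"
    unfolding deficit_def using ae
  proof (intro nn_integral_cong_AE, eventually_elim)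
    case (elim z)
    have "(\<lambda>n. ennreal ((cmod (cube (g n) z))\<^sup>2) * ?w z) \<longlonglongrightarrow> ennreal ((cmod (cube f z))\<^sup>2) * ?w z"
      by (subst (1 2) mult.commute, intro ennreal_tendsto_cmult tendsto_ennrealI tendsto_power tendsto_norm elim) auto
    then show ?case by (simp add: lim_imp_Liminf)
  qed
  also have "\<dots> \<le> liminf (\<lambda>n. deficit (g n))"
    unfolding deficit_def by (intro nn_integral_liminf) measurable
  finally show ?thesis .
qed

section \<open>Lebesgue spaces\<close>

lemma Lp_norm_nonneg [simp]: "0 \<le> Lp_norm M p f"
  by (simp add: Lp_norm_def)

lemma Lp_spaceD:
  assumes "f \<in> Lp_space M p"
  shows "f \<in> borel_measurable M" "integrable M (\<lambda>x. cmod (f x) powr p)"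
  using assms by (auto simp: Lp_space_def)

lemma Lp_norm_powr:
  assumes "0 < p"
  shows "Lp_norm M p f powr p = (LINT x|M. cmod (f x) powr p)"
  using assms by (simp add: Lp_norm_def powr_powr)

lemma nn_integral_Lp:
  assumes "0 < p" "f \<in> Lp_space M p"
  shows "(\<integral>\<^sup>+x. ennreal (cmod (f x) powr p) \<partial>M) = ennreal (Lp_norm M p f powr p)"
  unfolding Lp_norm_powr[OF assms(1)]
  by (intro nn_integral_eq_integral Lp_spaceD assms) auto

lemma Lp_spaceI:
  assumes "f \<in> borel_measurable M" "(\<integral>\<^sup>+x. ennreal (cmod (f x) powr p) \<partial>M) < \<infinity>"
  shows "f \<in> Lp_space M p"
  using assms by (auto simp: Lp_space_def intro!: integrableI_nonneg)

text \<open>Convexity of the power function at the points \<open>a / t\<close> and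
  \<open>b / (1 - t)\<close>. Leaving the weight \<open>t\<close> free replaces Hoelder's inequality
  in the proof of the triangle inequality.\<close>

lemma powr_add_le:
  fixes a b t p :: real
  assumes ab: "0 \<le> a" "0 \<le> b" and t: "0 < t" "t < 1" and p: "1 \<le> p"
  shows "(a + b) powr p \<le> t powr (1 - p) * a powr p + (1 - t) powr (1 - p) * b powr p"
proof -
  have ge1: "1 \<le> s powr (1 - p)" if "0 < s" "s < 1" for s :: real
    using powr_mono2'[of "1 - p" s 1] that p by simp
  consider "a = 0" | "b = 0" | "0 < a" "0 < b" using ab by linarith
  then show ?thesis
  proof cases
    case 1
    then show ?thesis using mult_right_mono[OF ge1[of "1 - t"], of "b powr p"] t by simp
  next
    case 2
    then show ?thesis using mult_right_mono[OF ge1[of t], of "a powr p"] t by simp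
  next
    case 3
    have *: "s * (x / s) powr p = s powr (1 - p) * x powr p" if "0 < s" "0 < x" for s x :: real
      using that by (simp add: powr_divide powr_diff)
    have "((1 - t) *\<^sub>R (b / (1 - t)) + t *\<^sub>R (a / t)) powr p \<le> (1 - t) * (b / (1 - t)) powr p + t * (a / t) powr p"
      using 3 t by (intro convex_onD[OF powr_convex[OF p]]) auto
    then show ?thesis using 3 t by (simp add: * add.commute)
  qed
qed

lemma
  fixes f g :: "'a \<Rightarrow> complex"
  assumes p: "1 \<le> p" and f: "f \<in> Lp_space M p" and g: "g \<in> Lp_space M p"
  shows Lp_space_add: "(\<lambda>x. f x + g x) \<in> Lp_space M p"
    and Lp_norm_triangle: "Lp_norm M p (\<lambda>x. f x + g x) \<le> Lp_norm M p f + Lp_norm M p g"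
proof -
  have p0: "0 < p" using p by simp
  have [measurable]: "f \<in> borel_measurable M" "g \<in> borel_measurable M" using f g by (auto dest: Lp_spaceD)
  have If: "integrable M (\<lambda>x. cmod (f x) powr p)" and Ig: "integrable M (\<lambda>x. cmod (g x) powr p)" using f g by (auto dest: Lp_spaceD)
  have pw: "cmod (f x + g x) powr p \<le> t powr (1 - p) * cmod (f x) powr p + (1 - t) powr (1 - p) * cmod (g x) powr p"
    if "0 < t" "t < 1" for t x
  proof -
    have "cmod (f x + g x) powr p \<le> (cmod (f x) + cmod (g x)) powr p"
      using p0 norm_triangle_ineq by (intro powr_mono2) auto
    also have "\<dots> \<le> t powr (1 - p) * cmod (f x) powr p + (1 - t) powr (1 - p) * cmod (g x) powr p"
      using that p by (intro powr_add_le) auto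
    finally show ?thesis .
  qed
  have I: "integrable M (\<lambda>x. cmod (f x + g x) powr p)"
  proof (rule Bochner_Integration.integrable_bound)
    show "integrable M (\<lambda>x. (1/2) powr (1 - p) * cmod (f x) powr p + (1 - 1/2) powr (1 - p) * cmod (g x) powr p)"
      by (intro Bochner_Integration.integrable_add integrable_mult_right If Ig)
    show "AE x in M. norm (cmod (f x + g x) powr p) \<le> norm ((1/2) powr (1 - p) * cmod (f x) powr p + (1 - 1/2) powr (1 - p) * cmod (g x) powr p)"
    proof (rule AE_I2)
      fix x
      show "norm (cmod (f x + g x) powr p) \<le> norm ((1/2) powr (1 - p) * cmod (f x) powr p + (1 - 1/2) powr (1 - p) * cmod (g x) powr p)"
      proof -
        have "cmod (f x + g x) powr p \<le> (1/2) powr (1 - p) * cmod (f x) powr p + (1 - 1/2) powr (1 - p) * cmod (g x) powr p"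
          by (rule pw) auto
        then show ?thesis unfolding real_norm_def by (smt (verit) powr_ge_zero)
      qed
    qed
  qed measurable
  then show "(\<lambda>x. f x + g x) \<in> Lp_space M p" by (simp add: Lp_space_def)
  show "Lp_norm M p (\<lambda>x. f x + g x) \<le> Lp_norm M p f + Lp_norm M p g"
  proof (rule field_le_epsilon)
    fix e :: real assume e: "0 < e"
    \<comment> \<open>The margin \<open>e / 2\<close> keeps \<open>A\<close> and \<open>B\<close>
      positive even if a norm vanishes, so that \<open>t\<close> below lies strictly between 0 and
      1.\<close>
    define A where "A = Lp_norm M p f + e / 2"
    define B where "B = Lp_norm M p g + e / 2"
    have AB: "0 < A" "0 < B" using e by (auto simp: A_def B_def add_nonneg_pos)
    \<comment> \<open>A minimising weight: with it the right-hand side collapses to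
      \<open>(A + B) powr p\<close>.\<close>
    define t where "t = A / (A + B)"
    have t: "0 < t" "t < 1" and t': "1 - t = B / (A + B)" using AB by (auto simp: t_def field_simps)
    have "(LINT x|M. cmod (f x + g x) powr p) \<le> (LINT x|M. t powr (1 - p) * cmod (f x) powr p + (1 - t) powr (1 - p) * cmod (g x) powr p)"
      using If Ig by (intro integral_mono I pw t Bochner_Integration.integrable_add integrable_mult_right)
    also have "\<dots> = t powr (1 - p) * Lp_norm M p f powr p + (1 - t) powr (1 - p) * Lp_norm M p g powr p"
      using If Ig by (simp add: Lp_norm_powr[OF p0])
    also have "\<dots> \<le> t powr (1 - p) * A powr p + (1 - t) powr (1 - p) * B powr p"
      using e p0 by (intro add_mono mult_left_mono powr_mono2) (auto simp: A_def B_def)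
    also have "\<dots> = (A + B) powr p"
    proof -
      have *: "(x / s) powr (1 - p) * x powr p = s powr (p - 1) * x" if "0 < s" "0 < x" for s x
      proof -
        have "(x / s) powr (1 - p) * x powr p = x powr (1 - p) * x powr p / s powr (1 - p)"
          using that by (simp add: powr_divide)
        also have "x powr (1 - p) * x powr p = x" using that by (simp flip: powr_add)
        also have "x / s powr (1 - p) = s powr (p - 1) * x"
          using that by (simp add: powr_diff field_simps)
        finally show ?thesis .
      qed
      have "t powr (1 - p) * A powr p + (1 - t) powr (1 - p) * B powr p = (A + B) powr (p - 1) * (A + B)"
        unfolding t' unfolding t_def using AB by (simp add: * distrib_left)
      also have "\<dots> = (A + B) powr p" using AB by (simp add: powr_diff)
      finally show ?thesis .
    qed
    finally have "Lp_norm M p (\<lambda>x. f x + g x) \<le> ((A + B) powr p) powr (1 / p)"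
      unfolding Lp_norm_def using p0 by (intro powr_mono2 integral_nonneg_AE) auto
    also have "\<dots> = A + B" using AB p0 by (simp add: powr_powr)
    finally show "Lp_norm M p (\<lambda>x. f x + g x) \<le> Lp_norm M p f + Lp_norm M p g + e"
      by (simp add: A_def B_def)
  qed
qed

lemma Lp_space_uminus: "f \<in> Lp_space M p \<Longrightarrow> (\<lambda>x. - f x) \<in> Lp_space M p"
  by (simp add: Lp_space_def)

lemma Lp_norm_minus_commute: "Lp_norm M p (\<lambda>x. f x - g x) = Lp_norm M p (\<lambda>x. g x - f x)"
  by (simp add: Lp_norm_def norm_minus_commute)

lemma Lp_space_diff:
  assumes "1 \<le> p" "f \<in> Lp_space M p" "g \<in> Lp_space M p"
  shows "(\<lambda>x. f x - g x) \<in> Lp_space M p"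
  using Lp_space_add[OF assms(1,2) Lp_space_uminus[OF assms(3)]] by simp

lemma Lp_norm_diff_le:
  assumes p: "1 \<le> p" and f: "f \<in> Lp_space M p" and g: "g \<in> Lp_space M p"
  shows "\<bar>Lp_norm M p f - Lp_norm M p g\<bar> \<le> Lp_norm M p (\<lambda>x. f x - g x)"
proof -
  have "Lp_norm M p f \<le> Lp_norm M p (\<lambda>x. f x - g x) + Lp_norm M p g"
    using Lp_norm_triangle[OF p Lp_space_diff[OF p f g] g] by simp
  moreover have "Lp_norm M p g \<le> Lp_norm M p (\<lambda>x. g x - f x) + Lp_norm M p f"
    using Lp_norm_triangle[OF p Lp_space_diff[OF p g f] f] by simp
  ultimately show ?thesis using Lp_norm_minus_commute[of M p f g] by linarith
qed

lemma Lp_tendsto_norm: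
  assumes "1 \<le> p" "Lp_tendsto M p g f"
  shows "(\<lambda>n. Lp_norm M p (g n)) \<longlonglongrightarrow> Lp_norm M p f"
proof -
  have "(\<lambda>n. Lp_norm M p (g n) - Lp_norm M p f) \<longlonglongrightarrow> 0"
    by (rule Lim_null_comparison[where g="\<lambda>n. Lp_norm M p (\<lambda>x. g n x - f x)"])
       (use assms in \<open>auto simp: Lp_tendsto_def intro!: always_eventually Lp_norm_diff_le\<close>)
  then show ?thesis by (rule LIM_zero_cancel)
qed

lemma Lp_tendsto_subseq: "Lp_tendsto M p g f \<Longrightarrow> strict_mono r \<Longrightarrow> Lp_tendsto M p (\<lambda>n. g (r n)) f"
  unfolding Lp_tendsto_def using LIMSEQ_subseq_LIMSEQ[of "\<lambda>n. Lp_norm M p (\<lambda>x. g n x - f x)" 0 r]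
  by (auto simp: o_def)

lemma Lp_tendsto_AE_subseq:
  assumes p: "1 \<le> p" and t: "Lp_tendsto M p g f"
  obtains r :: "nat \<Rightarrow> nat" where "strict_mono r" "AE x in M. (\<lambda>n. g (r n) x) \<longlonglongrightarrow> f x"
proof -
  have p0: "0 < p" using p by simp
  have L: "(\<lambda>x. g n x - f x) \<in> Lp_space M p" for n
    using t p by (intro Lp_space_diff) (auto simp: Lp_tendsto_def)
  have l: "(\<lambda>n. LINT x|M. norm (cmod (g n x - f x) powr p)) \<longlonglongrightarrow> 0"
  proof -
    have "(\<lambda>n. Lp_norm M p (\<lambda>x. g n x - f x) powr p) \<longlonglongrightarrow> 0 powr p"
      using t p0 by (intro tendsto_powr' tendsto_const) (auto simp: Lp_tendsto_def)
    then show ?thesis using p0 by (simp add: Lp_norm_powr)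
  qed
  have "\<exists>r::nat\<Rightarrow>nat. strict_mono r \<and> (AE x in M. (\<lambda>n. cmod (g (r n) x - f x) powr p) \<longlonglongrightarrow> 0)"
    by (rule tendsto_L1_AE_subseq[OF Lp_spaceD(2)[OF L] l])
  then obtain r :: "nat \<Rightarrow> nat" where r: "strict_mono r" "AE x in M. (\<lambda>n. cmod (g (r n) x - f x) powr p) \<longlonglongrightarrow> 0" by blast
  have "AE x in M. (\<lambda>n. g (r n) x) \<longlonglongrightarrow> f x"
    using r(2)
  proof eventually_elim
    case (elim x)
    have "(\<lambda>n. (cmod (g (r n) x - f x) powr p) powr (1 / p)) \<longlonglongrightarrow> 0 powr (1 / p)"
      using p0 by (intro tendsto_powr' elim tendsto_const) auto
    then have "(\<lambda>n. cmod (g (r n) x - f x)) \<longlonglongrightarrow> 0" using p0 by (simp add: powr_powr)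
    then show ?case by (rule LIM_zero_cancel[OF tendsto_norm_zero_cancel])
  qed
  with r(1) show thesis by (rule that)
qed

section \<open>Schwartz functions and their extensions\<close>

lemma schwartz_zero: "schwartz (\<lambda>y. 0)"
  unfolding schwartz_def by (rule exI[of _ "\<lambda>n y. 0"]) auto

lemma schwartz_add:
  assumes "schwartz f" "schwartz g" shows "schwartz (\<lambda>y. f y + g y)"
proof -
  from assms obtain D E where D: "D 0 = f" "\<And>n y. (D n has_vector_derivative D (Suc n) y) (at y)"
      "\<And>n k. bounded (range (\<lambda>y. y ^ k *\<^sub>R D n y))"
    and E: "E 0 = g" "\<And>n y. (E n has_vector_derivative E (Suc n) y) (at y)"
      "\<And>n k. bounded (range (\<lambda>y. y ^ k *\<^sub>R E n y))"
    unfolding schwartz_def by blast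
  show ?thesis unfolding schwartz_def
  proof (intro exI[of _ "\<lambda>n y. D n y + E n y"] conjI allI)
    show "((\<lambda>y. D n y + E n y) has_vector_derivative D (Suc n) y + E (Suc n) y) (at y)" for n y
      by (intro derivative_intros D E)
    show "bounded (range (\<lambda>y. y ^ k *\<^sub>R (D n y + E n y)))" for n k
      using bounded_plus_comp[OF D(3)[of k n] E(3)[of k n]] by (simp add: scaleR_add_right)
  qed (simp add: D E)
qed

lemma schwartz_cmult:
  assumes "schwartz f" shows "schwartz (\<lambda>y. c * f y)"
proof -
  from assms obtain D where D: "D 0 = f" "\<And>n y. (D n has_vector_derivative D (Suc n) y) (at y)"
      "\<And>n k. bounded (range (\<lambda>y. y ^ k *\<^sub>R D n y))"
    unfolding schwartz_def by blast
  show ?thesis unfolding schwartz_def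
  proof (intro exI[of _ "\<lambda>n y. c * D n y"] conjI allI)
    show "((\<lambda>y. c * D n y) has_vector_derivative c * D (Suc n) y) (at y)" for n y
      by (intro has_vector_derivative_mult_right D)
    show "bounded (range (\<lambda>y. y ^ k *\<^sub>R (c * D n y)))" for n k
    proof -
      obtain B where "\<And>y. norm (y ^ k *\<^sub>R D n y) \<le> B" using D(3)[of k n] by (auto simp: bounded_iff)
      then have "norm (y ^ k *\<^sub>R (c * D n y)) \<le> cmod c * B" for y
        using mult_left_mono[of "norm (y ^ k *\<^sub>R D n y)" B "cmod c"] by (simp add: norm_mult ac_simps)
      then show ?thesis by (auto simp: bounded_iff)
    qed
  qed (simp add: D)
qed

lemma schwartz_diff: "schwartz f \<Longrightarrow> schwartz g \<Longrightarrow> schwartz (\<lambda>y. f y - g y)"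
  using schwartz_add[of f "\<lambda>y. (-1) * g y"] schwartz_cmult[of g "-1"] by simp

lemma schwartz_measurable: assumes "schwartz f" shows "f \<in> borel_measurable borel"
proof -
  from assms obtain D where D: "D 0 = f" "\<And>n y. (D n has_vector_derivative D (Suc n) y) (at y)"
    unfolding schwartz_def by blast
  have "\<And>y. isCont f y" using D(2)[of 0] unfolding D(1) by (rule has_vector_derivative_continuous)
  then show ?thesis
    by (intro borel_measurable_continuous_onI continuous_at_imp_continuous_on) auto
qed

lemma schwartz_decay:
  assumes "schwartz f" obtains C where "0 \<le> C" "\<And>y. cmod (f y) \<le> C / (1 + y\<^sup>2)"
proof -
  from assms obtain D where D: "D 0 = f" "\<And>n k. bounded (range (\<lambda>y. y ^ k *\<^sub>R D n y))"
      "\<And>n y. (D n has_vector_derivative D (Suc n) y) (at y)"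
    unfolding schwartz_def by blast
  have b: "bounded (range (\<lambda>y. y ^ k *\<^sub>R f y))" for k using D(2)[of k 0] by (simp add: D(1))
  obtain A where A: "\<And>y. norm (y ^ 0 *\<^sub>R f y) \<le> A" using b[of 0] by (auto simp: bounded_iff)
  obtain B where B: "\<And>y. norm (y ^ 2 *\<^sub>R f y) \<le> B" using b[of 2] by (auto simp: bounded_iff)
  have "cmod (f y) \<le> (A + B) / (1 + y\<^sup>2)" for y
  proof -
    have "cmod (f y) * (1 + y\<^sup>2) \<le> A + B" using A[of y] B[of y] by (simp add: algebra_simps)
    moreover have "0 < 1 + y\<^sup>2" by (smt (verit) zero_le_power2)
    ultimately show ?thesis by (simp add: pos_le_divide_eq)
  qed
  moreover have "0 \<le> A + B"
    by (rule add_nonneg_nonneg[OF order_trans[OF norm_ge_zero A[of 0]] order_trans[OF norm_ge_zero B[of 0]]])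
  ultimately show thesis using that by blast
qed

section \<open>The Cauchy integral and integrability of Schwartz functions\<close>

lemma nn_integral_inverse_square_le:
  "(\<integral>\<^sup>+x. ennreal (1 / (1 + x\<^sup>2)) \<partial>lborel) \<le> ennreal pi"
proof -
  have pos: "0 < 1 + x\<^sup>2" for x :: real by (smt (verit) zero_le_power2)
  have "(\<integral>\<^sup>+x. ennreal (1 / (1 + x\<^sup>2)) \<partial>lborel)
     = (\<integral>\<^sup>+x\<in>UNIV. ennreal (\<bar>inverse (1 + x\<^sup>2)\<bar> * indicator {- (pi/2)..pi/2} (arctan x)) \<partial>lborel)"
  proof (intro nn_integral_cong)
    fix x :: real
    show "ennreal (1 / (1 + x\<^sup>2)) = ennreal (\<bar>inverse (1 + x\<^sup>2)\<bar> * indicator {- (pi/2)..pi/2} (arctan x)) * indicator UNIV x"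
    proof -
      have "indicator {- (pi/2)..pi/2} (arctan x) = (1::real)"
        using arctan_bounded[of x] by (intro indicator_eq_1_iff[THEN iffD2]) auto
      moreover have "\<bar>inverse (1 + x\<^sup>2)\<bar> = 1 / (1 + x\<^sup>2)"
        unfolding inverse_eq_divide using pos[of x] by (intro abs_of_nonneg) (simp add: less_imp_le)
      ultimately show ?thesis by (simp only: mult_1_right indicator_UNIV)
    qed
  qed
  also have "\<dots> \<le> (\<integral>\<^sup>+x. ennreal (indicator {- (pi/2)..pi/2} x) \<partial>lborel)"
  proof (rule nn_integral_substitution_le)
    show "(arctan has_field_derivative inverse (1 + x\<^sup>2)) (at x)" for x :: real
      by (rule DERIV_arctan)
    show "inj_on arctan UNIV" by (rule inj_onI) (simp add: arctan_eq_iff)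
    show "indicat_real {- (pi / 2)..pi / 2} \<in> borel_measurable borel" by measurable
  qed simp_all
  also have "\<dots> = ennreal pi"
  proof -
    have "emeasure lborel {- (pi/2)..pi/2} = ennreal pi" by (subst emeasure_lborel_Icc) auto
    then show ?thesis by (simp only: ennreal_indicator) (subst nn_integral_indicator, auto)
  qed
  finally show ?thesis .
qed

text \<open>The substitution lemma bounds only from above, so this direction applies it to
  \<open>tan\<close>, the inverse of \<open>arctan\<close>. The exact value matters for the time
  integral in \<open>chirp_sixth_moment\<close>.\<close>

lemma nn_integral_inverse_square_ge:
  "ennreal pi \<le> (\<integral>\<^sup>+x. ennreal (1 / (1 + x\<^sup>2)) \<partial>lborel)"
proof -
  have "ennreal pi = (\<integral>\<^sup>+x\<in>{- (pi/2)<..<pi/2}. ennreal 1 \<partial>lborel)"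
  proof -
    have "emeasure lborel {- (pi/2)<..<pi/2} = ennreal pi" by (subst emeasure_lborel_Ioo) auto
    then show ?thesis by simp
  qed
  also have "\<dots> = (\<integral>\<^sup>+x\<in>{- (pi/2)<..<pi/2}. ennreal (\<bar>inverse ((cos x)\<^sup>2)\<bar> * (1 / (1 + (tan x)\<^sup>2))) \<partial>lborel)"
  proof (intro nn_integral_cong)
    fix x :: real
    show "ennreal 1 * indicator {- (pi/2)<..<pi/2} x = ennreal (\<bar>inverse ((cos x)\<^sup>2)\<bar> * (1 / (1 + (tan x)\<^sup>2))) * indicator {- (pi/2)<..<pi/2} x"
    proof (cases "x \<in> {- (pi/2)<..<pi/2}")
      case True
      then have c0: "0 < cos x" by (intro cos_gt_zero_pi) auto
      then have "1 + (tan x)\<^sup>2 = inverse ((cos x)\<^sup>2)" using tan_sec[of x] by (simp only: power_inverse)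
      then have "\<bar>inverse ((cos x)\<^sup>2)\<bar> * (1 / (1 + (tan x)\<^sup>2)) = 1" using c0 by simp
      then show ?thesis by (simp only:)
    qed simp
  qed
  also have "\<dots> \<le> (\<integral>\<^sup>+x. ennreal (1 / (1 + x\<^sup>2)) \<partial>lborel)"
  proof (rule nn_integral_substitution_le)
    show "(tan has_field_derivative inverse ((cos x)\<^sup>2)) (at x)" if "x \<in> {- (pi/2)<..<pi/2}" for x
    proof (rule DERIV_tan)
      have "0 < cos x" using that by (intro cos_gt_zero_pi) auto
      then show "cos x \<noteq> 0" by simp
    qed
    show "inj_on tan {- (pi/2)<..<pi/2::real}"
    proof (rule inj_onI)
      fix x y :: real assume xy: "x \<in> {- (pi/2)<..<pi/2}" "y \<in> {- (pi/2)<..<pi/2}" "tan x = tan y"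
      have "x = arctan (tan x)" using xy(1) by (intro arctan_tan[symmetric]) auto
      also have "\<dots> = arctan (tan y)" unfolding xy(3) ..
      also have "\<dots> = y" using xy(2) by (intro arctan_tan) auto
      finally show "x = y" .
    qed
    show "(\<lambda>x::real. 1 / (1 + x\<^sup>2)) \<in> borel_measurable borel" by measurable
    show "0 \<le> 1 / (1 + x\<^sup>2)" for x :: real by (simp add: add_nonneg_nonneg)
    show "{- (pi/2)<..<pi/2} \<in> sets borel" by simp
  qed
  finally show ?thesis .
qed

lemma nn_integral_inverse_square: "(\<integral>\<^sup>+x. ennreal (1 / (1 + x\<^sup>2)) \<partial>lborel) = ennreal pi"
  by (rule antisym[OF nn_integral_inverse_square_le nn_integral_inverse_square_ge])

lemma nn_integral_hyp_le_lborel: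
  assumes "f \<in> borel_measurable borel"
  shows "(\<integral>\<^sup>+y. f y \<partial>hyp_measure) \<le> (\<integral>\<^sup>+y. f y \<partial>lborel)"
proof -
  have "ennreal (1 / jbracket y) * f y \<le> 1 * f y" for y
    by (intro mult_right_mono) auto
  then show ?thesis using assms by (subst nn_integral_hyp) (auto intro!: nn_integral_mono)
qed

lemma
  assumes f: "schwartz f"
  shows schwartz_integrable: "integrable hyp_measure f"
    and schwartz_L2: "f \<in> Lp_space hyp_measure 2"
proof -
  note [measurable] = schwartz_measurable[OF f]
  obtain C where C: "0 \<le> C" "\<And>y. cmod (f y) \<le> C / (1 + y\<^sup>2)" using schwartz_decay[OF f] by auto
  have "(\<integral>\<^sup>+y. ennreal (C * (1 / (1 + y\<^sup>2))) \<partial>hyp_measure) \<le> (\<integral>\<^sup>+y. ennreal (C * (1 / (1 + y\<^sup>2))) \<partial>lborel)"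
    by (rule nn_integral_hyp_le_lborel) measurable
  also have "\<dots> = ennreal C * ennreal pi"
    using C(1) by (simp add: ennreal_mult' nn_integral_cmult nn_integral_inverse_square del: times_divide_eq_right)
  finally have fin: "(\<integral>\<^sup>+y. ennreal (C * (1 / (1 + y\<^sup>2))) \<partial>hyp_measure) < \<infinity>"
    by (rule order.strict_trans1) (simp add: ennreal_mult_less_top)
  show "integrable hyp_measure f"
  proof (rule integrableI_bounded)
    have "(\<integral>\<^sup>+y. ennreal (cmod (f y)) \<partial>hyp_measure) \<le> (\<integral>\<^sup>+y. ennreal (C * (1 / (1 + y\<^sup>2))) \<partial>hyp_measure)"
      using C(2) by (intro nn_integral_mono ennreal_leI) simp
    then show "(\<integral>\<^sup>+y. ennreal (cmod (f y)) \<partial>hyp_measure) < \<infinity>" using fin by (rule order.strict_trans1)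
  qed measurable
  show "f \<in> Lp_space hyp_measure 2"
  proof (rule Lp_spaceI)
    have "cmod (f y) powr 2 \<le> C * (C * (1 / (1 + y\<^sup>2)))" for y
    proof -
      have "0 < 1 + y\<^sup>2" by (smt (verit) zero_le_power2)
      then have "C / (1 + y\<^sup>2) \<le> C" using C(1) by (simp add: divide_le_eq mult_le_cancel_left1)
      then have "cmod (f y) * cmod (f y) \<le> C * (C / (1 + y\<^sup>2))"
        using C by (intro mult_mono) (auto intro: order_trans)
      then show ?thesis by (simp add: power2_eq_square)
    qed
    then have "(\<integral>\<^sup>+y. ennreal (cmod (f y) powr 2) \<partial>hyp_measure) \<le> (\<integral>\<^sup>+y. ennreal C * ennreal (C * (1 / (1 + y\<^sup>2))) \<partial>hyp_measure)"
      using C(1) by (intro nn_integral_mono) (simp add: ennreal_mult'[symmetric] ennreal_leI)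
    also have "\<dots> = ennreal C * (\<integral>\<^sup>+y. ennreal (C * (1 / (1 + y\<^sup>2))) \<partial>hyp_measure)"
      by (intro nn_integral_cmult) measurable
    also have "\<dots> < \<infinity>" using fin by (simp add: ennreal_mult_less_top)
    finally show "(\<integral>\<^sup>+y. ennreal (cmod (f y) powr 2) \<partial>hyp_measure) < \<infinity>" .
  qed measurable
qed

lemma extension_integral_diff:
  assumes "integrable hyp_measure f" "integrable hyp_measure g"
  shows "extension_integral (\<lambda>y. f y - g y) p = extension_integral f p - extension_integral g p"
  unfolding extension_integral_eq right_diff_distrib
  by (intro Bochner_Integration.integral_diff planewave_integrable assms)

lemma
  assumes f: "schwartz f"
  shows schwartz_extension_L6: "extension_integral f \<in> Lp_space lborel 6"
    and schwartz_strichartz_deficit: "ennreal (Lp_norm lborel 6 (extension_integral f) ^ 6) + deficit f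
       \<le> ennreal (sharp6 * Lp_norm hyp_measure 2 f ^ 6)"
proof -
  note [measurable] = schwartz_measurable[OF f]
  have 2: "(\<integral>\<^sup>+y. ennreal ((cmod (f y))\<^sup>2) \<partial>hyp_measure) = ennreal ((Lp_norm hyp_measure 2 f)\<^sup>2)"
    using nn_integral_Lp[OF _ schwartz_L2[OF f]] by simp
  have le: "(\<integral>\<^sup>+p. ennreal (cmod (extension_integral f p) ^ 6) \<partial>lborel) + deficit f
    \<le> ennreal (sharp6 * Lp_norm hyp_measure 2 f ^ 6)"
    using strichartz_deficit[OF schwartz_integrable[OF f]] sharp6_pos unfolding 2
    by (simp add: ennreal_power ennreal_mult' flip: power_mult)
  show L6: "extension_integral f \<in> Lp_space lborel 6"
  proof (rule Lp_spaceI)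
    have "(\<integral>\<^sup>+p. ennreal (cmod (extension_integral f p) powr 6) \<partial>lborel) \<le> ennreal (sharp6 * Lp_norm hyp_measure 2 f ^ 6)"
      using order_trans[OF add_increasing2[OF _ order_refl] le] by simp
    then show "(\<integral>\<^sup>+p. ennreal (cmod (extension_integral f p) powr 6) \<partial>lborel) < \<infinity>"
      by (rule order.strict_trans1) simp
  qed measurable
  show "ennreal (Lp_norm lborel 6 (extension_integral f) ^ 6) + deficit f \<le> ennreal (sharp6 * Lp_norm hyp_measure 2 f ^ 6)"
    using le nn_integral_Lp[OF _ L6] by simp
qed

lemma schwartz_strichartz:
  assumes f: "schwartz f"
  shows "Lp_norm lborel 6 (extension_integral f) \<le> root 6 sharp6 * Lp_norm hyp_measure 2 f"
proof -
  have "ennreal (Lp_norm lborel 6 (extension_integral f) ^ 6) \<le> ennreal (sharp6 * Lp_norm hyp_measure 2 f ^ 6)"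
    using order_trans[OF add_increasing2[OF _ order_refl] schwartz_strichartz_deficit[OF f]] by simp
  then have "Lp_norm lborel 6 (extension_integral f) ^ 6 \<le> (root 6 sharp6 * Lp_norm hyp_measure 2 f) ^ 6"
    using sharp6_pos by (simp add: power_mult_distrib)
  then show ?thesis using sharp6_pos power_le_imp_le_base[of "Lp_norm lborel 6 (extension_integral f)" 5] by simp
qed

text \<open>By linearity the Strichartz bound controls differences, so an L2 Cauchy sequence of
  Schwartz functions has extensions that are Cauchy in L6.\<close>

lemma extension_integral_cauchy:
  assumes "schwartz f" "schwartz g"
  shows "Lp_norm lborel 6 (\<lambda>p. extension_integral f p - extension_integral g p)
    \<le> root 6 sharp6 * Lp_norm hyp_measure 2 (\<lambda>y. f y - g y)"
  using schwartz_strichartz[OF schwartz_diff[OF assms]]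
  unfolding extension_integral_diff[OF schwartz_integrable[OF assms(1)] schwartz_integrable[OF assms(2)], abs_def] .

section \<open>Limits of extensions and strictness\<close>

lemma is_extension_schwartz:
  assumes f: "schwartz f" shows "is_extension f (extension_integral f)"
  unfolding is_extension_def Lp_tendsto_def
  by (rule exI[of _ "\<lambda>n. f"]) (auto simp: f schwartz_L2 schwartz_extension_L6, simp_all add: Lp_norm_def)

text \<open>The choice in \<open>extension_op\<close> need not return
  \<open>extension_integral f\<close>, so its norm has to be identified. Both functions are L6
  limits of the same sequence of extensions; comparing norms is enough, without almost everywhere
  equality.\<close>

lemma is_extension_schwartz_norm:
  assumes f: "schwartz f" and F: "is_extension f F"
  shows "Lp_norm lborel 6 F = Lp_norm lborel 6 (extension_integral f)"
proof -
  obtain g where g: "\<And>n. schwartz (g n)" "Lp_tendsto hyp_measure 2 g f"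
    "Lp_tendsto lborel 6 (\<lambda>n. extension_integral (g n)) F"
    using F unfolding is_extension_def by blast
  have "Lp_tendsto lborel 6 (\<lambda>n. extension_integral (g n)) (extension_integral f)"
    unfolding Lp_tendsto_def
  proof (intro conjI allI schwartz_extension_L6 f g)
    have "(\<lambda>n. root 6 sharp6 * Lp_norm hyp_measure 2 (\<lambda>y. g n y - f y)) \<longlonglongrightarrow> root 6 sharp6 * 0"
      using g(2) by (intro tendsto_mult tendsto_const) (simp add: Lp_tendsto_def)
    then have l: "(\<lambda>n. root 6 sharp6 * Lp_norm hyp_measure 2 (\<lambda>y. g n y - f y)) \<longlonglongrightarrow> 0" by simp
    show "(\<lambda>n. Lp_norm lborel 6 (\<lambda>x. extension_integral (g n) x - extension_integral f x)) \<longlonglongrightarrow> 0"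
    proof (rule Lim_null_comparison[OF always_eventually l], rule allI)
      show "norm (Lp_norm lborel 6 (\<lambda>x. extension_integral (g n) x - extension_integral f x))
        \<le> root 6 sharp6 * Lp_norm hyp_measure 2 (\<lambda>y. g n y - f y)" for n
        using extension_integral_cauchy[OF g(1) f] by simp
    qed
  qed
  then have "(\<lambda>n. Lp_norm lborel 6 (extension_integral (g n))) \<longlonglongrightarrow> Lp_norm lborel 6 (extension_integral f)"
    by (rule Lp_tendsto_norm[rotated]) simp
  moreover have "(\<lambda>n. Lp_norm lborel 6 (extension_integral (g n))) \<longlonglongrightarrow> Lp_norm lborel 6 F"
    by (rule Lp_tendsto_norm[OF _ g(3)]) simp
  ultimately show ?thesis by (rule LIMSEQ_unique[symmetric])
qed

lemma is_extension_strict: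
  assumes f: "f \<in> nonzero_L2" and F: "is_extension f F"
  shows "Lp_norm lborel 6 F < root 6 sharp6 * Lp_norm hyp_measure 2 f"
proof -
  have fL: "f \<in> Lp_space hyp_measure 2" and nz: "\<not> (AE y in hyp_measure. f y = 0)"
    using f by (auto simp: nonzero_L2_def)
  have [measurable]: "f \<in> borel_measurable borel"
    using Lp_spaceD(1)[OF fL] by (simp cong: measurable_cong_sets)
  obtain g0 where g0: "\<And>n. schwartz (g0 n)" "Lp_tendsto hyp_measure 2 g0 f"
    "Lp_tendsto lborel 6 (\<lambda>n. extension_integral (g0 n)) F"
    using F unfolding is_extension_def by blast
  \<comment> \<open>L2 convergence alone gives no pointwise limit, which the semicontinuity of the
    deficit requires.\<close>
  obtain r :: "nat \<Rightarrow> nat" where r: "strict_mono r" "AE x in hyp_measure. (\<lambda>n. g0 (r n) x) \<longlonglongrightarrow> f x"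
    using Lp_tendsto_AE_subseq[OF _ g0(2)] by auto
  define g where "g n = g0 (r n)" for n
  have g: "schwartz (g n)" for n by (simp add: g_def g0)
  have n2: "(\<lambda>n. Lp_norm hyp_measure 2 (g n)) \<longlonglongrightarrow> Lp_norm hyp_measure 2 f"
    unfolding g_def by (rule Lp_tendsto_norm[OF _ Lp_tendsto_subseq[OF g0(2) r(1)]]) simp
  have n6: "(\<lambda>n. Lp_norm lborel 6 (extension_integral (g n))) \<longlonglongrightarrow> Lp_norm lborel 6 F"
    unfolding g_def by (rule Lp_tendsto_norm[OF _ Lp_tendsto_subseq[OF g0(3) r(1)]]) simp
  have "0 < deficit f" by (rule deficit_pos[OF _ nz]) measurable
  also have "deficit f \<le> liminf (\<lambda>n. deficit (g n))"
    by (rule deficit_le_liminf) (use r(2) g in \<open>auto simp: g_def intro: schwartz_measurable\<close>)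
  finally have "0 < liminf (\<lambda>n. deficit (g n))" .
  \<comment> \<open>The lower limit may be infinite; a value strictly below it is finite, and a
    fixed real gap \<open>d\<close> can be carried through the limit of real inequalities.\<close>
  from dense[OF this] obtain d0 where d0: "0 < d0" "d0 < liminf (\<lambda>n. deficit (g n))" by auto
  then obtain d where d: "0 < d" "ennreal d = d0" by (cases d0) auto
  have ev: "\<forall>\<^sub>F n in sequentially. d0 < deficit (g n)" using d0(2) by (rule less_LiminfD)
  have "\<forall>\<^sub>F n in sequentially. Lp_norm lborel 6 (extension_integral (g n)) ^ 6 + d \<le> sharp6 * Lp_norm hyp_measure 2 (g n) ^ 6"
    using ev
  proof eventually_elim
    case (elim n)
    have "ennreal (Lp_norm lborel 6 (extension_integral (g n)) ^ 6) + ennreal d \<le> ennreal (sharp6 * Lp_norm hyp_measure 2 (g n) ^ 6)"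
      using order_trans[OF add_left_mono[OF less_imp_le[OF elim]] schwartz_strichartz_deficit[OF g]] d(2) by simp
    then show ?case using d(1) sharp6_pos by (simp add: ennreal_plus[symmetric] del: ennreal_plus)
  qed
  then have "Lp_norm lborel 6 F ^ 6 + d \<le> sharp6 * Lp_norm hyp_measure 2 f ^ 6"
    by (intro tendsto_le[OF sequentially_bot _ _ ]) (auto intro!: tendsto_intros n2 n6)
  then have "Lp_norm lborel 6 F ^ 6 < (root 6 sharp6 * Lp_norm hyp_measure 2 f) ^ 6"
    using d(1) sharp6_pos by (simp add: power_mult_distrib)
  then show ?thesis using sharp6_pos power_less_imp_less_base[of "Lp_norm lborel 6 F" 6] by simp
qed

section \<open>Density of Schwartz functions and existence of extensions\<close>

lemma power_le_fact_exp:
  fixes x :: real assumes "0 \<le> x" shows "x ^ n \<le> fact n * exp x"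
proof -
  have "(\<Sum>k\<in>{n}. x ^ k /\<^sub>R fact k) \<le> (\<Sum>k. x ^ k /\<^sub>R fact k)"
    using assms by (intro sum_le_suminf summable_exp_generic) auto
  then have "x ^ n /\<^sub>R fact n \<le> exp x" by (simp add: exp_def)
  then show ?thesis by (simp add: field_simps)
qed

lemma poly_gaussian_bounded:
  fixes p :: "real poly" shows "\<exists>B. \<forall>z. \<bar>poly p z\<bar> * exp (- z\<^sup>2) \<le> B"
proof (intro exI allI)
  fix z :: real
  have pw: "\<bar>z\<bar> ^ i * exp (- z\<^sup>2) \<le> fact i * exp 1" for i
  proof -
    have "\<bar>z\<bar> - z\<^sup>2 \<le> 1"
      using zero_le_power2[of "\<bar>z\<bar> - 1/2"] by (simp add: power2_eq_square algebra_simps)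
    have "\<bar>z\<bar> ^ i * exp (- z\<^sup>2) \<le> fact i * exp \<bar>z\<bar> * exp (- z\<^sup>2)"
      by (intro mult_right_mono power_le_fact_exp) auto
    also have "\<dots> = fact i * exp (\<bar>z\<bar> - z\<^sup>2)" by (simp add: exp_diff exp_minus field_simps)
    also have "\<dots> \<le> fact i * exp 1" using \<open>\<bar>z\<bar> - z\<^sup>2 \<le> 1\<close> by (intro mult_left_mono) auto
    finally show ?thesis .
  qed
  have "\<bar>poly p z\<bar> * exp (- z\<^sup>2) \<le> (\<Sum>i\<le>degree p. \<bar>coeff p i\<bar> * \<bar>z\<bar> ^ i) * exp (- z\<^sup>2)"
    unfolding poly_altdef by (intro mult_right_mono order_trans[OF sum_abs]) (auto simp: abs_mult power_abs)
  also have "\<dots> = (\<Sum>i\<le>degree p. \<bar>coeff p i\<bar> * (\<bar>z\<bar> ^ i * exp (- z\<^sup>2)))"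
    by (simp add: sum_distrib_right mult.assoc)
  also have "\<dots> \<le> (\<Sum>i\<le>degree p. \<bar>coeff p i\<bar> * (fact i * exp 1))"
    by (intro sum_mono mult_left_mono pw) auto
  finally show "\<bar>poly p z\<bar> * exp (- z\<^sup>2) \<le> (\<Sum>i\<le>degree p. \<bar>coeff p i\<bar> * (fact i * exp 1))" .
qed

text \<open>These functions are closed under differentiation, as (p e^(-q))' = (p' - p q') e^(-q),
  and the lower bound on \<open>q\<close> gives Gaussian decay. One family thus supplies both the
  test Gaussians and the approximants of interval indicators.\<close>

lemma schwartz_poly_exp:
  fixes p q :: "real poly"
  assumes r: "0 < r" and q: "\<And>y. ((y - c) / r)\<^sup>2 - 1 \<le> poly q y"
  shows "schwartz (\<lambda>y. complex_of_real (poly p y * exp (- poly q y)))"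
proof -
  define P where "P = rec_nat p (\<lambda>_ p. pderiv p - p * pderiv q)"
  have P: "P 0 = p" "P (Suc n) = pderiv (P n) - P n * pderiv q" for n by (simp_all add: P_def)
  show ?thesis unfolding schwartz_def
  proof (intro exI[of _ "\<lambda>n y. complex_of_real (poly (P n) y * exp (- poly q y))"] conjI allI)
    show "((\<lambda>y. complex_of_real (poly (P n) y * exp (- poly q y))) has_vector_derivative
        complex_of_real (poly (P (Suc n)) y * exp (- poly q y))) (at y)" for n y
    proof (rule has_vector_derivative_of_real)
      show "((\<lambda>y. poly (P n) y * exp (- poly q y)) has_real_derivative poly (P (Suc n)) y * exp (- poly q y)) (at y)"
        by (auto intro!: derivative_eq_intros simp: P algebra_simps)
    qed
    show "bounded (range (\<lambda>y. y ^ k *\<^sub>R complex_of_real (poly (P n) y * exp (- poly q y))))" for n k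
    proof -
      \<comment> \<open>The polynomial in the variable z = (y - c) / r, so that the bound for the
        standard Gaussian applies.\<close>
      define R where "R = pcompose (monom 1 k * P n) [:c, r:]"
      obtain B where B: "\<And>z. \<bar>poly R z\<bar> * exp (- z\<^sup>2) \<le> B" using poly_gaussian_bounded by blast
      have "norm (y ^ k *\<^sub>R complex_of_real (poly (P n) y * exp (- poly q y))) \<le> exp 1 * B" for y
      proof -
        define z where "z = (y - c) / r"
        have y: "c + r * z = y" using r by (simp add: z_def)
        have R: "poly R z = y ^ k * poly (P n) y"
          by (simp add: R_def poly_pcompose poly_monom mult.commute[of z] y)
        have "norm (y ^ k *\<^sub>R complex_of_real (poly (P n) y * exp (- poly q y))) = \<bar>poly R z\<bar> * exp (- poly q y)"
          unfolding norm_scaleR norm_of_real R by (simp add: abs_mult)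
        also have "\<dots> \<le> \<bar>poly R z\<bar> * exp (1 - z\<^sup>2)"
          using q[of y] by (intro mult_left_mono) (auto simp: z_def)
        also have "\<dots> = exp 1 * (\<bar>poly R z\<bar> * exp (- z\<^sup>2))" by (simp add: exp_diff exp_minus field_simps)
        also have "\<dots> \<le> exp 1 * B" using B by (intro mult_left_mono) auto
        finally show ?thesis .
      qed
      then show ?thesis by (auto simp: bounded_iff)
    qed
  qed (simp add: P)
qed

lemma Lp_dominated_convergence:
  fixes f :: "'a \<Rightarrow> complex" and u :: "nat \<Rightarrow> 'a \<Rightarrow> complex"
  assumes p: "0 < p" and [measurable]: "f \<in> borel_measurable M" "\<And>n. u n \<in> borel_measurable M"
    and w: "w \<in> Lp_space M p"
    and uw: "\<And>n x. x \<in> space M \<Longrightarrow> cmod (u n x) \<le> cmod (w x)"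
    and fw: "\<And>x. x \<in> space M \<Longrightarrow> cmod (f x) \<le> cmod (w x)"
    and lim: "AE x in M. (\<lambda>n. u n x) \<longlonglongrightarrow> f x"
  shows "(\<lambda>n. Lp_norm M p (\<lambda>x. u n x - f x)) \<longlonglongrightarrow> 0"
proof -
  have "(\<lambda>n. LINT x|M. cmod (u n x - f x) powr p) \<longlonglongrightarrow> (LINT x|M. 0)"
  proof (rule integral_dominated_convergence[where w="\<lambda>x. 2 powr p * cmod (w x) powr p"])
    show "integrable M (\<lambda>x. 2 powr p * cmod (w x) powr p)"
      using Lp_spaceD(2)[OF w] by (rule integrable_mult_right)
    show "AE x in M. norm (cmod (u n x - f x) powr p) \<le> 2 powr p * cmod (w x) powr p" for n
    proof (rule AE_I2)
      fix x assume "x \<in> space M"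
      then have "cmod (u n x - f x) \<le> 2 * cmod (w x)"
        using norm_triangle_ineq4[of "u n x" "f x"] uw[of x n] fw[of x] by linarith
      then have "cmod (u n x - f x) powr p \<le> (2 * cmod (w x)) powr p"
        using p by (intro powr_mono2) auto
      then show "norm (cmod (u n x - f x) powr p) \<le> 2 powr p * cmod (w x) powr p"
        by (simp add: powr_mult)
    qed
    show "AE x in M. (\<lambda>n. cmod (u n x - f x) powr p) \<longlonglongrightarrow> 0"
      using lim
    proof eventually_elim
      case (elim x)
      have "(\<lambda>n. cmod (u n x - f x)) \<longlonglongrightarrow> 0"
        by (rule tendsto_norm_zero[OF LIM_zero[OF elim]])
      then have "(\<lambda>n. cmod (u n x - f x) powr p) \<longlonglongrightarrow> 0 powr p"
        using p by (intro tendsto_powr') auto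
      then show ?case using p by simp
    qed
  qed measurable
  then have "(\<lambda>n. (LINT x|M. cmod (u n x - f x) powr p) powr (1 / p)) \<longlonglongrightarrow> 0 powr (1 / p)"
    using p by (intro tendsto_powr' tendsto_const) auto
  then show ?thesis using p by (simp add: Lp_norm_def)
qed

lemma Lp_space_dominated:
  assumes p: "0 < p" and f: "f \<in> borel_measurable M" and w: "w \<in> Lp_space M p"
    and fw: "\<And>x. x \<in> space M \<Longrightarrow> cmod (f x) \<le> cmod (w x)"
  shows "f \<in> Lp_space M p"
proof -
  have "integrable M (\<lambda>x. cmod (f x) powr p)"
    using Lp_spaceD(2)[OF w]
  proof (rule Bochner_Integration.integrable_bound)
    show "AE x in M. norm (cmod (f x) powr p) \<le> norm (cmod (w x) powr p)"
      using p fw by (intro AE_I2) (auto intro!: powr_mono2)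
  qed (use f in measurable)
  then show ?thesis using f by (simp add: Lp_space_def)
qed

lemma Lp_space_cmult: "f \<in> Lp_space M p \<Longrightarrow> (\<lambda>x. c * f x) \<in> Lp_space M p"
  by (auto simp: Lp_space_def norm_mult powr_mult)

lemma Lp_norm_cmult:
  assumes "0 < p" shows "Lp_norm M p (\<lambda>x. c * f x) = cmod c * Lp_norm M p f"
  using assms by (simp add: Lp_norm_def norm_mult powr_mult powr_powr integral_nonneg_AE)

section \<open>The L2 closure of the Schwartz functions\<close>

definition schwartz_approx :: "(real \<Rightarrow> complex) \<Rightarrow> bool" where
  "schwartz_approx f \<longleftrightarrow> f \<in> Lp_space hyp_measure 2 \<and>
     (\<forall>e>0. \<exists>g. schwartz g \<and> Lp_norm hyp_measure 2 (\<lambda>y. g y - f y) < e)"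

lemma schwartz_approx_schwartz: "schwartz f \<Longrightarrow> schwartz_approx f"
  unfolding schwartz_approx_def
  by (auto simp: schwartz_L2 intro!: exI[of _ f]) (simp add: Lp_norm_def)

lemma schwartz_approx_limit:
  assumes f: "f \<in> Lp_space hyp_measure 2" and u: "\<And>n. schwartz_approx (u n)"
    and lim: "(\<lambda>n. Lp_norm hyp_measure 2 (\<lambda>y. u n y - f y)) \<longlonglongrightarrow> 0"
  shows "schwartz_approx f"
  unfolding schwartz_approx_def
proof (intro conjI f allI impI)
  fix e :: real assume e: "0 < e"
  obtain n where n: "Lp_norm hyp_measure 2 (\<lambda>y. u n y - f y) < e / 2"
    using order_tendstoD(2)[OF lim, of "e / 2"] e by (auto simp: eventually_sequentially)
  obtain g where g: "schwartz g" "Lp_norm hyp_measure 2 (\<lambda>y. g y - u n y) < e / 2"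
    using u[of n] e unfolding schwartz_approx_def by (metis half_gt_zero)
  have un: "u n \<in> Lp_space hyp_measure 2" using u[of n] by (simp add: schwartz_approx_def)
  have "Lp_norm hyp_measure 2 (\<lambda>y. (g y - u n y) + (u n y - f y)) < e"
    using Lp_norm_triangle[OF _ Lp_space_diff[OF _ schwartz_L2[OF g(1)] un] Lp_space_diff[OF _ un f]] n g(2)
    by fastforce
  then show "\<exists>g. schwartz g \<and> Lp_norm hyp_measure 2 (\<lambda>y. g y - f y) < e"
    using g(1) by auto
qed

lemma schwartz_approx_add:
  assumes f: "schwartz_approx f" and g: "schwartz_approx g"
  shows "schwartz_approx (\<lambda>y. f y + g y)"
  unfolding schwartz_approx_def
proof (intro conjI allI impI)
  have fL: "f \<in> Lp_space hyp_measure 2" and gL: "g \<in> Lp_space hyp_measure 2"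
    using f g by (auto simp: schwartz_approx_def)
  show "(\<lambda>y. f y + g y) \<in> Lp_space hyp_measure 2" by (rule Lp_space_add[OF _ fL gL]) simp
  fix e :: real assume e: "0 < e"
  obtain a where a: "schwartz a" "Lp_norm hyp_measure 2 (\<lambda>y. a y - f y) < e / 2"
    using f e unfolding schwartz_approx_def by (metis half_gt_zero)
  obtain b where b: "schwartz b" "Lp_norm hyp_measure 2 (\<lambda>y. b y - g y) < e / 2"
    using g e unfolding schwartz_approx_def by (metis half_gt_zero)
  have "Lp_norm hyp_measure 2 (\<lambda>y. (a y - f y) + (b y - g y)) < e"
    using Lp_norm_triangle[OF _ Lp_space_diff[OF _ schwartz_L2[OF a(1)] fL] Lp_space_diff[OF _ schwartz_L2[OF b(1)] gL]] a(2) b(2)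
    by fastforce
  moreover have "(\<lambda>y. (a y - f y) + (b y - g y)) = (\<lambda>y. (a y + b y) - (f y + g y))" by auto
  ultimately show "\<exists>h. schwartz h \<and> Lp_norm hyp_measure 2 (\<lambda>y. h y - (f y + g y)) < e"
    using schwartz_add[OF a(1) b(1)] by (intro exI[of _ "\<lambda>y. a y + b y"]) simp
qed

lemma schwartz_approx_cmult:
  assumes f: "schwartz_approx f" shows "schwartz_approx (\<lambda>y. c * f y)"
  unfolding schwartz_approx_def
proof (intro conjI allI impI)
  show "(\<lambda>y. c * f y) \<in> Lp_space hyp_measure 2" using f by (simp add: schwartz_approx_def Lp_space_cmult)
  fix e :: real assume e: "0 < e"
  have "0 < e / (cmod c + 1)" using e by (simp add: add_nonneg_pos)
  then obtain a where a: "schwartz a" "Lp_norm hyp_measure 2 (\<lambda>y. a y - f y) < e / (cmod c + 1)"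
    using f unfolding schwartz_approx_def by blast
  have "Lp_norm hyp_measure 2 (\<lambda>y. c * a y - c * f y) = cmod c * Lp_norm hyp_measure 2 (\<lambda>y. a y - f y)"
    unfolding right_diff_distrib[symmetric] by (rule Lp_norm_cmult) simp
  also have "\<dots> \<le> cmod c * (e / (cmod c + 1))" using a(2) by (intro mult_left_mono) auto
  also have "\<dots> < e"
  proof -
    have d: "0 < cmod c + 1" by (simp add: add_nonneg_pos)
    show ?thesis using e by (subst times_divide_eq_right, subst pos_divide_less_eq[OF d]) (simp add: algebra_simps)
  qed
  finally show "\<exists>h. schwartz h \<and> Lp_norm hyp_measure 2 (\<lambda>y. h y - c * f y) < e"
    using schwartz_cmult[OF a(1)] by blast
qed

lemma schwartz_approx_diff:
  assumes "schwartz_approx f" "schwartz_approx g" shows "schwartz_approx (\<lambda>y. f y - g y)"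
  using schwartz_approx_add[OF assms(1) schwartz_approx_cmult[OF assms(2), of "-1"]] by simp

lemma schwartz_approx_sum:
  assumes "finite A" "\<And>a. a \<in> A \<Longrightarrow> schwartz_approx (f a)"
  shows "schwartz_approx (\<lambda>y. \<Sum>a\<in>A. f a y)"
  using assms by (induction A) (auto intro: schwartz_approx_add schwartz_approx_schwartz schwartz_zero)

text \<open>In the variable z = (y - c) / r the interval is |z| < 1, and exp (-(z^2)^(n+1)) tends to
  its indicator except at the endpoints. Polynomial exponents make these functions Schwartz without
  any smooth cutoff.\<close>

lemma schwartz_approx_interval:
  "schwartz_approx (indicator {a<..<b})"
proof (cases "a < b")
  case False
  then have "indicator {a<..<b} = (\<lambda>y. 0 :: complex)" by (auto simp: fun_eq_iff indicator_def)
  then show ?thesis by (simp only: schwartz_approx_schwartz schwartz_zero)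
next
  case True
  define c r where "c = (a + b) / 2" and "r = (b - a) / 2"
  have r: "0 < r" using True by (simp add: r_def)
  have ab: "y \<in> {a<..<b} \<longleftrightarrow> \<bar>(y - c) / r\<bar> < 1" for y
    using True by (auto simp: c_def r_def abs_less_iff field_simps)
  define Q :: "real poly" where "Q = [:- c / r, 1 / r:]"
  have Q: "poly Q y = (y - c) / r" for y by (simp add: Q_def diff_divide_distrib)
  \<comment> \<open>The exponent \<open>Suc n\<close> leaves out the power zero, which would give a
    constant without decay.\<close>
  define u where "u n y = complex_of_real (exp (- ((((y - c) / r)\<^sup>2) ^ Suc n)))" for n y
  \<comment> \<open>A common Schwartz majorant: z^2 - 1 never exceeds (z^2)^(n+1), so
    \<open>w\<close> dominates every \<open>u n\<close>, and on the interval it is at least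
    1.\<close>
  define w where "w y = complex_of_real (exp (1 - ((y - c) / r)\<^sup>2))" for y
  have low: "((y - c) / r)\<^sup>2 - 1 \<le> (((y - c) / r)\<^sup>2) ^ Suc n" for y n
  proof (cases "1 \<le> ((y - c) / r)\<^sup>2")
    case True
    then have "((y - c) / r)\<^sup>2 * 1 \<le> ((y - c) / r)\<^sup>2 * (((y - c) / r)\<^sup>2) ^ n"
      by (intro mult_left_mono one_le_power[OF True]) auto
    then show ?thesis by simp
  next
    case False
    then have "((y - c) / r)\<^sup>2 - 1 \<le> 0" by simp
    also have "0 \<le> (((y - c) / r)\<^sup>2) ^ Suc n" by (rule zero_le_power[OF zero_le_power2])
    finally show ?thesis .
  qed
  have us: "schwartz (u n)" for n
    using schwartz_poly_exp[OF r, where c=c and q="(Q\<^sup>2) ^ Suc n" and p=1] low[of _ n] by (simp add: u_def[abs_def] Q poly_power)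
  have ws: "schwartz w"
    using schwartz_poly_exp[OF r, where c=c and q="Q\<^sup>2 - 1" and p=1] by (simp add: w_def[abs_def] Q poly_power)
  have fm: "indicator {a<..<b} \<in> borel_measurable hyp_measure" by measurable
  have fw: "cmod (indicator {a<..<b} y) \<le> cmod (w y)" for y
  proof (cases "y \<in> {a<..<b}")
    case True
    then have "((y - c) / r)\<^sup>2 \<le> 1" using ab[of y] by (simp only: abs_square_le_1)
    then show ?thesis using True by (simp add: w_def)
  qed simp
  have uw: "cmod (u n y) \<le> cmod (w y)" for n y
    using low[of y n] by (simp add: u_def w_def)
  \<comment> \<open>At both endpoints the approximants are constantly exp (-1), so these two points
    are removed as a null set.\<close>
  have lim: "AE y in hyp_measure. (\<lambda>n. u n y) \<longlonglongrightarrow> indicator {a<..<b} y"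
    using AE_hyp_neq[of a] AE_hyp_neq[of b]
  proof eventually_elim
    case (elim y)
    define z where "z = ((y - c) / r)\<^sup>2"
    show ?case
    proof (cases "y \<in> {a<..<b}")
      case True
      then have "z < 1" using ab[of y] by (simp add: z_def abs_square_less_1)
      then have "(\<lambda>n. z ^ Suc n) \<longlonglongrightarrow> 0"
        by (intro LIMSEQ_Suc LIMSEQ_power_zero) (simp add: z_def)
      then have "(\<lambda>n. complex_of_real (exp (- (z ^ Suc n)))) \<longlonglongrightarrow> complex_of_real (exp (- 0))"
        by (intro tendsto_of_real tendsto_exp tendsto_minus)
      then show ?thesis using True by (simp add: u_def z_def)
    next
      case False
      have "\<bar>(y - c) / r\<bar> \<noteq> 1"
      proof
        assume "\<bar>(y - c) / r\<bar> = 1"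
        then have "(y - c) / r = 1 \<or> (y - c) / r = - 1" by linarith
        then have "y = b \<or> y = a" using r by (auto simp: c_def r_def field_simps)
        then show False using elim by simp
      qed
      then have "1 < \<bar>(y - c) / r\<bar>" using False ab[of y] by linarith
      from one_less_power[OF this, of 2] have "1 < z" by (simp only: z_def power2_abs)
      then have "filterlim (\<lambda>n. z ^ n) at_top sequentially"
        by (intro filterlim_at_infinity_imp_filterlim_at_top filterlim_realpow_sequentially_gt1) auto
      then have "filterlim (\<lambda>n. z ^ Suc n) at_top sequentially" by (subst filterlim_sequentially_Suc)
      then have "filterlim (\<lambda>n. - (z ^ Suc n)) at_bot sequentially" by (simp add: filterlim_uminus_at_bot)
      then have "(\<lambda>n. exp (- (z ^ Suc n))) \<longlonglongrightarrow> 0" by (rule filterlim_compose[OF exp_at_bot])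
      then have "(\<lambda>n. complex_of_real (exp (- (z ^ Suc n)))) \<longlonglongrightarrow> complex_of_real 0" by (rule tendsto_of_real)
      then show ?thesis using False by (simp add: u_def z_def)
    qed
  qed
  show ?thesis
  proof (rule schwartz_approx_limit)
    show "indicator {a<..<b} \<in> Lp_space hyp_measure 2"
      by (rule Lp_space_dominated[OF _ fm schwartz_L2[OF ws] fw]) simp
    show "schwartz_approx (u n)" for n by (rule schwartz_approx_schwartz[OF us])
    have um: "u n \<in> borel_measurable hyp_measure" for n
      using schwartz_measurable[OF us] by (simp cong: measurable_cong_sets)
    show "(\<lambda>n. Lp_norm hyp_measure 2 (\<lambda>y. u n y - indicator {a<..<b} y)) \<longlonglongrightarrow> 0"
      by (rule Lp_dominated_convergence[OF _ fm um schwartz_L2[OF ws] uw fw lim]) simp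
  qed
qed

text \<open>A Dynkin argument over the intersection-stable family of open intervals. The bounded
  window is what makes the complement step work: the invariant measure of the line is infinite, so
  complements alone would leave L2.\<close>

lemma schwartz_approx_borel:
  assumes "A \<in> sets borel" shows "schwartz_approx (indicator (A \<inter> {-N<..<N}))"
proof -
  let ?J = "{-N<..<N::real}"
  let ?G = "range (\<lambda>(a, b). {a<..<b::real})"
  have JL: "indicator ?J \<in> Lp_space hyp_measure 2"
    using schwartz_approx_interval by (simp add: schwartz_approx_def)
  have G: "borel = sigma UNIV ?G"
    using borel_eq_box[where 'a=real] by (simp add: box_real)
  have "A \<in> sigma_sets UNIV ?G" using assms unfolding G by (simp add: sets_measure_of)
  have setsG: "sigma_sets UNIV ?G = sets borel" unfolding G by (simp add: sets_measure_of)
  have "Int_stable ?G"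
  proof (rule Int_stableI)
    fix S T assume "S \<in> ?G" "T \<in> ?G"
    then obtain a b c d where "S = {a<..<b}" "T = {c<..<d}" by auto
    then have "S \<inter> T = {max a c<..<min b d}" by auto
    then show "S \<inter> T \<in> ?G" by (auto intro!: image_eqI[of _ _ "(max a c, min b d)"])
  qed
  moreover have "?G \<subseteq> Pow UNIV" by simp
  ultimately show ?thesis using \<open>A \<in> sigma_sets UNIV ?G\<close>
  proof (induction rule: sigma_sets_induct_disjoint)
    case (basic A)
    then obtain a b where "A = {a<..<b}" by auto
    then have "A \<inter> ?J = {max a (-N)<..<min b N}" by auto
    then show ?case using schwartz_approx_interval by simp
  next
    case empty
    have "indicator ({} \<inter> ?J) = (\<lambda>y. 0 :: complex)" by (auto simp: fun_eq_iff)
    then show ?case by (simp only: schwartz_approx_schwartz schwartz_zero)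
  next
    case (compl A)
    have "indicator ((UNIV - A) \<inter> ?J) = (\<lambda>y. indicator ?J y - indicator (A \<inter> ?J) y :: complex)"
      by (auto simp: indicator_def fun_eq_iff)
    then show ?case using schwartz_approx_diff[OF schwartz_approx_interval compl(2)] by simp
  next
    case (union A)
    have Am [measurable]: "A i \<in> sets borel" for i using union(2) setsG by auto
    define u where "u n y = (\<Sum>i<n. indicator (A i \<inter> ?J) y :: complex)" for n y
    have u: "u n y = indicator ((\<Union>i<n. A i) \<inter> ?J) y" for n y
    proof -
      have "disjoint_family_on (\<lambda>i. A i \<inter> ?J) {..<n}"
        using union(1) by (auto simp: disjoint_family_on_def)
      from indicator_UN_disjoint[OF _ this, of y]
      have "indicator (\<Union>i<n. A i \<inter> ?J) y = u n y" by (simp add: u_def)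
      then show ?thesis by (simp add: Int_UN_distrib2 flip: UN_extend_simps)
    qed
    have lim: "(\<lambda>n. u n y) \<longlonglongrightarrow> indicator ((\<Union>i. A i) \<inter> ?J) y" for y
    proof (cases "y \<in> (\<Union>i. A i) \<inter> ?J")
      case True
      then obtain i where i: "y \<in> A i" by auto
      have "\<forall>\<^sub>F n in sequentially. u n y = indicator ((\<Union>i. A i) \<inter> ?J) y"
        unfolding eventually_sequentially
        by (rule exI[of _ "Suc i"]) (use True i in \<open>auto simp: u indicator_def\<close>)
      then show ?thesis by (rule tendsto_eventually)
    next
      case False
      then have "u n y = 0" for n by (auto simp: u indicator_def)
      then show ?thesis using False by simp
    qed
    have fm: "indicator ((\<Union>i. A i) \<inter> ?J) \<in> borel_measurable hyp_measure" by measurable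
    have fw: "cmod (indicator ((\<Union>i. A i) \<inter> ?J) y) \<le> cmod (indicator ?J y)" for y
      by (auto simp: indicator_def)
    show ?case
    proof (rule schwartz_approx_limit)
      show "indicator ((\<Union>i. A i) \<inter> ?J) \<in> Lp_space hyp_measure 2"
        by (rule Lp_space_dominated[OF _ fm JL fw]) simp
      show "schwartz_approx (u n)" for n
        unfolding u_def[abs_def] by (intro schwartz_approx_sum union(3)) auto
      show "(\<lambda>n. Lp_norm hyp_measure 2 (\<lambda>y. u n y - indicator ((\<Union>i. A i) \<inter> ?J) y)) \<longlonglongrightarrow> 0"
      proof (rule Lp_dominated_convergence[OF _ fm _ JL _ fw])
        show "u n \<in> borel_measurable hyp_measure" for n unfolding u_def by measurable
        show "cmod (u n y) \<le> cmod (indicator ?J y)" for n y unfolding u by (auto simp: indicator_def)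
      qed (use lim in auto)
    qed
  qed
qed

text \<open>Truncation to bounded windows followed by approximation with simple functions reduces
  everything to indicators of bounded Borel sets.\<close>

lemma schwartz_dense:
  assumes f: "f \<in> Lp_space hyp_measure 2" shows "schwartz_approx f"
proof -
  have [measurable]: "f \<in> borel_measurable borel"
    using Lp_spaceD(1)[OF f] by (simp cong: measurable_cong_sets)
  define J where "J n = {- real n<..<real n}" for n
  have [measurable]: "J n \<in> sets borel" for n by (simp add: J_def)
  define fJ where "fJ n y = indicator (J n) y * f y" for n y
  have fJm: "fJ n \<in> borel_measurable hyp_measure" for n unfolding fJ_def by measurable
  have fJw: "cmod (fJ n y) \<le> cmod (f y)" for n y by (simp add: fJ_def indicator_def)
  have fJL: "fJ n \<in> Lp_space hyp_measure 2" for n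
    by (rule Lp_space_dominated[OF _ fJm f fJw]) simp
  have aJ: "schwartz_approx (fJ n)" for n
  proof -
    obtain s where s: "\<And>i. simple_function hyp_measure (s i)" "\<And>x. (\<lambda>i. s i x) \<longlonglongrightarrow> fJ n x"
      "\<And>i x. dist (s i x) 0 \<le> 2 * dist (fJ n x) 0"
      using borel_measurable_implies_sequence_metric[OF fJm, of n 0] by auto
    have sm: "s i \<in> borel_measurable hyp_measure" for i using s(1) by (rule borel_measurable_simple_function)
    \<comment> \<open>The bound by \<open>2 * dist (fJ n x) 0\<close> makes the simple functions
      vanish outside the window, so their level sets may be intersected with it.\<close>
    have s0: "s i y = 0" if "y \<notin> J n" for i y using s(3)[of i y] that by (simp add: fJ_def)
    have "schwartz_approx (s i)" for i
    proof -
      have fin: "finite (range (s i))" using simple_functionD(1)[OF s(1)] by simp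
      have eq: "s i = (\<lambda>y. \<Sum>c\<in>range (s i). c * indicator (s i -` {c} \<inter> J n) y)"
      proof
        fix y
        have "(\<Sum>c\<in>range (s i). c * indicator (s i -` {c} \<inter> J n) y) = (\<Sum>c\<in>range (s i). if c = s i y then s i y else 0)"
          using s0[of y i] by (intro sum.cong) (auto simp: indicator_def)
        also have "\<dots> = s i y" using fin by simp
        finally show "s i y = (\<Sum>c\<in>range (s i). c * indicator (s i -` {c} \<inter> J n) y)" ..
      qed
      show ?thesis
      proof (subst eq, intro schwartz_approx_sum fin schwartz_approx_cmult)
        fix c
        have "s i -` {c} \<in> sets borel" using simple_functionD(2)[OF s(1), of i "{c}"] by simp
        then show "schwartz_approx (indicator (s i -` {c} \<inter> J n))"
          unfolding J_def by (rule schwartz_approx_borel)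
      qed
    qed
    then show ?thesis
    proof (rule schwartz_approx_limit[OF fJL])
      have w: "(\<lambda>y. 2 * fJ n y) \<in> Lp_space hyp_measure 2" by (rule Lp_space_cmult[OF fJL])
      show "(\<lambda>i. Lp_norm hyp_measure 2 (\<lambda>y. s i y - fJ n y)) \<longlonglongrightarrow> 0"
        by (rule Lp_dominated_convergence[OF _ fJm sm w]) (use s in \<open>auto simp: norm_mult\<close>)
    qed
  qed
  show ?thesis
  proof (rule schwartz_approx_limit[OF f aJ])
    have "(\<lambda>n. fJ n y) \<longlonglongrightarrow> f y" for y
    proof (rule tendsto_eventually)
      show "\<forall>\<^sub>F n in sequentially. fJ n y = f y"
        using eventually_gt_at_top[of "nat \<lceil>\<bar>y\<bar>\<rceil>"]
      proof eventually_elim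
        case (elim n)
        then have "\<bar>y\<bar> < real n" by linarith
        then have "y \<in> J n" by (auto simp: J_def)
        then show ?case by (simp add: fJ_def)
      qed
    qed
    then show "(\<lambda>n. Lp_norm hyp_measure 2 (\<lambda>y. fJ n y - f y)) \<longlonglongrightarrow> 0"
      by (intro Lp_dominated_convergence[OF _ Lp_spaceD(1)[OF f] fJm f fJw]) auto
  qed
qed

section \<open>Completeness and existence of extensions\<close>

text \<open>A geometric rate is enough, since the approximating Schwartz functions can be chosen as
  close as desired. It yields almost everywhere convergence of the whole sequence, and Fatou passes
  the rate on to the limit.\<close>

lemma Lp_complete:
  fixes h :: "nat \<Rightarrow> 'a \<Rightarrow> complex"
  assumes p: "1 \<le> p" and h: "\<And>n. h n \<in> Lp_space M p"
    and K: "\<And>m n. n \<le> m \<Longrightarrow> Lp_norm M p (\<lambda>x. h m x - h n x) \<le> K * (1/4) ^ n"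
  shows "\<exists>F. Lp_tendsto M p h F"
proof -
  have p0: "0 < p" using p by simp
  have K0: "0 \<le> K" using order_trans[OF Lp_norm_nonneg K[of 0 0]] by simp
  have [measurable]: "h n \<in> borel_measurable M" for n using Lp_spaceD(1)[OF h] .
  have hd: "(\<lambda>x. h m x - h n x) \<in> Lp_space M p" for m n by (rule Lp_space_diff[OF p h h])
  \<comment> \<open>The weight 2^n is set against the rate 4^(-n): the integrals of
    \<open>T n\<close> still have a finite sum, while finiteness of the pointwise sum forces the
    increments to decay like 2^(-n).\<close>
  define T where "T n x = ennreal ((2 ^ n * cmod (h (Suc n) x - h n x)) powr p)" for n x
  have [measurable]: "T n \<in> borel_measurable M" for n unfolding T_def by measurable
  define q where "q = (1/2::real) powr p"
  have q: "0 < q" "q < 1" using p0 powr_less_mono2[of p "1/2" 1] by (auto simp: q_def)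
  have IT: "(\<integral>\<^sup>+x. T n x \<partial>M) \<le> ennreal (K powr p * q ^ n)" for n
  proof -
    have "(\<integral>\<^sup>+x. T n x \<partial>M) = ennreal ((2 ^ n) powr p) * (\<integral>\<^sup>+x. ennreal (cmod (h (Suc n) x - h n x) powr p) \<partial>M)"
      by (subst nn_integral_cmult[symmetric], measurable, intro nn_integral_cong)
         (simp add: T_def powr_mult ennreal_mult)
    also have "\<dots> = ennreal ((2 ^ n) powr p * Lp_norm M p (\<lambda>x. h (Suc n) x - h n x) powr p)"
      by (simp add: nn_integral_Lp[OF p0 hd] ennreal_mult)
    also have "\<dots> \<le> ennreal ((2 ^ n) powr p * (K * (1/4) ^ n) powr p)"
      using p0 by (intro ennreal_leI mult_left_mono powr_mono2 K) auto
    also have "(2 ^ n) powr p * (K * (1/4) ^ n) powr p = (2 ^ n * (K * (1/4) ^ n)) powr p"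
      using K0 by (simp add: powr_mult)
    also have "2 ^ n * (K * (1/4) ^ n) = K * (1/2) ^ n"
    proof -
      have "(2::real) ^ n * (1/4) ^ n = (1/2) ^ n" by (simp flip: power_mult_distrib)
      then show ?thesis by (metis mult.left_commute)
    qed
    also have "(K * (1/2) ^ n) powr p = K powr p * q ^ n"
      using K0 by (simp add: powr_mult q_def powr_power powr_realpow[symmetric] powr_powr mult.commute)
    finally show ?thesis .
  qed
  have "(\<integral>\<^sup>+x. (\<Sum>n. T n x) \<partial>M) = (\<Sum>n. \<integral>\<^sup>+x. T n x \<partial>M)"
    by (rule nn_integral_suminf) measurable
  also have "\<dots> \<le> (\<Sum>n. ennreal (K powr p * q ^ n))"
    by (intro suminf_le IT) auto
  also have "\<dots> = ennreal (\<Sum>n. K powr p * q ^ n)"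
    using q by (intro suminf_ennreal2) (auto intro!: summable_mult summable_geometric)
  also have "\<dots> < \<infinity>" by simp
  finally have "AE x in M. (\<Sum>n. T n x) \<noteq> \<infinity>"
    by (intro nn_integral_noteq_infinite) auto
  then have conv: "AE x in M. convergent (\<lambda>n. h n x)"
  proof eventually_elim
    case (elim x)
    then obtain S where S: "0 \<le> S" "(\<Sum>n. T n x) = ennreal S" by (cases "\<Sum>n. T n x") auto
    have bd: "cmod (h (Suc n) x - h n x) \<le> S powr (1 / p) * (1/2) ^ n" for n
    proof -
      have "T n x \<le> (\<Sum>n. T n x)" using sum_le_suminf[of "\<lambda>n. T n x" "{n}"] by simp
      then have "(2 ^ n * cmod (h (Suc n) x - h n x)) powr p \<le> S" unfolding S(2) unfolding T_def using S(1) by simp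
      then have "((2 ^ n * cmod (h (Suc n) x - h n x)) powr p) powr (1 / p) \<le> S powr (1 / p)"
        using p0 by (intro powr_mono2) auto
      then have "2 ^ n * cmod (h (Suc n) x - h n x) \<le> S powr (1 / p)" using p0 by (simp add: powr_powr)
      then show ?thesis by (simp add: field_simps power_one_over)
    qed
    have "summable (\<lambda>n. h (Suc n) x - h n x)"
      by (rule summable_comparison_test[where g="\<lambda>n. S powr (1 / p) * (1/2) ^ n"])
         (use bd in \<open>auto intro!: summable_mult summable_geometric\<close>)
    then have "convergent (\<lambda>n. h 0 x + (\<Sum>i<n. h (Suc i) x - h i x))"
      by (intro convergent_add convergent_const) (simp add: summable_iff_convergent)
    then show ?case by (simp add: sum_lessThan_telescope[of "\<lambda>n. h n x"])
  qed
  define F where "F x = lim (\<lambda>n. h n x)" for x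
  have Fm [measurable]: "F \<in> borel_measurable M" unfolding F_def by measurable
  have bound: "(\<integral>\<^sup>+x. ennreal (cmod (F x - h n x) powr p) \<partial>M) \<le> ennreal ((K * (1/4) ^ n) powr p)" for n
  proof -
    have "(\<integral>\<^sup>+x. ennreal (cmod (F x - h n x) powr p) \<partial>M)
       = (\<integral>\<^sup>+x. liminf (\<lambda>m. ennreal (cmod (h m x - h n x) powr p)) \<partial>M)"
      using conv
    proof (intro nn_integral_cong_AE, eventually_elim)
      case (elim x)
      then have "(\<lambda>m. h m x) \<longlonglongrightarrow> F x" by (simp add: F_def convergent_LIMSEQ_iff)
      then have "(\<lambda>m. ennreal (cmod (h m x - h n x) powr p)) \<longlonglongrightarrow> ennreal (cmod (F x - h n x) powr p)"
        using p0 by (intro tendsto_ennrealI tendsto_powr' tendsto_norm tendsto_diff tendsto_const) auto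
      then show ?case by (rule lim_imp_Liminf[OF trivial_limit_sequentially, symmetric])
    qed
    also have "\<dots> \<le> liminf (\<lambda>m. \<integral>\<^sup>+x. ennreal (cmod (h m x - h n x) powr p) \<partial>M)"
      by (intro nn_integral_liminf) measurable
    also have "\<dots> \<le> liminf (\<lambda>m::nat. ennreal ((K * (1/4) ^ n) powr p))"
    proof (rule Liminf_mono, use eventually_ge_at_top[of n] in eventually_elim)
      fix m assume "n \<le> m"
      then show "(\<integral>\<^sup>+x. ennreal (cmod (h m x - h n x) powr p) \<partial>M) \<le> ennreal ((K * (1/4) ^ n) powr p)"
        unfolding nn_integral_Lp[OF p0 hd] using p0 K by (intro ennreal_leI powr_mono2) auto
    qed
    also have "\<dots> = ennreal ((K * (1/4) ^ n) powr p)" by (simp add: Liminf_const)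
    finally show ?thesis .
  qed
  have Fd: "(\<lambda>x. F x - h n x) \<in> Lp_space M p" for n
    by (rule Lp_spaceI[OF _ order.strict_trans1[OF bound]]) auto
  have FL: "F \<in> Lp_space M p" using Lp_space_add[OF p Fd[of 0] h[of 0]] by simp
  have nb: "Lp_norm M p (\<lambda>x. h n x - F x) \<le> K * (1/4) ^ n" for n
  proof -
    have "ennreal (Lp_norm M p (\<lambda>x. F x - h n x) powr p) \<le> ennreal ((K * (1/4) ^ n) powr p)"
      using bound[of n] unfolding nn_integral_Lp[OF p0 Fd] .
    then have "Lp_norm M p (\<lambda>x. F x - h n x) powr p \<le> (K * (1/4) ^ n) powr p" by simp
    then have "(Lp_norm M p (\<lambda>x. F x - h n x) powr p) powr (1/p) \<le> ((K * (1/4) ^ n) powr p) powr (1/p)"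
      by (rule powr_mono2[rotated 2]) (use p0 in auto)
    then show ?thesis using p0 K0 by (simp add: powr_powr Lp_norm_minus_commute[of _ _ F])
  qed
  have "(\<lambda>n. Lp_norm M p (\<lambda>x. h n x - F x)) \<longlonglongrightarrow> 0"
  proof (rule Lim_null_comparison)
    show "\<forall>\<^sub>F n in sequentially. norm (Lp_norm M p (\<lambda>x. h n x - F x)) \<le> K * (1/4) ^ n"
      using nb by (intro always_eventually) auto
    have "(\<lambda>n. K * (1/4::real) ^ n) \<longlonglongrightarrow> K * 0" by (intro tendsto_mult tendsto_const LIMSEQ_power_zero) simp
    then show "(\<lambda>n. K * (1/4::real) ^ n) \<longlonglongrightarrow> 0" by simp
  qed
  then show ?thesis using FL h unfolding Lp_tendsto_def by blast
qed

text \<open>Only this makes the choice in \<open>extension_op\<close> meaningful: without a witness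
  the selected function would satisfy nothing.\<close>

lemma is_extension_exists:
  assumes f: "f \<in> Lp_space hyp_measure 2" shows "\<exists>F. is_extension f F"
proof -
  \<comment> \<open>The factor 1/2 leaves room for the triangle inequality: two such errors add up
    to at most the rate used in \<open>Lp_complete\<close>.\<close>
  have "\<exists>g. schwartz g \<and> Lp_norm hyp_measure 2 (\<lambda>y. g y - f y) < (1/4) ^ n / 2" for n :: nat
  proof -
    have "0 < (1/4::real) ^ n / 2" by simp
    then show ?thesis using schwartz_dense[OF f] unfolding schwartz_approx_def by blast
  qed
  then obtain g where g: "\<And>n::nat. schwartz (g n)" "\<And>n. Lp_norm hyp_measure 2 (\<lambda>y. g n y - f y) < (1/4) ^ n / 2"
    by metis
  have gf: "(\<lambda>y. g n y - f y) \<in> Lp_space hyp_measure 2" "(\<lambda>y. f y - g n y) \<in> Lp_space hyp_measure 2" for n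
    by (intro Lp_space_diff schwartz_L2 g f, simp)+
  have gg: "Lp_norm hyp_measure 2 (\<lambda>y. g m y - g n y) \<le> (1/4) ^ n" if "n \<le> m" for m n
  proof -
    have "Lp_norm hyp_measure 2 (\<lambda>y. (g m y - f y) + (f y - g n y))
      \<le> Lp_norm hyp_measure 2 (\<lambda>y. g m y - f y) + Lp_norm hyp_measure 2 (\<lambda>y. f y - g n y)"
      by (rule Lp_norm_triangle[OF _ gf(1) gf(2)]) simp
    also have "\<dots> \<le> (1/4) ^ m / 2 + (1/4) ^ n / 2"
      using g(2)[of m] g(2)[of n] Lp_norm_minus_commute[of hyp_measure 2 f "g n"] by linarith
    also have "(1/4::real) ^ m \<le> (1/4) ^ n" using that by (intro power_decreasing) auto
    finally show ?thesis by simp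
  qed
  have l2: "Lp_tendsto hyp_measure 2 g f"
    unfolding Lp_tendsto_def
  proof (intro conjI f allI schwartz_L2 g)
    have "(\<lambda>n. (1/4::real) ^ n / 2) \<longlonglongrightarrow> 0 / 2" by (intro tendsto_divide tendsto_const LIMSEQ_power_zero) auto
    then have l: "(\<lambda>n. (1/4::real) ^ n / 2) \<longlonglongrightarrow> 0" by simp
    show "(\<lambda>n. Lp_norm hyp_measure 2 (\<lambda>y. g n y - f y)) \<longlonglongrightarrow> 0"
      by (rule Lim_null_comparison[OF always_eventually l]) (use g(2) in \<open>auto intro: less_imp_le\<close>)
  qed
  have "\<exists>F. Lp_tendsto lborel 6 (\<lambda>n. extension_integral (g n)) F"
  proof (rule Lp_complete)
    show "extension_integral (g n) \<in> Lp_space lborel 6" for n by (rule schwartz_extension_L6[OF g(1)])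
    show "Lp_norm lborel 6 (\<lambda>x. extension_integral (g m) x - extension_integral (g n) x) \<le> root 6 sharp6 * (1/4) ^ n"
      if "n \<le> m" for m n
      using order_trans[OF extension_integral_cauchy[OF g(1) g(1)] mult_left_mono[OF gg[OF that]]] sharp6_pos by simp
  qed simp
  then show ?thesis using g(1) l2 unfolding is_extension_def by blast
qed

section \<open>Concentrating Gaussians and the optimal constant\<close>

text \<open>The integrand of the extension of the Gaussian exp (-z^2 / 2) from the parabola (z, z^2
  / 2), which osculates the hyperboloid at its vertex once the height 1 is subtracted.\<close>

definition chirp :: "real \<Rightarrow> real \<Rightarrow> real \<Rightarrow> complex" where
  "chirp X T z = exp (\<i> * complex_of_real (X * z + T * (z\<^sup>2 / 2))) * complex_of_real (exp (- (1/2 * z\<^sup>2)))"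

lemma chirp_measurable [measurable]:
  assumes [measurable]: "f \<in> borel_measurable M" "g \<in> borel_measurable M" "h \<in> borel_measurable M"
  shows "(\<lambda>x. chirp (f x) (g x) (h x)) \<in> borel_measurable M"
  unfolding chirp_def by measurable

lemma cmod_chirp: "cmod (chirp X T z) = exp (- (1/2 * z\<^sup>2))"
  unfolding chirp_def by (simp only: norm_mult norm_exp_i_times norm_of_real abs_exp_cancel mult_1_left)

lemma chirp_integrable: "integrable lborel (chirp X T)"
  by (rule Bochner_Integration.integrable_bound[OF gaussian_integrable[of "1/2"]])
     (simp_all add: cmod_chirp, measurable)

text \<open>Completing the square at w + p / 2. The parts of the phase quadratic in w cancel against
  the conjugate, leaving a linear phase of frequency \<open>T * p\<close>; the shape
  \<open>p / 2 + 1 * w\<close> prepares the affine substitution of the w-integral.\<close>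

lemma chirp_product:
  "chirp X T (w + p) * cnj (chirp X T w) =
    (exp (\<i> * complex_of_real (X * p)) * complex_of_real (exp (- (1/4 * p\<^sup>2)))) *
    (exp (\<i> * complex_of_real ((T * p) * (p / 2 + 1 * w))) * complex_of_real (exp (- (1 * (p / 2 + 1 * w)\<^sup>2))))"
proof -
  have r: "X * (w + p) + T * ((w + p)\<^sup>2 / 2) - (X * w + T * (w\<^sup>2 / 2)) = X * p + (T * p) * (p / 2 + 1 * w)"
    by (simp add: power2_eq_square field_simps)
  have e: "- (1/2 * (w + p)\<^sup>2) + - (1/2 * w\<^sup>2) = - (1/4 * p\<^sup>2) + - (1 * (p / 2 + 1 * w)\<^sup>2)"
    by (simp add: power2_eq_square field_simps)
  have "chirp X T (w + p) * cnj (chirp X T w)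
     = exp (\<i> * complex_of_real (X * (w + p) + T * ((w + p)\<^sup>2 / 2) - (X * w + T * (w\<^sup>2 / 2))))
       * complex_of_real (exp (- (1/2 * (w + p)\<^sup>2) + - (1/2 * w\<^sup>2)))"
  proof -
    have "exp (\<i> * complex_of_real a) * cnj (exp (\<i> * complex_of_real b)) = exp (\<i> * complex_of_real (a - b))" for a b
      by (simp add: exp_cnj exp_add[symmetric] algebra_simps)
    note this[symmetric]
    then show ?thesis
      by (simp only: chirp_def complex_cnj_mult complex_cnj_complex_of_real exp_add of_real_mult ac_simps)
  qed
  also have "\<dots> = exp (\<i> * complex_of_real (X * p + (T * p) * (p / 2 + 1 * w))) * complex_of_real (exp (- (1/4 * p\<^sup>2) + - (1 * (p / 2 + 1 * w)\<^sup>2)))"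
    unfolding r e ..
  also have "\<dots> = (exp (\<i> * complex_of_real (X * p)) * complex_of_real (exp (- (1/4 * p\<^sup>2)))) *
    (exp (\<i> * complex_of_real ((T * p) * (p / 2 + 1 * w))) * complex_of_real (exp (- (1 * (p / 2 + 1 * w)\<^sup>2))))"
    unfolding exp_add of_real_add distrib_left of_real_mult by (simp only: ac_simps)
  finally show ?thesis .
qed

text \<open>
  Writing the squared modulus as a double integral and shifting one variable separates it into two real
  Gaussian Fourier transforms, so no complex-parameter Gaussian integral is needed.
\<close>

lemma chirp_integral_norm:
  "(cmod (LINT z|lborel. chirp X T z))\<^sup>2 = 2 * pi / sqrt (1 + T\<^sup>2) * exp (- (X\<^sup>2 / (1 + T\<^sup>2)))"
proof -
  let ?\<phi> = "chirp X T"
  let ?A = "LINT z|lborel. ?\<phi> z"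
  have T: "0 < 1 + T\<^sup>2" by (smt (verit) zero_le_power2)
  define K where "K p w = ?\<phi> (w + p) * cnj (?\<phi> w)" for p w
  have shift: "(LINT p|lborel. f (w + p)) = (LINT p|lborel. f p)" for f :: "real \<Rightarrow> 'b::{banach, second_countable_topology}" and w :: real
    using lborel_integral_real_affine[of 1 f w] by simp
  have ishift: "integrable lborel (\<lambda>p. ?\<phi> (w + p))" for w
    using lborel_integrable_real_affine[OF chirp_integrable, of 1 X T w] by simp
  have iK: "integrable (lborel \<Otimes>\<^sub>M lborel) (\<lambda>(w, p). K p w)"
  proof (rule lborel_pair.Fubini_integrable)
    show "(\<lambda>(w, p). K p w) \<in> borel_measurable (lborel \<Otimes>\<^sub>M lborel)" unfolding K_def by measurable
    have "(LINT p|lborel. cmod (K p w)) = (LINT p|lborel. cmod (?\<phi> p)) * cmod (?\<phi> w)" for w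
      unfolding K_def by (simp add: norm_mult shift[of "\<lambda>p. cmod (?\<phi> p)"])
    then show "integrable lborel (\<lambda>w. LINT p|lborel. cmod (case (w, p) of (w, p) \<Rightarrow> K p w))"
      using chirp_integrable[of X T] by simp
    show "AE w in lborel. integrable lborel (\<lambda>p. case (w, p) of (w, p) \<Rightarrow> K p w)"
      using ishift by (simp add: K_def)
  qed
  have "complex_of_real ((cmod ?A)\<^sup>2) = ?A * cnj ?A" by (rule complex_norm_square)
  also have "\<dots> = (LINT w|lborel. ?A * cnj (?\<phi> w))" by simp
  also have "\<dots> = (LINT w|lborel. LINT p|lborel. K p w)"
    unfolding K_def by (simp add: shift[of ?\<phi>])
  also have "\<dots> = (LINT p|lborel. LINT w|lborel. K p w)"
    by (rule lborel_pair.Fubini_integral[OF iK, symmetric])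
  also have "\<dots> = (LINT p|lborel. complex_of_real (sqrt pi) * (exp (\<i> * complex_of_real (X * p)) * complex_of_real (exp (- ((1 + T\<^sup>2) / 4 * p\<^sup>2)))))"
  proof (intro Bochner_Integration.integral_cong refl)
    fix p :: real
    let ?g = "\<lambda>q. exp (\<i> * complex_of_real ((T * p) * q)) * complex_of_real (exp (- (1 * q\<^sup>2)))"
    let ?c = "exp (\<i> * complex_of_real (X * p)) * complex_of_real (exp (- (1/4 * p\<^sup>2)))"
    have "(LINT w|lborel. K p w) = ?c * (LINT w|lborel. ?g (p / 2 + 1 * w))"
      unfolding K_def chirp_product by (rule integral_mult_right_zero)
    also have "(LINT w|lborel. ?g (p / 2 + 1 * w)) = (LINT q|lborel. ?g q)"
      using lborel_integral_real_affine[of 1 ?g "p / 2"] by simp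
    also have "\<dots> = complex_of_real (sqrt (pi / 1) * exp (- ((T * p)\<^sup>2 / (4 * 1))))"
      by (rule gaussian_fourier) simp
    also have "?c * complex_of_real (sqrt (pi / 1) * exp (- ((T * p)\<^sup>2 / (4 * 1))))
      = complex_of_real (sqrt pi) * (exp (\<i> * complex_of_real (X * p)) * complex_of_real (exp (- (1/4 * p\<^sup>2)) * exp (- ((T * p)\<^sup>2 / (4 * 1)))))"
      by (simp only: of_real_mult div_by_1 ac_simps)
    also have "exp (- (1/4 * p\<^sup>2)) * exp (- ((T * p)\<^sup>2 / (4 * 1))) = exp (- ((1 + T\<^sup>2) / 4 * p\<^sup>2))"
      by (simp add: exp_add[symmetric] power_mult_distrib field_simps)
    finally show "(LINT w|lborel. K p w) = complex_of_real (sqrt pi) * (exp (\<i> * complex_of_real (X * p)) * complex_of_real (exp (- ((1 + T\<^sup>2) / 4 * p\<^sup>2))))" .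
  qed
  also have "\<dots> = complex_of_real (sqrt pi) * complex_of_real (sqrt (pi / ((1 + T\<^sup>2) / 4)) * exp (- (X\<^sup>2 / (4 * ((1 + T\<^sup>2) / 4)))))"
    using T by (subst integral_mult_right_zero, subst gaussian_fourier) auto
  also have "\<dots> = complex_of_real (sqrt pi * sqrt (pi / ((1 + T\<^sup>2) / 4)) * exp (- (X\<^sup>2 / (4 * ((1 + T\<^sup>2) / 4)))))"
    by (simp only: of_real_mult mult.assoc)
  finally have "(cmod ?A)\<^sup>2 = sqrt pi * sqrt (pi / ((1 + T\<^sup>2) / 4)) * exp (- (X\<^sup>2 / (4 * ((1 + T\<^sup>2) / 4))))"
    by (simp only: of_real_eq_iff)
  moreover have "sqrt pi * sqrt (pi / ((1 + T\<^sup>2) / 4)) = 2 * pi / sqrt (1 + T\<^sup>2)"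
  proof -
    have "sqrt pi * sqrt (pi / ((1 + T\<^sup>2) / 4)) = sqrt ((2 * pi)\<^sup>2 / (1 + T\<^sup>2))"
      by (simp add: real_sqrt_mult[symmetric] power2_eq_square)
    also have "\<dots> = 2 * pi / sqrt (1 + T\<^sup>2)" unfolding real_sqrt_divide real_sqrt_abs by simp
    finally show ?thesis .
  qed
  moreover have "4 * ((1 + T\<^sup>2) / 4) = 1 + T\<^sup>2" by simp
  ultimately show ?thesis by (simp only:)
qed

text \<open>The X-integral leaves a multiple of 1 / (1 + T^2), whose T-integral is \<pi>. As
  \<open>pi * sqrt pi\<close> is the sixth power of the L2 norm of exp (-z^2 / 2) on the line, this
  Gaussian realises the ratio \<open>sharp6\<close> on the parabola.\<close>

lemma chirp_sixth_moment:
  "(\<integral>\<^sup>+T. \<integral>\<^sup>+X. ennreal (cmod (LINT z|lborel. chirp X T z) ^ 6) \<partial>lborel \<partial>lborel) = ennreal (sharp6 * (pi * sqrt pi))"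
proof -
  have "(\<integral>\<^sup>+X. ennreal (cmod (LINT z|lborel. chirp X T z) ^ 6) \<partial>lborel)
    = ennreal (8 * pi ^ 3 * sqrt (pi / 3)) * ennreal (1 / (1 + T\<^sup>2))" for T
  proof -
    have T: "0 < 1 + T\<^sup>2" by (smt (verit) zero_le_power2)
    define R where "R = sqrt (1 + T\<^sup>2)"
    have R: "0 < R" "R\<^sup>2 = 1 + T\<^sup>2" using T by (auto simp: R_def)
    have "cmod (LINT z|lborel. chirp X T z) ^ 6 = (2 * pi / R) ^ 3 * exp (- (3 / R\<^sup>2 * X\<^sup>2))" for X
    proof -
      have "cmod (LINT z|lborel. chirp X T z) ^ 6 = ((cmod (LINT z|lborel. chirp X T z))\<^sup>2) ^ 3"
        by (simp flip: power_mult)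
      also have "\<dots> = (2 * pi / R) ^ 3 * (exp (- (X\<^sup>2 / R\<^sup>2))) ^ 3"
        unfolding chirp_integral_norm R_def[symmetric] unfolding R(2)[symmetric] by (rule power_mult_distrib)
      also have "(exp (- (X\<^sup>2 / R\<^sup>2))) ^ 3 = exp (- (3 / R\<^sup>2 * X\<^sup>2))"
        by (simp flip: exp_of_nat_mult)
      finally show ?thesis .
    qed
    then have "(\<integral>\<^sup>+X. ennreal (cmod (LINT z|lborel. chirp X T z) ^ 6) \<partial>lborel)
      = (\<integral>\<^sup>+X. ennreal ((2 * pi / R) ^ 3) * ennreal (exp (- (3 / R\<^sup>2 * X\<^sup>2))) \<partial>lborel)"
      using R(1) by (intro nn_integral_cong) (simp add: ennreal_mult)
    also have "\<dots> = ennreal ((2 * pi / R) ^ 3) * ennreal (sqrt (pi / (3 / R\<^sup>2)))"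
      using R(1) by (subst nn_integral_cmult, measurable, subst gaussian_nn_integral) simp_all
    also have "sqrt (pi / (3 / R\<^sup>2)) = sqrt (pi / 3) * R"
      using R(1) by (simp add: real_sqrt_mult real_sqrt_divide)
    also have "ennreal ((2 * pi / R) ^ 3) * ennreal (sqrt (pi / 3) * R) = ennreal (8 * pi ^ 3 * sqrt (pi / 3) * (1 / R\<^sup>2))"
      using R(1) by (subst ennreal_mult[symmetric]) (auto simp: power_divide power_mult_distrib power2_eq_square power3_eq_cube)
    also have "\<dots> = ennreal (8 * pi ^ 3 * sqrt (pi / 3)) * ennreal (1 / R\<^sup>2)"
      by (rule ennreal_mult) auto
    finally show ?thesis unfolding R(2) .
  qed
  then have "(\<integral>\<^sup>+T. \<integral>\<^sup>+X. ennreal (cmod (LINT z|lborel. chirp X T z) ^ 6) \<partial>lborel \<partial>lborel)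
     = ennreal (8 * pi ^ 3 * sqrt (pi / 3)) * ennreal pi"
    by (simp only:) (subst nn_integral_cmult, measurable, simp only: nn_integral_inverse_square)
  also have "\<dots> = ennreal (8 * pi ^ 3 * sqrt (pi / 3) * pi)" by (rule ennreal_mult[symmetric]) auto
  also have "8 * pi ^ 3 * sqrt (pi / 3) * pi = sharp6 * (pi * sqrt pi)"
    by (simp add: sharp6_def real_sqrt_divide power3_eq_cube power2_eq_square)
  finally show ?thesis .
qed

section \<open>Test functions on the hyperboloid\<close>

text \<open>A Gaussian of width 1 / s, so that growing \<open>s\<close> concentrates it at the
  vertex y = 0.\<close>

definition gauss_test :: "real \<Rightarrow> real \<Rightarrow> complex" where
  "gauss_test s y = complex_of_real (exp (- (s\<^sup>2 * y\<^sup>2 / 2)))"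

lemma gauss_test_schwartz: assumes s: "0 < s" shows "schwartz (gauss_test s)"
proof -
  have "((y - 0) / (2 / s))\<^sup>2 - 1 \<le> poly [:0, 0, s\<^sup>2 / 2:] y" for y
  proof -
    have "0 \<le> (s * y)\<^sup>2" by simp
    then show ?thesis by (simp add: power2_eq_square algebra_simps)
  qed
  then have "schwartz (\<lambda>y. complex_of_real (poly 1 y * exp (- poly [:0, 0, s\<^sup>2 / 2:] y)))"
    using s by (intro schwartz_poly_exp[of "2 / s" 0]) auto
  then show ?thesis by (simp add: gauss_test_def[abs_def] power2_eq_square ac_simps)
qed

text \<open>Dropping the weight \<open>1 / jbracket y\<close> only enlarges the integral. The norm
  enters the sharpness argument on the larger side, so no asymptotics for it are needed.\<close>

lemma gauss_test_norm_le:
  assumes s: "0 < s" shows "(Lp_norm hyp_measure 2 (gauss_test s))\<^sup>2 \<le> sqrt pi / s"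
proof -
  have [measurable]: "gauss_test s \<in> borel_measurable borel" by (rule schwartz_measurable[OF gauss_test_schwartz[OF s]])
  have e: "(cmod (gauss_test s y))\<^sup>2 = exp (- (s\<^sup>2 * y\<^sup>2))" for y
    by (simp add: gauss_test_def flip: exp_double)
  have "ennreal ((Lp_norm hyp_measure 2 (gauss_test s))\<^sup>2) = (\<integral>\<^sup>+y. ennreal ((cmod (gauss_test s y))\<^sup>2) \<partial>hyp_measure)"
    using nn_integral_Lp[OF _ schwartz_L2[OF gauss_test_schwartz[OF s]]] by simp
  also have "\<dots> \<le> (\<integral>\<^sup>+y. ennreal ((cmod (gauss_test s y))\<^sup>2) \<partial>lborel)"
    by (rule nn_integral_hyp_le_lborel) measurable
  also have "\<dots> = ennreal (sqrt (pi / s\<^sup>2))" unfolding e using s by (intro gaussian_nn_integral) simp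
  finally show ?thesis using s by (simp add: real_sqrt_divide)
qed

lemma gauss_test_nonzero: assumes s: "0 < s" shows "gauss_test s \<in> nonzero_L2"
proof -
  have "\<not> (AE y in hyp_measure. gauss_test s y = 0)"
  proof
    assume "AE y in hyp_measure. gauss_test s y = 0"
    then have "AE y in hyp_measure. False" by (simp add: gauss_test_def)
    then have "AE y in (lborel :: real measure). False" unfolding hyp_measure_def by (subst (asm) AE_density) auto
    then obtain N :: "real set" where "UNIV \<subseteq> N" "emeasure lborel N = 0" by (auto elim!: AE_E)
    then show False by (simp add: top.extremum_unique)
  qed
  then show ?thesis using schwartz_L2[OF gauss_test_schwartz[OF s]] by (simp add: nonzero_L2_def)
qed

text \<open>
  The integrand of the extension of \<open>gauss_test s\<close> at \<open>(s X, s\<^sup>2 T)\<close> after the substitution \<open>y = z / s\<close>,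
  without the unimodular factor \<open>exp (\<i> s\<^sup>2 T)\<close>; here \<open>s\<^sup>2 (jbracket (z / s) - 1) = z\<^sup>2 / (1 + jbracket (z / s))\<close>.
\<close>

definition scaled :: "real \<Rightarrow> real \<Rightarrow> real \<Rightarrow> real \<Rightarrow> complex" where
  "scaled s X T z = (1 / jbracket (z / s)) *\<^sub>R (exp (\<i> * complex_of_real (X * z + T * (z\<^sup>2 / (1 + jbracket (z / s))))) * complex_of_real (exp (- (1/2 * z\<^sup>2))))"

lemma scaled_measurable [measurable]:
  assumes [measurable]: "f \<in> borel_measurable M" "g \<in> borel_measurable M" "h \<in> borel_measurable M"
  shows "(\<lambda>x. scaled s (f x) (g x) (h x)) \<in> borel_measurable M"
  unfolding scaled_def by measurable

lemma extension_gauss_test_scaled: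
  assumes s: "0 < s"
  shows "cmod (extension_integral (gauss_test s) (s * X, s\<^sup>2 * T)) = (1 / s) * cmod (LINT z|lborel. scaled s X T z)"
proof -
  have gm [measurable]: "gauss_test s \<in> borel_measurable borel" by (rule schwartz_measurable[OF gauss_test_schwartz[OF s]])
  let ?p = "(s * X, s\<^sup>2 * T)"
  have "extension_integral (gauss_test s) ?p = (LINT y|lborel. (1 / jbracket y) *\<^sub>R (planewave ?p y * gauss_test s y))"
    unfolding extension_integral_eq hyp_measure_def by (subst integral_density) auto
  also have "\<dots> = \<bar>1 / s\<bar> *\<^sub>R (LINT z|lborel. (1 / jbracket (0 + 1 / s * z)) *\<^sub>R (planewave ?p (0 + 1 / s * z) * gauss_test s (0 + 1 / s * z)))"
    using s by (intro lborel_integral_real_affine) simp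
  also have "(LINT z|lborel. (1 / jbracket (0 + 1 / s * z)) *\<^sub>R (planewave ?p (0 + 1 / s * z) * gauss_test s (0 + 1 / s * z)))
     = (LINT z|lborel. exp (\<i> * complex_of_real (s\<^sup>2 * T)) * scaled s X T z)"
  proof (intro Bochner_Integration.integral_cong refl)
    fix z :: real
    define j where "j = jbracket (z / s)"
    have j: "0 < 1 + j" "j\<^sup>2 = 1 + (z / s)\<^sup>2" by (auto simp: j_def jbracket_sq add_pos_pos)
    have "s\<^sup>2 * (j - 1) = z\<^sup>2 / (1 + j)"
    proof -
      have "(j - 1) * (1 + j) = z\<^sup>2 / s\<^sup>2" using j(2) by (simp add: power2_eq_square algebra_simps)
      then have "s\<^sup>2 * ((j - 1) * (1 + j)) = z\<^sup>2" using s by simp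
      then show ?thesis using j(1) by (simp add: field_simps)
    qed
    then have "s\<^sup>2 * T * j = s\<^sup>2 * T + T * (z\<^sup>2 / (1 + j))" by (simp add: algebra_simps flip: \<open>s\<^sup>2 * (j - 1) = z\<^sup>2 / (1 + j)\<close>)
    moreover have "s * X * (0 + 1 / s * z) = X * z" using s by simp
    ultimately have pw: "planewave ?p (0 + 1 / s * z) = exp (\<i> * complex_of_real (s\<^sup>2 * T)) * exp (\<i> * complex_of_real (X * z + T * (z\<^sup>2 / (1 + j))))"
    proof -
      assume A: "s\<^sup>2 * T * j = s\<^sup>2 * T + T * (z\<^sup>2 / (1 + j))" and B: "s * X * (0 + 1 / s * z) = X * z"
      have h: "jbracket (0 + 1 / s * z) = j" by (simp add: j_def)
      have E: "exp (\<i> * complex_of_real (a + b)) = exp (\<i> * complex_of_real a) * exp (\<i> * complex_of_real b)" for a b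
        by (simp add: distrib_left exp_add)
      have "planewave ?p (0 + 1 / s * z) = exp (\<i> * complex_of_real (X * z)) * exp (\<i> * complex_of_real (s\<^sup>2 * T + T * (z\<^sup>2 / (1 + j))))"
        unfolding planewave_def fst_conv snd_conv h A B ..
      then show ?thesis unfolding E by (simp only: mult.left_commute)
    qed
    have g: "gauss_test s (0 + 1 / s * z) = complex_of_real (exp (- (1/2 * z\<^sup>2)))"
      using s by (simp add: gauss_test_def power_divide)
    have z: "0 + 1 / s * z = z / s" by simp
    show "(1 / jbracket (0 + 1 / s * z)) *\<^sub>R (planewave ?p (0 + 1 / s * z) * gauss_test s (0 + 1 / s * z))
      = exp (\<i> * complex_of_real (s\<^sup>2 * T)) * scaled s X T z"
      unfolding pw g scaled_def j_def[symmetric] unfolding z j_def[symmetric]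
      by (simp only: scaleR_conv_of_real ac_simps)
  qed
  also have "\<dots> = exp (\<i> * complex_of_real (s\<^sup>2 * T)) * (LINT z|lborel. scaled s X T z)"
    by (rule integral_mult_right_zero)
  finally show ?thesis using s by (simp add: norm_mult norm_scaleR)
qed

lemma scaled_tendsto:
  "(\<lambda>n. LINT z|lborel. scaled (real (Suc n)) X T z) \<longlonglongrightarrow> (LINT z|lborel. chirp X T z)"
proof (rule integral_dominated_convergence[where w="\<lambda>z. exp (- (1/2 * z\<^sup>2))"])
  show "integrable lborel (\<lambda>z::real. exp (- (1/2 * z\<^sup>2)))" by (rule gaussian_integrable) simp
  show "AE z in lborel. norm (scaled (real (Suc n)) X T z) \<le> exp (- (1/2 * z\<^sup>2))" for n
  proof (rule AE_I2)
    fix z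
    have "norm (scaled (real (Suc n)) X T z) = (1 / jbracket (z / real (Suc n))) * exp (- (1/2 * z\<^sup>2))"
      unfolding scaled_def norm_scaleR norm_mult norm_exp_i_times norm_of_real by simp
    also have "\<dots> \<le> 1 * exp (- (1/2 * z\<^sup>2))" by (intro mult_right_mono) auto
    finally show "norm (scaled (real (Suc n)) X T z) \<le> exp (- (1/2 * z\<^sup>2))" by simp
  qed
  show "AE z in lborel. (\<lambda>n. scaled (real (Suc n)) X T z) \<longlonglongrightarrow> chirp X T z"
  proof (rule AE_I2)
    fix z :: real
    have l: "(\<lambda>n. z / real (Suc n)) \<longlonglongrightarrow> 0" by (rule LIMSEQ_Suc[OF lim_const_over_n])
    have "(\<lambda>n. jbracket (z / real (Suc n))) \<longlonglongrightarrow> sqrt (1 + 0\<^sup>2)"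
      unfolding jbracket_def by (intro tendsto_intros l)
    then have j: "(\<lambda>n. jbracket (z / real (Suc n))) \<longlonglongrightarrow> 1" by simp
    have "(\<lambda>n. scaled (real (Suc n)) X T z) \<longlonglongrightarrow> (1 / 1) *\<^sub>R (exp (\<i> * complex_of_real (X * z + T * (z\<^sup>2 / (1 + 1)))) * complex_of_real (exp (- (1/2 * z\<^sup>2))))"
      unfolding scaled_def by (intro tendsto_intros j) auto
    then show "(\<lambda>n. scaled (real (Suc n)) X T z) \<longlonglongrightarrow> chirp X T z" by (simp add: chirp_def)
  qed
qed measurable

text \<open>In the variables (X, T) with x = s X, t = s^2 T the Jacobian is s^3, while the prefactor
  1 / s gives s^(-6). Multiplication by s^3 balances these powers and also the norm bound (sqrt
  \<pi> / s)^3, so the inequality becomes uniform in \<open>s\<close>. Fatou, once in each variable,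
  suffices because the limit has to be bounded only from above.\<close>

lemma gauss_test_asymptotic_sharpness:
  assumes c: "0 \<le> c" and le: "\<And>s. 0 < s \<Longrightarrow> Lp_norm lborel 6 (extension_integral (gauss_test s)) \<le> c * Lp_norm hyp_measure 2 (gauss_test s)"
  shows "sharp6 \<le> c ^ 6"
proof -
  have each: "(\<integral>\<^sup>+T. \<integral>\<^sup>+X. ennreal (cmod (LINT z|lborel. scaled s X T z) ^ 6) \<partial>lborel \<partial>lborel) \<le> ennreal (c ^ 6 * (pi * sqrt pi))"
    if s: "0 < s" for s
  proof -
    define G where "G p = ennreal (cmod (extension_integral (gauss_test s) p) ^ 6)" for p
    have [measurable]: "gauss_test s \<in> borel_measurable borel" by (rule schwartz_measurable[OF gauss_test_schwartz[OF s]])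
    have Gm [measurable]: "G \<in> borel_measurable borel" unfolding G_def by measurable
    have [measurable]: "(\<lambda>x. G (f x, g x)) \<in> borel_measurable M" if "f \<in> borel_measurable M" "g \<in> borel_measurable M" for f g and M :: "'x measure"
    proof -
      have "G \<in> borel_measurable (borel \<Otimes>\<^sub>M borel)" using Gm unfolding borel_prod .
      from measurable_compose[OF measurable_Pair[OF that] this] show ?thesis .
    qed
    have N6: "s ^ 3 * Lp_norm lborel 6 (extension_integral (gauss_test s)) ^ 6 \<le> c ^ 6 * (pi * sqrt pi)"
    proof -
      have "Lp_norm lborel 6 (extension_integral (gauss_test s)) ^ 6 \<le> (c * Lp_norm hyp_measure 2 (gauss_test s)) ^ 6"
        by (intro power_mono le s) auto
      also have "\<dots> = c ^ 6 * ((Lp_norm hyp_measure 2 (gauss_test s))\<^sup>2) ^ 3"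
        by (simp add: power_mult_distrib flip: power_mult)
      also have "\<dots> \<le> c ^ 6 * (sqrt pi / s) ^ 3"
        using c by (intro mult_left_mono power_mono gauss_test_norm_le s) auto
      finally have "s ^ 3 * Lp_norm lborel 6 (extension_integral (gauss_test s)) ^ 6 \<le> s ^ 3 * (c ^ 6 * (sqrt pi / s) ^ 3)"
        using s by (intro mult_left_mono) auto
      also have "\<dots> = c ^ 6 * (pi * sqrt pi)" using s by (simp add: power_divide power3_eq_cube)
      finally show ?thesis .
    qed
    have "(\<integral>\<^sup>+p. G p \<partial>lborel) = ennreal (Lp_norm lborel 6 (extension_integral (gauss_test s)) ^ 6)"
      using nn_integral_Lp[OF _ schwartz_extension_L6[OF gauss_test_schwartz[OF s]]] by (simp add: G_def)
    moreover have "(\<integral>\<^sup>+p. G p \<partial>lborel) = (\<integral>\<^sup>+t. \<integral>\<^sup>+x. G (x, t) \<partial>lborel \<partial>lborel)"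
      unfolding lborel_prod[symmetric] by (rule lborel_pair.nn_integral_snd[symmetric]) (simp add: lborel_prod)
    moreover have "(\<integral>\<^sup>+t. \<integral>\<^sup>+x. G (x, t) \<partial>lborel \<partial>lborel) = ennreal (s\<^sup>2) * (\<integral>\<^sup>+T. ennreal s * (\<integral>\<^sup>+X. G (s * X, s\<^sup>2 * T) \<partial>lborel) \<partial>lborel)"
    proof -
      have inner: "(\<integral>\<^sup>+x. G (x, s\<^sup>2 * T) \<partial>lborel) = ennreal s * (\<integral>\<^sup>+X. G (s * X, s\<^sup>2 * T) \<partial>lborel)" for T
        using s by (subst nn_integral_real_affine[where c=s and t=0]) auto
      have "(\<integral>\<^sup>+t. \<integral>\<^sup>+x. G (x, t) \<partial>lborel \<partial>lborel) = ennreal (s\<^sup>2) * (\<integral>\<^sup>+T. \<integral>\<^sup>+x. G (x, s\<^sup>2 * T) \<partial>lborel \<partial>lborel)"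
        using s by (subst nn_integral_real_affine[where c="s\<^sup>2" and t=0]) auto
      then show ?thesis by (simp only: inner)
    qed
    ultimately have "ennreal (Lp_norm lborel 6 (extension_integral (gauss_test s)) ^ 6) = ennreal (s\<^sup>2) * (\<integral>\<^sup>+T. ennreal s * (\<integral>\<^sup>+X. G (s * X, s\<^sup>2 * T) \<partial>lborel) \<partial>lborel)"
      by simp
    then have "ennreal (s ^ 3) * ennreal (Lp_norm lborel 6 (extension_integral (gauss_test s)) ^ 6)
      = (\<integral>\<^sup>+T. \<integral>\<^sup>+X. ennreal (s ^ 3) * (ennreal (s\<^sup>2) * (ennreal s * G (s * X, s\<^sup>2 * T))) \<partial>lborel \<partial>lborel)"
      by (simp add: nn_integral_cmult)
    also have "\<dots> = (\<integral>\<^sup>+T. \<integral>\<^sup>+X. ennreal (cmod (LINT z|lborel. scaled s X T z) ^ 6) \<partial>lborel \<partial>lborel)"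
    proof (intro nn_integral_cong)
      fix T X :: real
      have "s ^ 3 * (s\<^sup>2 * (s * (((1 / s) * C) ^ 6))) = C ^ 6" for C
        using s by (simp add: power_divide power2_eq_square power3_eq_cube field_simps) (simp add: eval_nat_numeral)
      then show "ennreal (s ^ 3) * (ennreal (s\<^sup>2) * (ennreal s * G (s * X, s\<^sup>2 * T))) = ennreal (cmod (LINT z|lborel. scaled s X T z) ^ 6)"
        unfolding G_def extension_gauss_test_scaled[OF s] using s by (simp only: ennreal_mult[symmetric] zero_le_power less_imp_le zero_le_mult_iff norm_ge_zero zero_le_divide_1_iff simp_thms)
    qed
    finally have "(\<integral>\<^sup>+T. \<integral>\<^sup>+X. ennreal (cmod (LINT z|lborel. scaled s X T z) ^ 6) \<partial>lborel \<partial>lborel)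
      = ennreal (s ^ 3 * Lp_norm lborel 6 (extension_integral (gauss_test s)) ^ 6)"
      using s by (simp add: ennreal_mult)
    then show ?thesis using N6 by (simp add: ennreal_leI)
  qed
  have lim6: "(\<lambda>n. ennreal (cmod (LINT z|lborel. scaled (real (Suc n)) X T z) ^ 6)) \<longlonglongrightarrow> ennreal (cmod (LINT z|lborel. chirp X T z) ^ 6)" for X T
    by (intro tendsto_ennrealI tendsto_power tendsto_norm scaled_tendsto)
  have li: "ennreal (cmod (LINT z|lborel. chirp X T z) ^ 6) = liminf (\<lambda>n. ennreal (cmod (LINT z|lborel. scaled (real (Suc n)) X T z) ^ 6))" for X T
    by (rule lim_imp_Liminf[OF trivial_limit_sequentially lim6, symmetric])
  have "ennreal (sharp6 * (pi * sqrt pi)) = (\<integral>\<^sup>+T. \<integral>\<^sup>+X. liminf (\<lambda>n. ennreal (cmod (LINT z|lborel. scaled (real (Suc n)) X T z) ^ 6)) \<partial>lborel \<partial>lborel)"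
    unfolding chirp_sixth_moment[symmetric] li ..
  also have "\<dots> \<le> (\<integral>\<^sup>+T. liminf (\<lambda>n. \<integral>\<^sup>+X. ennreal (cmod (LINT z|lborel. scaled (real (Suc n)) X T z) ^ 6) \<partial>lborel) \<partial>lborel)"
    by (intro nn_integral_mono nn_integral_liminf) measurable
  also have "\<dots> \<le> liminf (\<lambda>n. \<integral>\<^sup>+T. \<integral>\<^sup>+X. ennreal (cmod (LINT z|lborel. scaled (real (Suc n)) X T z) ^ 6) \<partial>lborel \<partial>lborel)"
    by (intro nn_integral_liminf) measurable
  also have "\<dots> \<le> liminf (\<lambda>n::nat. ennreal (c ^ 6 * (pi * sqrt pi)))"
    by (intro Liminf_mono always_eventually allI each) simp
  also have "\<dots> = ennreal (c ^ 6 * (pi * sqrt pi))" by (simp add: Liminf_const)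
  finally have "sharp6 * (pi * sqrt pi) \<le> c ^ 6 * (pi * sqrt pi)"
    using c by (subst (asm) ennreal_le_iff) auto
  then show ?thesis by (rule mult_right_le_imp_le) simp
qed

section \<open>The value of the constant and the absence of extremizers\<close>

lemma root_sharp6: "root 6 sharp6 = 3 powr (- 1 / 12) * (2 * pi) powr (1 / 2)"
proof (rule real_root_pos_unique)
  have "(3 powr (- 1 / 12) * (2 * pi) powr (1 / 2)) ^ 6 = 3 powr (- 1 / 12 * 6) * (2 * pi) powr (1 / 2 * 6)"
    unfolding power_mult_distrib by (subst (1 2) powr_power) auto
  also have "- 1 / 12 * 6 = - (1 / 2 :: real)" by simp
  also have "1 / 2 * 6 = (3 :: real)" by simp
  also have "3 powr (- (1 / 2)) = 1 / sqrt (3 :: real)"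
    unfolding powr_minus_divide by (subst powr_half_sqrt) auto
  also have "(2 * pi) powr 3 = (2 * pi) ^ 3" by (rule powr_numeral) simp
  also have "1 / sqrt 3 * (2 * pi) ^ 3 = sharp6"
    by (simp add: sharp6_def power3_eq_cube power2_eq_square)
  finally show "(3 powr (- 1 / 12) * (2 * pi) powr (1 / 2)) ^ 6 = sharp6" .
qed auto

lemma nonzero_L2_norm_pos:
  assumes "f \<in> nonzero_L2" shows "0 < Lp_norm hyp_measure 2 f"
proof (rule ccontr)
  assume "\<not> 0 < Lp_norm hyp_measure 2 f"
  then have "Lp_norm hyp_measure 2 f = 0" using Lp_norm_nonneg[of hyp_measure 2 f] by linarith
  moreover have fL: "f \<in> Lp_space hyp_measure 2" using assms by (simp add: nonzero_L2_def)
  ultimately have "(\<integral>\<^sup>+y. ennreal (cmod (f y) powr 2) \<partial>hyp_measure) = 0" by (simp add: nn_integral_Lp del: powr_numeral)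
  then have "AE y in hyp_measure. ennreal (cmod (f y) powr 2) = 0"
    using Lp_spaceD(1)[OF fL] by (subst (asm) nn_integral_0_iff_AE) auto
  then have "AE y in hyp_measure. f y = 0" by eventually_elim simp
  then show False using assms by (simp add: nonzero_L2_def)
qed

lemma extension_op_strict:
  assumes f: "f \<in> nonzero_L2"
  shows "Lp_norm lborel 6 (extension_op f) < root 6 sharp6 * Lp_norm hyp_measure 2 f"
proof (rule is_extension_strict[OF f])
  have "\<exists>F. is_extension f F" using f by (intro is_extension_exists) (simp add: nonzero_L2_def)
  then show "is_extension f (extension_op f)" unfolding extension_op_def by (rule someI_ex)
qed

lemma extension_op_schwartz_norm:
  assumes f: "schwartz f" shows "Lp_norm lborel 6 (extension_op f) = Lp_norm lborel 6 (extension_integral f)"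
  unfolding extension_op_def
  by (rule is_extension_schwartz_norm[OF f]) (rule someI[of "is_extension f", OF is_extension_schwartz[OF f]])

text \<open>The upper bound is the strict inequality divided by the norm. For the lower bound the
  supremum itself is used as an admissible constant for all test Gaussians.\<close>

lemma optimal_constant_eq: "optimal_constant = ereal (root 6 sharp6)"
proof (rule antisym)
  show le: "optimal_constant \<le> ereal (root 6 sharp6)"
    unfolding optimal_constant_def
  proof (rule SUP_least)
    fix f assume f: "f \<in> nonzero_L2"
    show "ereal (Lp_norm lborel 6 (extension_op f) / Lp_norm hyp_measure 2 f) \<le> ereal (root 6 sharp6)"
      using extension_op_strict[OF f] nonzero_L2_norm_pos[OF f] by (simp add: divide_le_eq)
  qed
  have ratio: "ereal (Lp_norm lborel 6 (extension_op (gauss_test s)) / Lp_norm hyp_measure 2 (gauss_test s)) \<le> optimal_constant"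
    if "0 < s" for s
    unfolding optimal_constant_def by (rule SUP_upper[OF gauss_test_nonzero[OF that]])
  \<comment> \<open>A single quotient keeps the supremum at or above 0; with the upper bound this
    makes it a real number \<open>c\<close>, to which the sharpness argument applies.\<close>
  have "0 \<le> ereal (Lp_norm lborel 6 (extension_op (gauss_test 1)) / Lp_norm hyp_measure 2 (gauss_test 1))" by simp
  also have "\<dots> \<le> optimal_constant" by (rule ratio) simp
  finally have "0 \<le> optimal_constant" .
  have "\<exists>c. S = ereal c \<and> 0 \<le> c" if "0 \<le> S" "S \<le> ereal (root 6 sharp6)" for S :: ereal
    using that by (cases S) auto
  from this[OF \<open>0 \<le> optimal_constant\<close> le]
  obtain c where c: "optimal_constant = ereal c" "0 \<le> c" by blast
  have "sharp6 \<le> c ^ 6"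
  proof (rule gauss_test_asymptotic_sharpness[OF c(2)])
    fix s :: real assume s: "0 < s"
    show "Lp_norm lborel 6 (extension_integral (gauss_test s)) \<le> c * Lp_norm hyp_measure 2 (gauss_test s)"
      using ratio[OF s] nonzero_L2_norm_pos[OF gauss_test_nonzero[OF s]]
      unfolding c(1) extension_op_schwartz_norm[OF gauss_test_schwartz[OF s]] by (simp add: divide_le_eq)
  qed
  then have "root 6 sharp6 \<le> root 6 (c ^ 6)" by simp
  also have "\<dots> = c" using c(2) by (simp add: real_root_power_cancel)
  finally show "ereal (root 6 sharp6) \<le> optimal_constant" unfolding c(1) by simp
qed

theorem theorem1:
  shows "optimal_constant = ereal (3 powr (- 1 / 12) * (2 * pi) powr (1 / 2))
    \<and> \<not> (\<exists>f \<in> nonzero_L2.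
           ereal (Lp_norm lborel 6 (extension_op f))
             = optimal_constant * ereal (Lp_norm hyp_measure 2 f))"
proof
  show "optimal_constant = ereal (3 powr (- 1 / 12) * (2 * pi) powr (1 / 2))"
    unfolding optimal_constant_eq root_sharp6 ..
  show "\<not> (\<exists>f \<in> nonzero_L2. ereal (Lp_norm lborel 6 (extension_op f)) = optimal_constant * ereal (Lp_norm hyp_measure 2 f))"
  proof
    assume "\<exists>f \<in> nonzero_L2. ereal (Lp_norm lborel 6 (extension_op f)) = optimal_constant * ereal (Lp_norm hyp_measure 2 f)"
    then obtain f where f: "f \<in> nonzero_L2"
      and eq: "ereal (Lp_norm lborel 6 (extension_op f)) = optimal_constant * ereal (Lp_norm hyp_measure 2 f)" by blast
    from eq have "Lp_norm lborel 6 (extension_op f) = root 6 sharp6 * Lp_norm hyp_measure 2 f"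
      by (simp add: optimal_constant_eq)
    then show False using extension_op_strict[OF f] by simp
  qed
qed

end
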